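(* Let $f:\mathbb{R}\to\mathbb{R}$ be a real analytic function of period $1$. Suppose $\alpha\in\Omega$ and $\gamma(E,\alpha)>0$ for Lebesgue almost every $E$. Then for any $\delta>0$ there exist a set $A(\delta)\subset S(\alpha)$ with $|A(\delta)|<\delta$ and constants $h(\alpha,\delta)>0$, $c(\alpha,\delta)>0$ such that for any $E\in S(\alpha)\setminus A(\delta)$ and any real $\alpha'$ with $|\alpha-\alpha'|<h(\alpha,\delta)$ there exists $E'\in S(\alpha')$ with $$|E'-E|<c(\alpha,\delta)\,\bigl|(\alpha-\alpha')\ln^3|\alpha-\alpha'|\bigr|.$$ The constant $c$ is independent of $E$, $E'$, $\alpha'$.
   Context: For $\alpha,\theta\in\mathbb{R}$, $H_{\alpha,\theta}$ is the operator on $\ell^2(\mathbb{Z})$ given by $(H_{\alpha,\theta}\psi)(n)=\psi(n-1)+\psi(n+1)+f(\alpha n+\theta)\psi(n)$; $S(\alpha,\theta)$ is its spectrum and $S(\alpha)=\bigcup_{\theta\in\mathbb{R}}S(\alpha,\theta)$. $|\cdot|$ is Lebesgue measure. $\Omega$ is the set of irrational $\alpha$ whose continued fraction coefficients $a_1,a_2,\dots$ form a bounded sequence. With $M_n(\theta,E)=\begin{pmatrix}E-f(\alpha n+\theta)&-1\\1&0\end{pmatrix}$ and $T_n=M_{n-1}\cdots M_0$, the Lyapunov exponent is $\gamma(E,\alpha)=\lim_{n\to\infty}\frac1n\int_0^1\ln\|T_n(\theta,E)\|\,d\theta$.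
   Formalization: The perturbed frequency α' is taken different from α, since for α' = α the bound involves ln 0 (or, read as 0, would make the strict inequality impossible). *)

theory Defs
  imports "HOL-Analysis.Analysis"
begin

definition real_analytic :: "(real \<Rightarrow> real) \<Rightarrow> bool" where
  "real_analytic f \<longleftrightarrow>
     (\<forall>x. \<exists>r>0. \<exists>a::nat \<Rightarrow> real. \<forall>y. \<bar>y - x\<bar> < r \<longrightarrow> (\<lambda>n. a n * (y - x) ^ n) sums f y)"

definition cf_rem :: "real \<Rightarrow> nat \<Rightarrow> real" where
  "cf_rem \<alpha> n = ((\<lambda>x. 1 / frac x) ^^ n) \<alpha>"

definition cf_coeff :: "real \<Rightarrow> nat \<Rightarrow> int" where
  "cf_coeff \<alpha> n = \<lfloor>cf_rem \<alpha> n\<rfloor>"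

definition Omega :: "real set" where
  "Omega = {\<alpha>. \<alpha> \<notin> \<rat> \<and> (\<exists>B. \<forall>n\<ge>1. cf_coeff \<alpha> n \<le> B)}"

definition l2 :: "(int \<Rightarrow> complex) set" where
  "l2 = {\<psi>. (\<lambda>n. (cmod (\<psi> n))\<^sup>2) summable_on UNIV}"

definition l2norm :: "(int \<Rightarrow> complex) \<Rightarrow> real" where
  "l2norm \<psi> = sqrt (\<Sum>\<^sub>\<infinity>n. (cmod (\<psi> n))\<^sup>2)"

definition Hop :: "(real \<Rightarrow> real) \<Rightarrow> real \<Rightarrow> real \<Rightarrow> (int \<Rightarrow> complex) \<Rightarrow> (int \<Rightarrow> complex)" where
  "Hop f \<alpha> \<theta> \<psi> = (\<lambda>n. \<psi> (n - 1) + \<psi> (n + 1) + complex_of_real (f (\<alpha> * of_int n + \<theta>)) * \<psi> n)"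

text \<open>Spectrum S(alpha,theta): the real E for which H - E has no bounded inverse on l^2(Z).
  (H is bounded self-adjoint, so its spectrum is real.)\<close>
definition spec :: "(real \<Rightarrow> real) \<Rightarrow> real \<Rightarrow> real \<Rightarrow> real set" where
  "spec f \<alpha> \<theta> = {E. \<not> (\<exists>G. (\<forall>\<psi>\<in>l2. G \<psi> \<in> l2
        \<and> (\<lambda>n. Hop f \<alpha> \<theta> (G \<psi>) n - complex_of_real E * G \<psi> n) = \<psi>
        \<and> G (\<lambda>n. Hop f \<alpha> \<theta> \<psi> n - complex_of_real E * \<psi> n) = \<psi>)
      \<and> (\<exists>C. \<forall>\<psi>\<in>l2. l2norm (G \<psi>) \<le> C * l2norm \<psi>))}"

definition specU :: "(real \<Rightarrow> real) \<Rightarrow> real \<Rightarrow> real set" where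
  "specU f \<alpha> = (\<Union>\<theta>. spec f \<alpha> \<theta>)"

definition Mmat :: "(real \<Rightarrow> real) \<Rightarrow> real \<Rightarrow> nat \<Rightarrow> real \<Rightarrow> real \<Rightarrow> real^2^2" where
  "Mmat f \<alpha> n \<theta> E = vector [vector [E - f (\<alpha> * real n + \<theta>), -1], vector [1, 0]]"

fun Tmat :: "(real \<Rightarrow> real) \<Rightarrow> real \<Rightarrow> nat \<Rightarrow> real \<Rightarrow> real \<Rightarrow> real^2^2" where
  "Tmat f \<alpha> 0 \<theta> E = mat 1"
| "Tmat f \<alpha> (Suc n) \<theta> E = Mmat f \<alpha> n \<theta> E ** Tmat f \<alpha> n \<theta> E"

definition lyap :: "(real \<Rightarrow> real) \<Rightarrow> real \<Rightarrow> real \<Rightarrow> real" where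
  "lyap f E \<alpha> = lim (\<lambda>n. (1 / real n) *
      integral {0..1} (\<lambda>\<theta>. ln (onorm (\<lambda>v. Tmat f \<alpha> n \<theta> E *v v))))"

end

theory Submission
  imports Defs "HOL-Complex_Analysis.Complex_Analysis"
begin

text \<open>Let \<open>P\<^sub>m(\<theta>)\<close> be the determinant of \<open>E - H\<close> on the box of the first \<open>m\<close> sites. A positive
  Lyapunov exponent makes \<open>sup |P\<^sub>m|\<close> grow exponentially, uniformly in \<open>E\<close> off a set of small
  measure. Hence at every scale \<open>N\<close> there is \<open>k\<close> comparable to \<open>N\<close> and \<open>m \<in> {k<..2k}\<close> such
  that \<open>sup |P\<^sub>m|\<close> exceeds all determinants of length at most \<open>k\<close> by a factor \<open>exp N\<close>. By Cramer's
  rule, on a box of length \<open>m\<close> where \<open>|P\<^sub>m|\<close> is at least half its supremum, every solution is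
  smaller in the middle than at the ends by a factor of order \<open>exp (-N)\<close>. Analyticity of \<open>f\<close> and a
  Bernstein inequality bound the derivative of \<open>P\<^sub>m\<close> by a multiple of \<open>m sup |P\<^sub>m|\<close>, so the large
  values fill an interval of length of order \<open>1/m\<close>. As \<open>\<alpha>\<close> is Diophantine, every orbit meets this
  interval within \<open>O(m\<^sup>3)\<close> steps.

  Cutting an approximate eigenvector at these good boxes yields one for \<open>E\<close> with error of order
  \<open>exp (-N)\<close> supported on \<open>O(N\<^sup>3)\<close> sites. Replacing \<open>\<alpha>\<close> by \<open>\<alpha>'\<close> costs \<open>O(N\<^sup>3 |\<alpha> - \<alpha>'|)\<close> on such a
  support, and \<open>N\<close> is taken to be about \<open>- ln |\<alpha> - \<alpha>'|\<close>.\<close>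

section \<open>Orbits of badly approximable rotations\<close>

text \<open>Positivity of a limit for almost every energy carries no uniformity and no evident
  measurability. Both come from subadditivity: the Lyapunov exponent is the infimum of its
  finite-scale averages, so a positive value bounds the suprema from below at every length at once.
  Energies with a prescribed rate form a closed set, these sets grow as the rate decreases, and they
  exhaust almost every energy; continuity of measure then provides the rate belonging to
  \<open>\<delta>\<close>. Only suprema over the phase are controlled, never the value at a given
  phase; visits of the orbit to the neighbourhood of a maximiser take the place of phasewise lower
  bounds. The union over all phases in the spectrum leaves the phase for \<alpha>' free, so the two
  potentials can be matched at one end of the support and drift apart only with its length. The cube
  of the logarithm is a visiting time: a return of the rotation with displacement below 1/Q takes up
  to Q steps and is repeated O(Q^2) times, with Q comparable to N.\<close>

lemma cf_rem_Suc: "cf_rem x (Suc n) = 1 / frac (cf_rem x n)"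
  by (simp add: cf_rem_def)

lemma cf_rem_inverse_frac: "cf_rem (1 / frac x) n = cf_rem x (Suc n)"
  by (simp add: cf_rem_def funpow_Suc_right del: funpow.simps)

lemma frac_irrational: "x \<notin> \<rat> \<Longrightarrow> frac x \<notin> \<rat>"
  unfolding frac_def by (metis Rats_add Rats_of_int diff_add_cancel)

lemma cf_rem_irrational: "x \<notin> \<rat> \<Longrightarrow> cf_rem x n \<notin> \<rat>"
proof (induction n)
  case 0
  then show ?case by (simp add: cf_rem_def)
next
  case (Suc n)
  then show ?case
    by (metis Rats_inverse cf_rem_Suc frac_irrational inverse_eq_divide inverse_inverse_eq)
qed

text \<open>Coefficient \<open>Suc n\<close> is the integer part of
  \<open>1 / frac (cf_rem \<alpha> n)\<close>, so a bound \<open>B\<close> on it keeps this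
  fractional part above \<open>1 / (B + 1)\<close>. The index shift makes the estimate available at
  \<open>n = 0\<close>, where \<alpha> itself stands.\<close>

lemma Omega_frac_lower_bound:
  assumes "\<alpha> \<in> Omega"
  obtains \<eta> where "0 < \<eta>" "\<And>n. \<eta> \<le> frac (cf_rem \<alpha> n)"
proof -
  obtain B where irr: "\<alpha> \<notin> \<rat>" and B: "\<And>n. n \<ge> 1 \<Longrightarrow> cf_coeff \<alpha> n \<le> B"
    using assms by (auto simp: Omega_def)
  have *: "0 < B + 1 \<and> 1 / (of_int B + 1) \<le> frac (cf_rem \<alpha> n)" for n
  proof -
    let ?y = "frac (cf_rem \<alpha> n)"
    have "?y \<noteq> 0"
      using cf_rem_irrational[OF irr, of n] frac_irrational Rats_0 by metis
    then have y: "0 < ?y" "?y < 1"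
      using frac_ge_0[of "cf_rem \<alpha> n"] frac_lt_1 by (auto simp: less_le)
    have "\<lfloor>1 / ?y\<rfloor> \<le> B"
      using B[of "Suc n"] by (simp add: cf_coeff_def cf_rem_Suc)
    then have lt: "1 / ?y < of_int B + 1" by linarith
    have "0 < 1 / ?y" using y by simp
    then have pos: "0 < of_int B + (1::real)" using lt by linarith
    then have "0 < B + 1" by linarith
    moreover have "1 / (of_int B + 1) \<le> ?y"
      using lt y pos by (simp add: field_simps)
    ultimately show ?thesis by simp
  qed
  show ?thesis
  proof (rule that)
    have "0 < of_int B + (1::real)" using *[of 0] by linarith
    then show "0 < 1 / (of_int B + 1 :: real)" by simp
  qed (use * in auto)
qed

text \<open>The exponent 2 instead of the optimal 1 makes the induction along the Gauss map lossless.\<close>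

lemma diophantine_of_frac_bound:
  assumes "0 < \<eta>" and "\<And>n. \<eta> \<le> frac (cf_rem x n)" and "0 < q"
  shows "\<eta>\<^sup>2 / 4 / (real q)\<^sup>2 \<le> \<bar>real q * x - of_int p\<bar>"
  using assms
proof (induction q arbitrary: x p rule: less_induct)
  case (less q)
  define y where "y = frac x"
  define x1 where "x1 = 1 / y"
  define p' where "p' = p - int q * \<lfloor>x\<rfloor>"
  have ylow: "\<eta> \<le> y" using less.prems(2)[of 0] by (simp add: y_def cf_rem_def)
  have y0: "0 < y" using ylow less.prems by linarith
  have y1: "y < 1" by (simp add: y_def frac_lt_1)
  have e1: "\<eta> < 1" using ylow y1 by linarith
  have "\<eta> \<le> frac x1"
    using less.prems(2)[of 1] cf_rem_inverse_frac[of x 0] by (simp add: x1_def y_def cf_rem_def)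
  moreover have "1 \<le> \<lfloor>x1\<rfloor>" using y0 y1 by (simp add: x1_def)
  ultimately have "1 + \<eta> \<le> x1" unfolding frac_def by linarith
  then have "(1 + \<eta>) * y \<le> 1" using y0 by (simp add: x1_def field_simps)
  \<comment> \<open>The number \<open>1 / y\<close> has integer part at least 1 and fractional part
    at least \<eta>, so \<open>y\<close> cannot come close to 1.\<close>
  have yup: "\<eta> / 2 \<le> 1 - y"
  proof -
    have "y \<le> 1 / (1 + \<eta>)" using \<open>(1 + \<eta>) * y \<le> 1\<close> less.prems by (simp add: field_simps)
    also have "\<dots> \<le> 1 - \<eta> / 2"
      using less.prems e1 by (simp add: field_simps power2_eq_square mult_left_le)
    finally show ?thesis by simp
  qed
  have q1: "1 \<le> real q" using less.prems by simp
  have eq: "real q * x - of_int p = real q * y - of_int p'"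
    by (simp add: y_def p'_def frac_def algebra_simps)
  have small: "\<eta>\<^sup>2 / 4 / (real q)\<^sup>2 \<le> \<eta>\<^sup>2 / 4"
    using q1 by (simp add: divide_le_eq mult_le_cancel_left1 )
  have ee: "\<eta>\<^sup>2 \<le> \<eta>" using e1 less.prems by (simp add: power2_eq_square mult_left_le)
  \<comment> \<open>Outside the open interval from 0 to \<open>q\<close>, the distances of
    \<open>y\<close> from 0 and 1 suffice. Inside it, \<open>p'\<close> is smaller than
    \<open>q\<close> and becomes the denominator for the next remainder \<open>x1\<close>.\<close>
  consider "p' \<le> 0" | "int q \<le> p'" | "0 < p'" "p' < int q" by linarith
  then show ?case
  proof cases
    case 1
    have "1 * \<eta> \<le> real q * y" using q1 ylow less.prems by (intro mult_mono) auto
    moreover have "real_of_int p' \<le> 0" using 1 by simp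
    ultimately show ?thesis unfolding eq using small ee less.prems(1) by linarith
  next
    case 2
    have "1 * (\<eta>/2) \<le> real q * (1 - y)" using q1 yup less.prems by (intro mult_mono) auto
    moreover have "real q \<le> real_of_int p'" using 2 by linarith
    ultimately show ?thesis unfolding eq using small ee less.prems(1)
      by (simp add: algebra_simps)
  next
    case 3
    define k where "k = nat p'"
    have k: "0 < k" "k < q" "of_int p' = real k" using 3 by (auto simp: k_def)
    \<comment> \<open>If \<open>k / q\<close> is at most the root of \<open>y\<close>, the identity
      \<open>|q y - k| = y |k x1 - q|\<close> carries the bound for \<open>k\<close> over to
      \<open>q\<close>, since \<open>y\<close> is at least \<open>(k / q)^2\<close>. Otherwise
      \<open>k / q\<close> lies above the root of \<open>y\<close>, and \<open>k - q y\<close> is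
      bounded below by a constant.\<close>
    show ?thesis
    proof (cases "(real k)\<^sup>2 \<le> y * (real q)\<^sup>2")
      case True
      have "\<eta>\<^sup>2 / 4 / (real k)\<^sup>2 \<le> \<bar>real k * x1 - of_int (int q)\<bar>"
      proof (rule less.IH[OF k(2) less.prems(1) _ k(1)])
        show "\<eta> \<le> frac (cf_rem x1 n)" for n
          using less.prems(2)[of "Suc n"] by (simp add: x1_def y_def cf_rem_inverse_frac)
      qed
      then have "y * (\<eta>\<^sup>2 / 4 / (real k)\<^sup>2) \<le> y * \<bar>real k * x1 - of_int (int q)\<bar>"
        using y0 by (intro mult_left_mono) auto
      also have "\<dots> = \<bar>y * (real k * x1 - real q)\<bar>" using y0 by (simp add: abs_mult)
      also have "y * (real k * x1 - real q) = real k - y * real q"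
        using y0 by (simp add: x1_def field_simps)
      finally have "y * (\<eta>\<^sup>2 / 4 / (real k)\<^sup>2) \<le> \<bar>real q * y - real k\<bar>"
        by (simp add: mult.commute abs_minus_commute)
      moreover have "\<eta>\<^sup>2 / 4 / (real q)\<^sup>2 \<le> y * (\<eta>\<^sup>2 / 4 / (real k)\<^sup>2)"
      proof -
        have "\<eta>\<^sup>2 / 4 * (real k)\<^sup>2 \<le> \<eta>\<^sup>2 / 4 * (y * (real q)\<^sup>2)"
          using True by (intro mult_left_mono) auto
        then show ?thesis using k q1 by (simp add: field_simps)
      qed
      ultimately show ?thesis unfolding eq k(3) by linarith
    next
      case False
      have "real q * y \<le> real q" using y1 y0 q1 by (simp add: mult_left_le)
      moreover have "real k < real q" using k by simp
      ultimately have sum: "real k + real q * y \<le> 2 * real q" by linarith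
      have "(real q)\<^sup>2 * (y * (1 - y)) \<le> (real k)\<^sup>2 - (real q * y)\<^sup>2"
        using False by (simp add: algebra_simps power2_eq_square)
      also have "\<dots> = (real k - real q * y) * (real k + real q * y)"
        by (simp add: algebra_simps power2_eq_square)
      finally have le: "(real q)\<^sup>2 * (y * (1 - y)) \<le> (real k - real q * y) * (real k + real q * y)" .
      have yy: "\<eta> * (\<eta> / 2) \<le> y * (1 - y)" using ylow yup less.prems by (intro mult_mono) auto
      then have "0 < y * (1 - y)" using y0 y1 by simp
      then have "0 < (real k - real q * y) * (real k + real q * y)" using le q1
        by (smt (verit) mult_pos_pos zero_less_power)
      then have pos: "0 < real k - real q * y" 
        by (smt (verit) mult_nonneg_nonneg mult_nonpos_nonneg of_nat_0_le_iff y0)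
      have "(real q)\<^sup>2 * (y * (1 - y)) \<le> (real k - real q * y) * (2 * real q)"
        using le mult_left_mono[OF sum less_imp_le[OF pos]] by linarith
      then have "real q * (y * (1 - y)) \<le> (real k - real q * y) * 2"
        using q1 by (simp add: power2_eq_square)
      moreover have "1 * (\<eta> * (\<eta> / 2)) \<le> real q * (y * (1 - y))"
        by (rule mult_mono) (use q1 yy less.prems(1) in simp_all)
      ultimately have "\<eta>\<^sup>2 / 4 \<le> real k - real q * y" by (simp add: power2_eq_square)
      then show ?thesis unfolding eq k(3) using small by linarith
    qed
  qed
qed

text \<open>Dirichlet's theorem gives a time \<open>q \<le> Q\<close> after which the rotation moves
  by less than \<open>1 / Q\<close>; the Diophantine bound makes it move by at least
  \<open>c / Q^2\<close>. Repeating these \<open>q\<close> steps sweeps the circle without jumping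
  over an interval of length \<open>1 / Q\<close>, in at most \<open>Q^2 / c\<close> rounds.\<close>

lemma orbit_quantitatively_dense:
  fixes \<alpha> :: real
  assumes "0 < c" and dioph: "\<And>q p. 0 < q \<Longrightarrow> c / (real q)\<^sup>2 \<le> \<bar>real q * \<alpha> - of_int p\<bar>"
    and "0 < Q"
  shows "\<exists>i::nat. \<exists>z::int. real i \<le> (real Q)^3 / c \<and> \<bar>\<theta> + \<alpha> * real i - t - of_int z\<bar> \<le> 1 / real Q"
proof -
  obtain h k where k: "0 < k" "k \<le> int Q" and hk: "\<bar>of_int k * \<alpha> - of_int h\<bar> < 1 / real Q"
    using Dirichlet_approx[OF \<open>0 < Q\<close>] by blast
  define q where "q = nat k"
  have q: "0 < q" "q \<le> Q" "of_int k = real q" using k by (auto simp: q_def)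
  define s where "s = real q * \<alpha> - of_int h"
  have s_up: "\<bar>s\<bar> < 1 / real Q" using hk by (simp add: s_def q)
  have "c / (real Q)\<^sup>2 \<le> c / (real q)\<^sup>2"
    using q \<open>0 < c\<close> by (intro divide_left_mono power_mono) auto
  then have s_low: "c / (real Q)\<^sup>2 \<le> \<bar>s\<bar>" using dioph[OF q(1), of h] by (simp add: s_def)
  have "0 < c / (real Q)\<^sup>2" using assms by simp
  then have s0: "0 < \<bar>s\<bar>" using s_low by linarith
  \<comment> \<open>The sweep runs in the direction of \<open>s\<close>: \<open>u\<close> is the arc
    from \<theta> to \<open>t\<close> measured that way, and \<open>j\<close> counts the rounds that
    do not overshoot.\<close>
  define u where "u = frac (sgn s * (t - \<theta>))"
  define j where "j = nat \<lfloor>u / \<bar>s\<bar>\<rfloor>"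
  have u: "0 \<le> u" "u < 1" by (auto simp: u_def frac_lt_1)
  have "0 \<le> u / \<bar>s\<bar>" using u s0 by simp
  then have j: "real j \<le> u / \<bar>s\<bar>" "u / \<bar>s\<bar> < real j + 1" unfolding j_def by linarith+
  have j1: "real j * \<bar>s\<bar> \<le> u" and j2: "u < real j * \<bar>s\<bar> + \<bar>s\<bar>"
    using j s0 by (simp_all add: field_simps)
  have "real j * (c / (real Q)\<^sup>2) \<le> real j * \<bar>s\<bar>" using s_low by (intro mult_left_mono) auto
  also have "\<dots> \<le> 1" using j1 u by linarith
  finally have jle: "real j \<le> (real Q)\<^sup>2 / c" using assms by (simp add: field_simps)
  have i_le: "real (j * q) \<le> (real Q)^3 / c"
  proof -
    have "real j * real q \<le> (real Q)\<^sup>2 / c * real Q" using jle q assms by (intro mult_mono) auto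
    then show ?thesis by (simp add: power3_eq_cube power2_eq_square mult_ac)
  qed
  define m where "m = \<lfloor>sgn s * (t - \<theta>)\<rfloor>"
  have um: "u = sgn s * (t - \<theta>) - of_int m" by (simp add: u_def m_def frac_def)
  have sm: "\<exists>m'::int. sgn s * of_int m = of_int m'"
    using s0 by (cases "s > 0") (auto intro: exI[of _ m] exI[of _ "-m"])
  then obtain m' :: int where m': "sgn s * of_int m = of_int m'" by blast
  have ss: "sgn s * sgn s = 1" using s0 by (auto simp: sgn_if)
  have "sgn s * u = t - \<theta> - of_int m'" unfolding um 
    using ss m' by (simp add: algebra_simps mult.assoc[symmetric])
  moreover have "sgn s * \<bar>s\<bar> = s" by (simp add: mult_sgn_abs)
  then have "sgn s * (real j * \<bar>s\<bar>) = real j * s" by (simp add: mult.left_commute)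
  ultimately have "real j * s - (t - \<theta> - of_int m') = sgn s * (real j * \<bar>s\<bar> - u)"
    by (simp only: right_diff_distrib)
  then have "\<bar>real j * s - (t - \<theta> - of_int m')\<bar> = \<bar>real j * \<bar>s\<bar> - u\<bar>"
    using s0 by (simp add: abs_mult)
  also have "\<dots> \<le> 1 / real Q" using j1 j2 s_up by linarith
  finally have "\<bar>\<theta> + \<alpha> * real (j * q) - t - of_int (int j * h - m')\<bar> \<le> 1 / real Q"
    by (simp add: s_def algebra_simps)
  then show ?thesis using i_le by blast
qed

section \<open>Analytic functions on a strip\<close>

text \<open>A Bernstein-type inequality. Composed with the Joukowski map
  \<open>w \<mapsto> \<rho> (w + 1/w) / 4\<close>, which sends the unit circle into the real axis, \<open>G\<close> lives on
  the annulus \<open>1/2 \<le> |w| \<le> 2\<close>, and the maximum principle for \<open>w\<^sup>\<kappa> G\<close>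
  shows that \<open>G\<close> is at most \<open>2\<tau>\<close> within distance \<open>1/(2\<kappa>)\<close> of \<open>w = \<i>\<close>.\<close>

lemma Bernstein_inequality_disc:
  assumes holG: "G holomorphic_on ball 0 \<rho>" and "0 < \<rho>" and \<kappa>: "0 < (\<kappa>::nat)"
    and bound: "\<And>z. z \<in> ball 0 \<rho> \<Longrightarrow> cmod (G z) \<le> \<tau> * 2 ^ \<kappa>"
    and real: "\<And>t. \<bar>t\<bar> < \<rho> \<Longrightarrow> cmod (G (of_real t)) \<le> \<tau>"
  shows "cmod (deriv G 0) \<le> 8 * real \<kappa> * \<tau> / \<rho>"
proof -
  define J where "J = (\<lambda>w::complex. of_real (\<rho> / 4) * (w + 1 / w))"
  define A where "A = {w::complex. 1/2 \<le> cmod w \<and> cmod w \<le> 2}"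
  define h where "h = (\<lambda>w. G (J w))"
  have \<tau>0: "0 \<le> \<tau>" by (rule order_trans[OF norm_ge_zero real[of 0]]) (use \<open>0 < \<rho>\<close> in simp)
  have Jball: "J w \<in> ball 0 \<rho>" if "w \<in> A" for w
  proof -
    have w: "1/2 \<le> cmod w" "cmod w \<le> 2" using that by (auto simp: A_def)
    have "cmod (w + 1 / w) \<le> cmod w + 1 / cmod w"
      by (metis norm_divide norm_one norm_triangle_ineq)
    also have "\<dots> \<le> 5/2"
    proof -
      have "(cmod w - 1/2) * (cmod w - 2) \<le> 0" using w by (intro mult_nonneg_nonpos) auto
      moreover have "cmod w * cmod w + 1 \<le> 5/2 * cmod w" if "(cmod w - 1/2) * (cmod w - 2) \<le> 0"
        using that by (simp add: algebra_simps)
      moreover have "0 < cmod w" using w by linarith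
      ultimately show ?thesis by (simp add: field_simps)
    qed
    finally have "\<rho> / 4 * cmod (w + 1 / w) \<le> \<rho> / 4 * (5/2)" using \<open>0 < \<rho>\<close> by (intro mult_left_mono) auto
    also have "\<dots> < \<rho>" using \<open>0 < \<rho>\<close> by simp
    finally show ?thesis using \<open>0 < \<rho>\<close> by (simp add: J_def norm_mult)
  qed
  have A0: "w \<noteq> 0" if "w \<in> A" for w using that by (auto simp: A_def)
  have holJ: "J holomorphic_on A" unfolding J_def using A0 by (auto intro!: holomorphic_intros)
  have holh: "h holomorphic_on A"
    using holomorphic_on_compose_gen[OF holJ holG] Jball by (simp add: h_def o_def image_subset_iff)
  have inner: "cmod (h w) * cmod w ^ \<kappa> \<le> \<tau>" if w: "1/2 \<le> cmod w" "cmod w \<le> 1" for w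
  proof -
    define S where "S = {w::complex. 1/2 \<le> cmod w \<and> cmod w \<le> 1}"
    have SA: "S \<subseteq> A" by (auto simp: S_def A_def)
    have hol: "(\<lambda>w. h w * w ^ \<kappa>) holomorphic_on S"
      by (intro holomorphic_intros holomorphic_on_subset[OF holh SA])
    have S_alt: "S = cball 0 1 - ball 0 (1/2)" by (auto simp: S_def)
    have clS: "closed S" unfolding S_alt by (intro closed_Diff) auto
    have "bounded S" unfolding S_alt by (rule bounded_subset[of "cball 0 1"]) auto
    have "norm (h w * w ^ \<kappa>) \<le> \<tau>"
    proof (rule maximum_modulus_frontier[of "\<lambda>w. h w * w ^ \<kappa>" S])
      show "(\<lambda>w. h w * w ^ \<kappa>) holomorphic_on interior S"
        using hol holomorphic_on_subset interior_subset by blast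
      show "continuous_on (closure S) (\<lambda>w. h w * w ^ \<kappa>)"
        using hol clS by (simp add: holomorphic_on_imp_continuous_on)
      show "bounded S" by fact
      show "w \<in> S" using w by (simp add: S_def)
      fix z assume z: "z \<in> frontier S"
      then have zS: "z \<in> S" and zI: "z \<notin> interior S"
        using clS by (auto simp: frontier_def)
      have "ball 0 1 - cball 0 (1/2) \<subseteq> interior S"
        by (rule interior_maximal) (auto simp: S_def)
      then have "cmod z = 1 \<or> cmod z = 1/2" using zS zI by (force simp: S_def)
      then show "norm (h z * z ^ \<kappa>) \<le> \<tau>"
      proof
        assume z1: "cmod z = 1"
        have "z * cnj z = 1" using complex_norm_square[of z] z1 by simp
        then have "1 / z = cnj z" by (metis mult_eq_0_iff nonzero_eq_divide_eq mult.commute zero_neq_one)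
        then have "J z = of_real (\<rho> / 2 * Re z)"
          by (simp add: J_def complex_eq_iff)
        moreover have "\<bar>\<rho> / 2 * Re z\<bar> < \<rho>"
        proof -
          have "\<rho> * \<bar>Re z\<bar> \<le> \<rho> * 1" using abs_Re_le_cmod[of z] z1 \<open>0 < \<rho>\<close> by (intro mult_left_mono) auto
          then show ?thesis using \<open>0 < \<rho>\<close> by (simp add: abs_mult)
        qed
        ultimately have "cmod (h z) \<le> \<tau>" using real[of "\<rho> / 2 * Re z"] by (simp only: h_def)
        then show ?thesis using z1 by (simp add: norm_mult norm_power)
      next
        \<comment> \<open>On the inner circle the weight equals \<open>1 / 2 ^ \<kappa>\<close> and
          cancels the excess of the complex bound over the real one.\<close>
        assume z1: "cmod z = 1/2"
        have "cmod (h z) \<le> \<tau> * 2 ^ \<kappa>" unfolding h_def using bound Jball SA zS by blast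
        moreover have "cmod z ^ \<kappa> = 1 / 2 ^ \<kappa>" unfolding z1 by (simp add: power_one_over)
        ultimately show ?thesis by (simp add: norm_mult norm_power divide_le_eq)
      qed
    qed
    then show ?thesis by (simp add: norm_mult norm_power)
  qed
  \<comment> \<open>With this radius Bernoulli's inequality keeps the weight above 1/2 near the unit
    circle, so dividing it out costs at most a factor 2.\<close>
  define r where "r = 1 / (2 * real \<kappa>)"
  have r: "0 < r" "r \<le> 1/2" using \<kappa> by (auto simp: r_def field_simps)
  have "1 + real \<kappa> * (- r) \<le> (1 + (- r)) ^ \<kappa>" using r by (intro Bernoulli_inequality) auto
  then have bern: "1/2 \<le> (1 - r) ^ \<kappa>" using \<kappa> by (simp add: r_def)
  have near: "cmod (h w) \<le> 2 * \<tau>" if "cmod (\<i> - w) \<le> r" for w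
  proof -
    have "\<bar>1 - cmod w\<bar> \<le> r" using that norm_triangle_ineq3[of \<i> w] by simp
    then have w: "1 - r \<le> cmod w" "cmod w \<le> 1 + r" by auto
    show ?thesis
    proof (cases "cmod w \<le> 1")
      case True
      have "1/2 \<le> cmod w ^ \<kappa>" using bern power_mono[OF w(1), of \<kappa>] r by linarith
      then have "cmod (h w) * (1/2) \<le> cmod (h w) * cmod w ^ \<kappa>" by (intro mult_left_mono) auto
      also have "\<dots> \<le> \<tau>" using inner w r True by auto
      finally show ?thesis by simp
    next
      case False
      \<comment> \<open>The Joukowski map is invariant under inversion, which reduces the outer half
        of the annulus to the inner one.\<close>
      have hw: "h w = h (1 / w)" by (simp add: h_def J_def add.commute)
      have "1/2 \<le> cmod (1 / w)" "cmod (1 / w) \<le> 1"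
        using w r False by (auto simp: norm_divide le_divide_eq divide_le_eq)
      from inner[OF this] have "cmod (h w) / cmod w ^ \<kappa> \<le> \<tau>"
        by (simp add: hw norm_divide power_divide)
      moreover have "0 < cmod w ^ \<kappa>" using False by (intro zero_less_power) linarith
      ultimately have "cmod (h w) \<le> \<tau> * cmod w ^ \<kappa>" by (simp add: pos_divide_le_eq)
      also have "\<dots> \<le> \<tau> * 2"
      proof (rule mult_left_mono[OF _ \<tau>0])
        have "cmod w ^ \<kappa> * (1 - r) ^ \<kappa> \<le> (1 + r) ^ \<kappa> * (1 - r) ^ \<kappa>"
          using w r False by (intro mult_right_mono power_mono) auto
        also have "\<dots> = (1 - r\<^sup>2) ^ \<kappa>"
          by (simp add: algebra_simps power2_eq_square flip: power_mult_distrib)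
        also have "\<dots> \<le> 1" using r by (intro power_le_one) (auto simp: power2_eq_square mult_le_one)
        finally have *: "cmod w ^ \<kappa> * (1 - r) ^ \<kappa> \<le> 1" .
        have "cmod w ^ \<kappa> * (1/2) \<le> cmod w ^ \<kappa> * (1 - r) ^ \<kappa>"
          using bern by (intro mult_left_mono) auto
        then show "cmod w ^ \<kappa> \<le> 2" using * by linarith
      qed
      finally show ?thesis using \<tau>0 by (simp add: mult.commute)
    qed
  qed
  have cA: "cball \<i> r \<subseteq> A"
  proof
    fix w assume "w \<in> cball \<i> r"
    then have "\<bar>1 - cmod w\<bar> \<le> r" using norm_triangle_ineq3[of \<i> w] by (simp add: dist_norm)
    then show "w \<in> A" using r by (auto simp: A_def)
  qed
  \<comment> \<open>Cauchy's estimate with bound \<open>2 \<tau>\<close> and radius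
    \<open>1 / (2 \<kappa>)\<close> gives \<open>4 \<kappa> \<tau>\<close>. As \<open>J\<close> maps
    \<i> to 0 with derivative \<open>\<rho> / 2\<close> there, the chain rule turns this into
    \<open>8 \<kappa> \<tau> / \<rho>\<close>.\<close>
  have "norm ((deriv ^^ 1) h \<i>) \<le> fact 1 * (2 * \<tau>) / r ^ 1"
  proof (rule Cauchy_inequality)
    show "h holomorphic_on ball \<i> r" using holh cA ball_subset_cball holomorphic_on_subset by blast
    show "continuous_on (cball \<i> r) h"
      using holh cA holomorphic_on_subset holomorphic_on_imp_continuous_on by blast
  qed (use r near in auto)
  then have dh: "cmod (deriv h \<i>) \<le> 4 * real \<kappa> * \<tau>" using \<kappa> by (simp add: r_def field_simps)
  have J0: "J \<i> = 0" by (simp add: J_def)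
  have dJ: "(J has_field_derivative of_real (\<rho> / 2)) (at \<i>)"
    unfolding J_def by (auto intro!: derivative_eq_intros simp: field_simps)
  have "G field_differentiable at 0"
    using holomorphic_on_imp_differentiable_at[OF holG] \<open>0 < \<rho>\<close> by simp
  then have dG: "(G has_field_derivative deriv G 0) (at (J \<i>))"
    unfolding J0 by (simp add: DERIV_deriv_iff_field_differentiable)
  have "(h has_field_derivative deriv G 0 * of_real (\<rho> / 2)) (at \<i>)"
    using DERIV_chain[OF dG dJ] by (simp add: h_def o_def)
  then have "deriv h \<i> = deriv G 0 * of_real (\<rho> / 2)" by (rule DERIV_imp_deriv)
  then have "cmod (deriv G 0) * (\<rho> / 2) \<le> 4 * real \<kappa> * \<tau>"
    using dh \<open>0 < \<rho>\<close> by (simp only: norm_mult norm_of_real)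
  then show ?thesis using \<open>0 < \<rho>\<close> by (simp add: field_simps)
qed

text \<open>Analyticity in a strip is encoded as one disc of fixed radius and one common bound at
  every real point. The local extensions need not be glued together, since all later estimates look
  at a single disc.\<close>

definition hol_ext :: "real \<Rightarrow> real \<Rightarrow> (real \<Rightarrow> real) \<Rightarrow> bool" where
  "hol_ext \<rho> B g \<longleftrightarrow> (\<forall>x. \<exists>F. F holomorphic_on ball 0 \<rho> \<and> (\<forall>z\<in>ball 0 \<rho>. cmod (F z) \<le> B) \<and>
     (\<forall>t. \<bar>t\<bar> < \<rho> \<longrightarrow> F (of_real t) = of_real (g (x + t))))"

text \<open>The complex bound may exceed the real one by \<open>2 ^ \<kappa>\<close>, yet the
  Lipschitz constant is only linear in \<kappa>. For determinants of length \<open>m\<close>,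
  \<kappa> is proportional to \<open>m\<close>; a plain Cauchy estimate would lose an exponential
  factor.\<close>

lemma hol_ext_imp_Lipschitz:
  assumes ext: "hol_ext \<rho> (\<tau> * 2 ^ \<kappa>) g" and "0 < \<rho>" "0 < \<kappa>" and \<tau>: "\<And>x. \<bar>g x\<bar> \<le> \<tau>"
  shows "\<bar>g x - g y\<bar> \<le> 8 * real \<kappa> * \<tau> / \<rho> * \<bar>x - y\<bar>"
proof -
  have "\<exists>D. (g has_real_derivative D) (at x) \<and> \<bar>D\<bar> \<le> 8 * real \<kappa> * \<tau> / \<rho>" for x
  proof -
    obtain F where F: "F holomorphic_on ball 0 \<rho>" "\<And>z. z \<in> ball 0 \<rho> \<Longrightarrow> cmod (F z) \<le> \<tau> * 2 ^ \<kappa>"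
      "\<And>t. \<bar>t\<bar> < \<rho> \<Longrightarrow> F (of_real t) = of_real (g (x + t))"
      using ext unfolding hol_ext_def by metis
    have D: "cmod (deriv F 0) \<le> 8 * real \<kappa> * \<tau> / \<rho>"
      using Bernstein_inequality_disc[OF F(1) \<open>0 < \<rho>\<close> \<open>0 < \<kappa>\<close> F(2)] F(3) \<tau> by simp
    have "F field_differentiable at 0"
      using holomorphic_on_imp_differentiable_at[OF F(1)] \<open>0 < \<rho>\<close> by simp
    then have "(F has_field_derivative deriv F 0) (at (of_real 0))"
      by (simp add: DERIV_deriv_iff_field_differentiable)
    then have "((\<lambda>t. F (of_real t)) has_vector_derivative deriv F 0) (at 0)"
      by (rule has_vector_derivative_real_field)
    then have "((\<lambda>t. Re (F (of_real t))) has_vector_derivative Re (deriv F 0)) (at 0)"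
      by (rule bounded_linear.has_vector_derivative[OF bounded_linear_Re])
    then have "((\<lambda>t. Re (F (of_real t))) has_real_derivative Re (deriv F 0)) (at 0)"
      by (simp add: has_real_derivative_iff_has_vector_derivative)
    then have "((\<lambda>t. g (x + t)) has_real_derivative Re (deriv F 0)) (at 0)"
    proof (rule has_field_derivative_transform_within[where d = \<rho>])
      show "\<And>t. t \<in> UNIV \<Longrightarrow> dist t 0 < \<rho> \<Longrightarrow> Re (F (of_real t)) = g (x + t)"
        using F(3) by (simp add: dist_real_def)
    qed (use \<open>0 < \<rho>\<close> in auto)
    then have "(g has_real_derivative Re (deriv F 0)) (at x)"
      using DERIV_shift[of g "Re (deriv F 0)" 0 x] by (simp add: add.commute)
    moreover have "\<bar>Re (deriv F 0)\<bar> \<le> 8 * real \<kappa> * \<tau> / \<rho>"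
      using D abs_Re_le_cmod order_trans by blast
    ultimately show ?thesis by blast
  qed
  then obtain D where D: "\<And>x. (g has_real_derivative D x) (at x)" "\<And>x. \<bar>D x\<bar> \<le> 8 * real \<kappa> * \<tau> / \<rho>"
    by metis
  have "norm (g x - g y) \<le> 8 * real \<kappa> * \<tau> / \<rho> * norm (x - y)"
    by (rule field_differentiable_bound[of UNIV g D]) (use D in auto)
  then show ?thesis by simp
qed

lemma periodic_add_int:
  fixes f :: "real \<Rightarrow> 'a"
  assumes per: "\<And>x. f (x + 1) = f x"
  shows "f (x + of_int n) = f x"
proof (induction n rule: int_induct[where k = 0])
  case (step1 i)
  then show ?case using per[of "x + of_int i"] by (simp add: algebra_simps)
next
  case (step2 i)
  then show ?case using per[of "x + of_int (i - 1)"] by (simp add: algebra_simps)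
qed simp

text \<open>By periodicity finitely many power series, centred in the unit interval, serve all
  points. Discs of a quarter of the radius are used for the cover and again around each point, so
  that their sum stays in the half disc on which the series is bounded.\<close>

lemma real_analytic_periodic_hol_ext:
  assumes "real_analytic f" and per: "\<And>x. f (x + 1) = f x"
  obtains \<rho> B where "0 < \<rho>" "0 \<le> B" "hol_ext \<rho> B f"
proof -
  have "\<exists>r>0. \<exists>F B. F holomorphic_on ball 0 r \<and> (\<forall>z\<in>ball 0 (r/2). cmod (F z) \<le> B) \<and>
     (\<forall>t. \<bar>t\<bar> < r \<longrightarrow> F (of_real t) = of_real (f (x + t)))" for x
  proof -
    obtain r a where r: "r > 0" and a: "\<And>y. \<bar>y - x\<bar> < r \<Longrightarrow> (\<lambda>n. a n * (y - x) ^ n) sums f y"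
      using assms(1) unfolding real_analytic_def by metis
    define F where "F = (\<lambda>z::complex. \<Sum>n. of_real (a n) * z ^ n)"
    have sumF: "(\<lambda>n. of_real (a n) * (z - 0) ^ n) sums F z" if "z \<in> ball 0 r" for z :: complex
    proof -
      have "cmod z < r" using that by simp
      then obtain s where s: "cmod z < s" "s < r" using dense by blast
      have s0: "0 < s" using s(1) norm_ge_zero[of z] by linarith
      have "(\<lambda>n. a n * s ^ n) sums f (x + s)" using a[of "x + s"] s s0 by simp
      then have "summable (\<lambda>n. complex_of_real (a n * s ^ n))"
        using sums_of_real sums_summable by blast
      then have "summable (\<lambda>n. complex_of_real (a n) * of_real s ^ n)" by simp
      then have "summable (\<lambda>n. complex_of_real (a n) * z ^ n)"
        by (rule powser_inside) (use s s0 in simp)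
      then show ?thesis by (simp add: F_def summable_sums)
    qed
    have hol: "F holomorphic_on ball 0 r" by (rule power_series_holomorphic[OF sumF])
    have "continuous_on (cball 0 (r/2)) F"
      by (rule holomorphic_on_imp_continuous_on[OF holomorphic_on_subset[OF hol]]) (use r in auto)
    then have "bounded (F ` cball 0 (r/2))" by (intro compact_imp_bounded compact_continuous_image) auto
    then obtain B where "\<forall>z\<in>cball 0 (r/2). cmod (F z) \<le> B"
      unfolding bounded_iff by auto
    moreover have "F (of_real t) = of_real (f (x + t))" if "\<bar>t\<bar> < r" for t
    proof -
      have "(\<lambda>n. a n * t ^ n) sums f (x + t)" using a[of "x + t"] that by simp
      then have "(\<lambda>n. complex_of_real (a n * t ^ n)) sums of_real (f (x + t))" by (rule sums_of_real)
      moreover have "(\<lambda>n. complex_of_real (a n * t ^ n)) sums F (of_real t)"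
        using sumF[of "of_real t"] that by simp
      ultimately show ?thesis using sums_unique2 by blast
    qed
    ultimately show ?thesis using r hol by fastforce
  qed
  then obtain r F B where r: "\<And>x. 0 < r x" and hol: "\<And>x. F x holomorphic_on ball 0 (r x)"
    and bd: "\<And>x z. z \<in> ball 0 (r x / 2) \<Longrightarrow> cmod (F x z) \<le> B x"
    and re: "\<And>x t. \<bar>t\<bar> < r x \<Longrightarrow> F x (of_real t) = of_real (f (x + t))"
    by metis
  obtain C where C: "finite C" "C \<subseteq> {0..1}" "{0..1} \<subseteq> (\<Union>x\<in>C. ball x (r x / 4))"
  proof (rule compactE_image[of "{0..1::real}" "{0..1}" "\<lambda>x. ball x (r x / 4)"])
    show "{0..1} \<subseteq> (\<Union>x\<in>{0..1}. ball x (r x / 4))" using r by (auto intro!: bexI)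
  qed (auto intro: that)
  have "C \<noteq> {}" using C(3) by force
  define \<rho> where "\<rho> = Min ((\<lambda>x. r x / 4) ` C)"
  define M where "M = Max ((\<lambda>x. \<bar>B x\<bar>) ` C)"
  have \<rho>0: "0 < \<rho>" using C(1) \<open>C \<noteq> {}\<close> r by (simp add: \<rho>_def)
  have \<rho>: "\<rho> \<le> r x / 4" if "x \<in> C" for x unfolding \<rho>_def using C(1) that by (intro Min_le) auto
  have M: "\<bar>B x\<bar> \<le> M" if "x \<in> C" for x unfolding M_def using C(1) that by (intro Max_ge) auto
  have M0: "0 \<le> M" using M \<open>C \<noteq> {}\<close> abs_ge_zero order_trans by blast
  have "hol_ext \<rho> M f"
    unfolding hol_ext_def
  proof
    fix x :: real
    have "frac x \<in> {0..1}" using frac_lt_1[of x] by (simp add: less_imp_le)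
    then have "frac x \<in> (\<Union>x\<in>C. ball x (r x / 4))" using C(3) by blast
    then obtain x' where x': "x' \<in> C" "\<bar>frac x - x'\<bar> < r x' / 4"
      by (auto simp: dist_real_def abs_minus_commute)
    let ?G = "\<lambda>z. F x' (z + of_real (frac x - x'))"
    have in2: "z + of_real (frac x - x') \<in> ball 0 (r x' / 2)" if "z \<in> ball 0 \<rho>" for z :: complex
    proof -
      have "cmod z < r x' / 4" using that \<rho>[OF x'(1)] by simp
      moreover have "cmod (of_real (frac x - x')) < r x' / 4" using x' by (simp only: norm_of_real)
      ultimately show ?thesis using norm_triangle_ineq[of z "of_real (frac x - x')"] 
        by (simp del: of_real_diff)
    qed
    have "?G holomorphic_on ball 0 \<rho>"
    proof -
      have "(F x' \<circ> (\<lambda>z. z + of_real (frac x - x'))) holomorphic_on ball 0 \<rho>"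
      proof (rule holomorphic_on_compose_gen[OF _ hol])
        show "(\<lambda>z. z + complex_of_real (frac x - x')) ` ball 0 \<rho> \<subseteq> ball 0 (r x')"
          using in2 r[of x'] by (force simp del: of_real_diff)
      qed (intro holomorphic_intros)
      then show ?thesis by (simp add: o_def)
    qed
    moreover have "cmod (?G z) \<le> M" if "z \<in> ball 0 \<rho>" for z
      using bd[OF in2[OF that]] M[OF x'(1)] by simp
    moreover have "?G (of_real t) = of_real (f (x + t))" if "\<bar>t\<bar> < \<rho>" for t
    proof -
      have "\<bar>t + (frac x - x')\<bar> < r x'" using that x' \<rho>[OF x'(1)] r[of x'] by linarith
      then have "F x' (of_real (t + (frac x - x'))) = of_real (f (t + frac x))"
        using re[of "t + (frac x - x')" x'] by simp
      moreover have "f (x + t) = f (t + frac x)"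
        using periodic_add_int[of f "t + frac x" "\<lfloor>x\<rfloor>"] per by (simp add: frac_def algebra_simps)
      ultimately show ?thesis by simp
    qed
    ultimately show "\<exists>G. G holomorphic_on ball 0 \<rho> \<and> (\<forall>z\<in>ball 0 \<rho>. cmod (G z) \<le> M) \<and>
      (\<forall>t. \<bar>t\<bar> < \<rho> \<longrightarrow> G (of_real t) = of_real (f (x + t)))" by (intro exI[of _ ?G]) auto
  qed
  then show ?thesis using that \<rho>0 M0 by blast
qed

section \<open>Continuants\<close>

text \<open>Determinant of the tridiagonal matrix with diagonal \<open>u 0, ..., u (m - 1)\<close>
  and off-diagonal entries 1. The ring is left general because the values occur both over the reals
  and, for complex phases, over the complex numbers.\<close>

fun continuant :: "(nat \<Rightarrow> 'a::comm_ring_1) \<Rightarrow> nat \<Rightarrow> 'a" where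
  "continuant u 0 = 1"
| "continuant u (Suc 0) = u 0"
| "continuant u (Suc (Suc m)) = u (Suc m) * continuant u (Suc m) - continuant u m"

text \<open>This expands the determinant along its first row, whereas the defining recursion uses
  the last one. It is the recurrence of the solution that vanishes at the right end of a
  box.\<close>

lemma continuant_left:
  "continuant u (Suc (Suc m)) =
     u 0 * continuant (\<lambda>i. u (Suc i)) (Suc m) - continuant (\<lambda>i. u (Suc (Suc i))) m"
proof (induction m rule: induct_nat_012)
  case (ge2 m)
  have "continuant u (Suc (Suc (Suc (Suc m)))) =
      u (Suc (Suc (Suc m))) * continuant u (Suc (Suc (Suc m))) - continuant u (Suc (Suc m))"
    by (rule continuant.simps)
  also have "\<dots> = u 0 * continuant (\<lambda>i. u (Suc i)) (Suc (Suc (Suc m)))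
      - continuant (\<lambda>i. u (Suc (Suc i))) (Suc (Suc m))"
    unfolding ge2 continuant.simps(3)[of "\<lambda>i. u (Suc i)" "Suc m"] 
      continuant.simps(3)[of "\<lambda>i. u (Suc (Suc i))" m] by (simp only: algebra_simps)
  finally show ?case .
qed (simp_all add: algebra_simps)

lemma norm_continuant_le:
  fixes u :: "nat \<Rightarrow> 'a::real_normed_field"
  assumes "\<And>i. norm (u i) + 1 \<le> \<Lambda>" "1 \<le> \<Lambda>"
  shows "norm (continuant u m) \<le> \<Lambda> ^ m"
proof (induction m rule: induct_nat_012)
  case 0
  then show ?case by simp
next
  case 1
  then show ?case using assms(1)[of 0] by simp
next
  case (ge2 m)
  have "norm (continuant u (Suc (Suc m))) \<le>
      norm (u (Suc m)) * norm (continuant u (Suc m)) + norm (continuant u m)"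
    by (simp add: norm_mult norm_triangle_ineq4 order_trans[OF norm_triangle_ineq4])
  also have "\<dots> \<le> (\<Lambda> - 1) * \<Lambda> ^ Suc m + \<Lambda> ^ m"
    using ge2 assms(1)[of "Suc m"] assms(2) by (intro add_mono mult_mono) auto
  also have "\<dots> \<le> (\<Lambda> - 1) * \<Lambda> ^ Suc m + \<Lambda> ^ Suc m"
    using assms(2) by (intro add_left_mono power_increasing) auto
  also have "\<dots> = \<Lambda> ^ Suc (Suc m)" by (simp add: algebra_simps)
  finally show ?case .
qed

text \<open>A discrete Green identity: since \<open>p\<close> solves the homogeneous equation, the
  Wronskian of \<open>y\<close> and \<open>p\<close> changes from site to site only by the
  inhomogeneity weighted with \<open>p\<close>.\<close>

lemma Wronskian_telescope:
  fixes y p g u :: "nat \<Rightarrow> 'a::comm_ring_1"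
  assumes p: "\<And>i. i < m \<Longrightarrow> p i + p (Suc (Suc i)) = u i * p (Suc i)"
    and y: "\<And>i. i < m \<Longrightarrow> y i + y (Suc (Suc i)) - u i * y (Suc i) = g i"
    and "l \<le> k" "k \<le> m"
  shows "(y (Suc k) * p k - y k * p (Suc k)) - (y (Suc l) * p l - y l * p (Suc l))
     = (\<Sum>i=l..<k. p (Suc i) * g i)"
  using assms(3,4)
proof (induction k rule: dec_induct)
  case base
  then show ?case by simp
next
  case (step k)
  have k: "k < m" using step by simp
  have "p (Suc k) * g k = p (Suc k) * (y k + y (Suc (Suc k))) - y (Suc k) * (u k * p (Suc k))"
    unfolding y[OF k, symmetric] by (simp add: algebra_simps)
  also have "\<dots> = p (Suc k) * (y k + y (Suc (Suc k))) - y (Suc k) * (p k + p (Suc (Suc k)))"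
    unfolding p[OF k] ..
  finally have d: "(y (Suc (Suc k)) * p (Suc k) - y (Suc k) * p (Suc (Suc k)))
      - (y (Suc k) * p k - y k * p (Suc k)) = p (Suc k) * g k"
    by (simp add: algebra_simps)
  have IH: "(y (Suc k) * p k - y k * p (Suc k)) - (y (Suc l) * p l - y l * p (Suc l))
      = (\<Sum>i=l..<k. p (Suc i) * g i)"
    using step by simp
  have "(\<Sum>i=l..<Suc k. p (Suc i) * g i) = (\<Sum>i=l..<k. p (Suc i) * g i) + p (Suc k) * g k"
    using step by simp
  then show ?case unfolding d[symmetric] IH[symmetric] by simp
qed

text \<open>Cramer's rule for the Dirichlet problem on a box of length \<open>m\<close>: \<open>p\<close> and \<open>q\<close> below are the
  solutions vanishing at its left and right end, with Wronskian \<open>continuant u m\<close>.\<close>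

lemma Green_function_bound:
  fixes u :: "nat \<Rightarrow> real" and y :: "nat \<Rightarrow> complex"
  assumes "1 \<le> k" "k \<le> m"
    and S: "\<bar>continuant u (k - 1)\<bar> \<le> S" "\<bar>continuant (\<lambda>i. u (i + k)) (m - k)\<bar> \<le> S"
    and D: "\<And>l i. l + i \<le> m \<Longrightarrow> \<bar>continuant (\<lambda>i. u (i + l)) i\<bar> \<le> D"
  shows "\<bar>continuant u m\<bar> * cmod (y k) \<le> S * (cmod (y 0) + cmod (y (Suc m)))
    + 2 * S * D * (\<Sum>i<m. cmod (y i + y (Suc (Suc i)) - of_real (u i) * y (Suc i)))"
proof -
  \<comment> \<open>Equation \<open>i\<close> is centred at site \<open>i + 1\<close>, so the box
    consists of the sites 1 to \<open>m\<close> and its outer neighbours are 0 and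
    \<open>Suc m\<close>. The normalisations are \<open>p 1 = 1\<close> and
    \<open>q m = 1\<close>.\<close>
  define p where "p = (\<lambda>i. case i of 0 \<Rightarrow> 0 | Suc j \<Rightarrow> continuant u j)"
  define q where "q = (\<lambda>i. if i \<le> m then continuant (\<lambda>j. u (j + i)) (m - i) else 0)"
  define g where "g = (\<lambda>i. y i + y (Suc (Suc i)) - of_real (u i) * y (Suc i))"
  have pr: "p i + p (Suc (Suc i)) = u i * p (Suc i)" for i
    by (cases i) (auto simp: p_def)
  have qr: "q i + q (Suc (Suc i)) = u i * q (Suc i)" if "i < m" for i
  proof (cases "Suc (Suc i) \<le> m")
    case True
    then obtain n where n: "m = Suc (Suc (i + n))" using nat_le_iff_add by auto
    then have "q i = u i * q (Suc i) - q (Suc (Suc i))"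
      using continuant_left[of "\<lambda>j. u (j + i)" n] by (simp add: q_def)
    then show ?thesis by simp
  next
    case False
    then have "m = Suc i" using that by simp
    then show ?thesis by (simp add: q_def)
  qed
  have D0: "0 \<le> D" using D[of 0 0] by simp
  have S0: "0 \<le> S" using S by linarith
  have pD: "\<bar>p i\<bar> \<le> D" if "i \<le> Suc m" for i using D0 D[of 0 "i-1"] that by (auto simp: p_def split: nat.split)
  have qD: "\<bar>q i\<bar> \<le> D" for i using D0 D[of i "m - i"] by (auto simp: q_def)
  have pS: "\<bar>p k\<bar> \<le> S" using S(1) \<open>1 \<le> k\<close> by (cases k) (auto simp: p_def)
  have qS: "\<bar>q k\<bar> \<le> S" using S(2) \<open>k \<le> m\<close> by (simp add: q_def)
  define W where "W = (\<lambda>r i. y (Suc i) * complex_of_real (r i) - y i * of_real (r (Suc i)))"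
  have Wtel: "W r k' - W r l = (\<Sum>i=l..<k'. of_real (r (Suc i)) * g i)"
    if "\<And>i. i < m \<Longrightarrow> r i + r (Suc (Suc i)) = u i * r (Suc i)" "l \<le> k'" "k' \<le> m" for r k' l
    unfolding W_def
    by (rule Wronskian_telescope[of m _ "\<lambda>i. of_real (u i)"])
      (use that in \<open>auto simp: g_def simp flip: of_real_add of_real_mult\<close>)
  have err: "cmod (\<Sum>i=l..<k'. of_real (r (Suc i)) * g i) \<le> D * (\<Sum>i<m. cmod (g i))"
    if "\<And>i. i \<le> Suc m \<Longrightarrow> \<bar>r i\<bar> \<le> D" "k' \<le> m" for r l k'
  proof -
    have "cmod (\<Sum>i=l..<k'. of_real (r (Suc i)) * g i) \<le> (\<Sum>i=l..<k'. D * cmod (g i))"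
      using that by (intro sum_norm_le) (auto simp: norm_mult intro!: mult_right_mono)
    also have "\<dots> \<le> (\<Sum>i<m. D * cmod (g i))"
      using that D0 by (intro sum_mono2) auto
    finally show ?thesis by (simp add: sum_distrib_left)
  qed
  let ?e = "D * (\<Sum>i<m. cmod (g i))"
  have "W p 0 = - y 0" by (simp add: W_def p_def)
  then have Wp: "cmod (W p k) \<le> cmod (y 0) + ?e"
    using Wtel[of p 0 k] err[of p k 0] pr pD \<open>k \<le> m\<close> norm_triangle_sub[of "W p k" "W p 0"]
    by (simp del: diff_minus_eq_add)
  have "W q m = y (Suc m)" by (simp add: W_def q_def)
  then have Wq: "cmod (W q k) \<le> cmod (y (Suc m)) + ?e"
    using Wtel[of q k m] err[of q m k] qr qD \<open>k \<le> m\<close> norm_triangle_sub[of "W q k" "W q m"]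
    by (simp add: norm_minus_commute[of "W q k"])
  have wr: "q k * p (Suc k) - q (Suc k) * p k = continuant u m"
    using Wronskian_telescope[of m p u q "\<lambda>_. 0" 0 k] pr qr \<open>k \<le> m\<close>
    by (simp add: p_def q_def algebra_simps)
  \<comment> \<open>Eliminating \<open>y (Suc k)\<close> from the two Wronskians leaves
    \<open>y k\<close> times the Wronskian of \<open>p\<close> and \<open>q\<close>, which is
    constant and was evaluated at site 0. Only \<open>p k\<close> and \<open>q k\<close> multiply
    the boundary values, hence the finer bound \<open>S\<close> for these two alone.\<close>
  have "of_real (p k) * W q k - of_real (q k) * W p k = y k * of_real (q k * p (Suc k) - q (Suc k) * p k)"
    by (simp add: W_def algebra_simps)
  then have "cmod (y k) * \<bar>continuant u m\<bar> = cmod (of_real (p k) * W q k - of_real (q k) * W p k)"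
    by (simp add: wr norm_mult)
  also have "\<dots> \<le> \<bar>p k\<bar> * cmod (W q k) + \<bar>q k\<bar> * cmod (W p k)"
    by (rule order_trans[OF norm_triangle_ineq4]) (simp add: norm_mult)
  also have "\<dots> \<le> S * (cmod (y (Suc m)) + ?e) + S * (cmod (y 0) + ?e)"
    using pS qS S0 Wp Wq by (intro add_mono mult_mono) auto
  finally show ?thesis by (simp add: g_def algebra_simps)
qed

text \<open>The recursion preserves holomorphy in the phase, and the bound is exponential in
  \<open>m\<close> with a base independent of the centre of the disc and of \<alpha>. This makes the
  \<kappa> of the Bernstein inequality linear in \<open>m\<close>.\<close>

lemma hol_ext_continuant:
  assumes ext: "hol_ext \<rho> B f" and "0 \<le> B" and "\<bar>E\<bar> \<le> R"
  shows "hol_ext \<rho> ((R + B + 1) ^ m) (\<lambda>\<theta>. continuant (\<lambda>i. E - f (\<alpha> * real i + \<theta>)) m)"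
  unfolding hol_ext_def
proof
  fix x
  have "\<exists>F. \<forall>i. F i holomorphic_on ball 0 \<rho> \<and> (\<forall>z\<in>ball 0 \<rho>. cmod (F i z) \<le> B) \<and>
     (\<forall>t. \<bar>t\<bar> < \<rho> \<longrightarrow> F i (of_real t) = of_real (f (\<alpha> * real i + x + t)))"
    using ext unfolding hol_ext_def by (intro choice allI) blast
  then obtain F where F: "\<And>i. F i holomorphic_on ball 0 \<rho>" "\<And>i z. z\<in>ball 0 \<rho> \<Longrightarrow> cmod (F i z) \<le> B"
     "\<And>i t. \<bar>t\<bar> < \<rho> \<Longrightarrow> F i (of_real t) = of_real (f (\<alpha> * real i + x + t))"
    by blast
  define C where "C = (\<lambda>m z. continuant (\<lambda>i. of_real E - F i z) m)"
  have "C m holomorphic_on ball 0 \<rho>"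
  proof (induction m rule: induct_nat_012)
    case 0 show ?case by (simp add: C_def)
  next
    case 1 show ?case unfolding C_def continuant.simps by (intro holomorphic_intros F)
  next
    case (ge2 m)
    then show ?case unfolding C_def continuant.simps by (intro holomorphic_intros F)
  qed
  moreover have "cmod (C m z) \<le> (R + B + 1) ^ m" if "z \<in> ball 0 \<rho>" for z
    unfolding C_def
  proof (rule norm_continuant_le)
    fix i
    have "cmod (of_real E - F i z) \<le> \<bar>E\<bar> + cmod (F i z)"
      using norm_triangle_ineq4[of "of_real E" "F i z"] by simp
    then show "cmod (of_real E - F i z) + 1 \<le> R + B + 1" using assms F(2)[OF that, of i] by linarith
  qed (use assms in auto)
  moreover have "C m (of_real t) = of_real (continuant (\<lambda>i. E - f (\<alpha> * real i + (x + t))) m)"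
    if "\<bar>t\<bar> < \<rho>" for t
    by (induction m rule: induct_nat_012) (auto simp: C_def F(3)[OF that] add.assoc)
  ultimately show "\<exists>F. F holomorphic_on ball 0 \<rho> \<and> (\<forall>z\<in>ball 0 \<rho>. cmod (F z) \<le> (R + B + 1) ^ m) \<and>
     (\<forall>t. \<bar>t\<bar> < \<rho> \<longrightarrow> F (of_real t) = of_real (continuant (\<lambda>i. E - f (\<alpha> * real i + (x + t))) m))"
    by blast
qed

section \<open>Square-summable sequences\<close>

text \<open>Turning the set into a type gives access to the classes of inner product and Banach
  spaces. The sequences are complex but the scalars real, with the real part of the usual inner
  product; this fits real energies and real potentials and leaves the norm unchanged.\<close>

typedef ell = "l2"
proof
  show "(\<lambda>_. 0) \<in> l2" by (simp add: l2_def)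
qed

setup_lifting type_definition_ell

lemma l2_iff: "\<psi> \<in> l2 \<longleftrightarrow> (\<lambda>n. (cmod (\<psi> n))\<^sup>2) summable_on UNIV"
  by (simp add: l2_def)

lemma summable_on_real_comparison:
  fixes f g :: "'a \<Rightarrow> real"
  assumes "g summable_on A" "\<And>x. x \<in> A \<Longrightarrow> norm (f x) \<le> g x"
  shows "f summable_on A"
  by (rule Infinite_Sum.abs_summable_summable, rule Infinite_Sum.abs_summable_on_comparison_test'[OF assms])

lemma summable_inner:
  assumes "\<phi> \<in> l2" "\<psi> \<in> l2"
  shows "(\<lambda>n. inner (\<phi> n) (\<psi> n)) summable_on UNIV"
proof (rule summable_on_real_comparison[where g = "\<lambda>n. (cmod (\<phi> n))\<^sup>2 + (cmod (\<psi> n))\<^sup>2"])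
  show "(\<lambda>n. (cmod (\<phi> n))\<^sup>2 + (cmod (\<psi> n))\<^sup>2) summable_on UNIV"
    using assms by (intro summable_on_add) (auto simp: l2_iff)
  fix n
  have "\<bar>inner (\<phi> n) (\<psi> n)\<bar> \<le> cmod (\<phi> n) * cmod (\<psi> n)" by (rule Cauchy_Schwarz_ineq2)
  also have "\<dots> \<le> (cmod (\<phi> n))\<^sup>2 + (cmod (\<psi> n))\<^sup>2"
    using sum_squares_bound[of "cmod (\<phi> n)" "cmod (\<psi> n)"]
      zero_le_power2[of "cmod (\<phi> n)"] zero_le_power2[of "cmod (\<psi> n)"] by linarith
  finally show "norm (inner (\<phi> n) (\<psi> n)) \<le> (cmod (\<phi> n))\<^sup>2 + (cmod (\<psi> n))\<^sup>2" by simp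
qed

lemma l2_add:
  assumes "\<phi> \<in> l2" "\<psi> \<in> l2"
  shows "(\<lambda>n. \<phi> n + \<psi> n) \<in> l2"
  unfolding l2_iff
proof (rule summable_on_real_comparison)
  show "(\<lambda>n. 2 * ((cmod (\<phi> n))\<^sup>2 + (cmod (\<psi> n))\<^sup>2)) summable_on UNIV"
    using assms by (intro summable_on_add summable_on_cmult_right) (simp_all add: l2_iff)
  fix n
  have "(cmod (\<phi> n + \<psi> n))\<^sup>2 \<le> (cmod (\<phi> n) + cmod (\<psi> n))\<^sup>2"
    by (intro power_mono norm_triangle_ineq) simp
  also have "\<dots> \<le> 2 * ((cmod (\<phi> n))\<^sup>2 + (cmod (\<psi> n))\<^sup>2)"
    using sum_squares_bound[of "cmod (\<phi> n)" "cmod (\<psi> n)"] by (simp add: power2_sum)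
  finally show "norm ((cmod (\<phi> n + \<psi> n))\<^sup>2) \<le> 2 * ((cmod (\<phi> n))\<^sup>2 + (cmod (\<psi> n))\<^sup>2)" by simp
qed

lemma l2_mult: "\<psi> \<in> l2 \<Longrightarrow> (\<And>n. cmod (a n) \<le> M) \<Longrightarrow> (\<lambda>n. a n * \<psi> n) \<in> l2"
  unfolding l2_iff
proof (rule summable_on_real_comparison[where g = "\<lambda>n. M\<^sup>2 * (cmod (\<psi> n))\<^sup>2"])
  fix n assume "\<And>n. cmod (a n) \<le> M"
  then show "norm ((cmod (a n * \<psi> n))\<^sup>2) \<le> M\<^sup>2 * (cmod (\<psi> n))\<^sup>2"
    by (auto simp: norm_mult power_mult_distrib intro!: mult_right_mono power_mono)
qed (auto intro: summable_on_cmult_right)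

lemma l2_scaleR: "\<psi> \<in> l2 \<Longrightarrow> (\<lambda>n. c *\<^sub>R \<psi> n) \<in> l2"
  using l2_mult[of \<psi> "\<lambda>_. of_real c" "\<bar>c\<bar>"] by (simp add: scaleR_conv_of_real)

lemma bij_shift: "bij_betw (\<lambda>n::int. n + k) UNIV UNIV"
  by (rule bij_betwI[where g = "\<lambda>n. n - k"]) auto

lemma l2_shift: "\<psi> \<in> l2 \<Longrightarrow> (\<lambda>n. \<psi> (n + k)) \<in> l2"
  unfolding l2_iff
  using summable_on_reindex_bij_betw[OF bij_shift, of "\<lambda>n. (cmod (\<psi> n))\<^sup>2" k] by simp

instantiation ell :: real_inner
begin
lift_definition zero_ell :: ell is "\<lambda>_. 0" by (simp add: l2_def)
lift_definition plus_ell :: "ell \<Rightarrow> ell \<Rightarrow> ell" is "\<lambda>\<phi> \<psi> n. \<phi> n + \<psi> n" by (rule l2_add)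
lift_definition scaleR_ell :: "real \<Rightarrow> ell \<Rightarrow> ell" is "\<lambda>c \<psi> n. c *\<^sub>R \<psi> n" by (rule l2_scaleR)
lift_definition uminus_ell :: "ell \<Rightarrow> ell" is "\<lambda>\<psi> n. - \<psi> n" by (simp add: l2_iff)
lift_definition minus_ell :: "ell \<Rightarrow> ell \<Rightarrow> ell" is "\<lambda>\<phi> \<psi> n. \<phi> n - \<psi> n"
  by (drule l2_scaleR[of _ "-1"], drule (1) l2_add) simp
lift_definition inner_ell :: "ell \<Rightarrow> ell \<Rightarrow> real" is "\<lambda>\<phi> \<psi>. \<Sum>\<^sub>\<infinity>n. inner (\<phi> n) (\<psi> n)" .
definition norm_ell :: "ell \<Rightarrow> real" where "norm_ell x = sqrt (inner x x)"
definition dist_ell :: "ell \<Rightarrow> ell \<Rightarrow> real" where "dist_ell x y = norm (x - y)"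
definition sgn_ell :: "ell \<Rightarrow> ell" where "sgn_ell x = scaleR (inverse (norm x)) x"
definition uniformity_ell :: "(ell \<times> ell) filter" where
  "uniformity_ell = (INF e\<in>{0<..}. principal {(x, y). dist x y < e})"
definition open_ell :: "ell set \<Rightarrow> bool" where
  "open_ell U \<longleftrightarrow> (\<forall>x\<in>U. eventually (\<lambda>(x', y). x' = x \<longrightarrow> y \<in> U) uniformity)"

instance
proof
  fix x y z :: ell and a b :: real
  show "dist x y = norm (x - y)" by (rule dist_ell_def)
  show "sgn x = scaleR (inverse (norm x)) x" by (rule sgn_ell_def)
  show "uniformity = (INF e\<in>{0<..}. principal {(x, y). dist x y < (e::real)} :: (ell \<times> ell) filter)"
    by (rule uniformity_ell_def)
  show "open U \<longleftrightarrow> (\<forall>x\<in>U. eventually (\<lambda>(x', y). x' = x \<longrightarrow> y \<in> U) uniformity)" for U :: "ell set"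
    by (rule open_ell_def)
  show "norm x = sqrt (inner x x)" by (rule norm_ell_def)
  show "x + y + z = x + (y + z)" by transfer (simp add: add.assoc)
  show "x + y = y + x" by transfer (simp add: add.commute)
  show "0 + x = x" by transfer simp
  show "- x + x = 0" by transfer simp
  show "x - y = x + - y" by transfer simp
  show "a *\<^sub>R (x + y) = a *\<^sub>R x + a *\<^sub>R y" by transfer (simp add: scaleR_right_distrib)
  show "(a + b) *\<^sub>R x = a *\<^sub>R x + b *\<^sub>R x" by transfer (simp add: scaleR_left_distrib)
  show "a *\<^sub>R b *\<^sub>R x = (a * b) *\<^sub>R x" by transfer simp
  show "1 *\<^sub>R x = x" by transfer simp
  show "inner x y = inner y x" by transfer (simp add: inner_commute)
  show "inner (x + y) z = inner x z + inner y z"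
    by transfer (simp add: inner_add_left infsum_add summable_inner)
  show "inner (a *\<^sub>R x) y = a * inner x y"
    by transfer (simp add: infsum_cmult_right')
  show "0 \<le> inner x x" by transfer (simp add: infsum_nonneg)
  show "inner x x = 0 \<longleftrightarrow> x = 0"
  proof
    assume "inner x x = 0"
    then show "x = 0"
    proof transfer
      fix \<psi> :: "int \<Rightarrow> complex"
      assume \<psi>: "\<psi> \<in> l2" and 0: "(\<Sum>\<^sub>\<infinity>n. inner (\<psi> n) (\<psi> n)) = 0"
      have "inner (\<psi> n) (\<psi> n) = 0" for n
        by (rule nonneg_infsum_le_0D[where A = UNIV]) (use 0 summable_inner[OF \<psi> \<psi>] in auto)
      then show "\<psi> = (\<lambda>_. 0)" by auto
    qed
  qed (transfer, simp)
qed
end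

lemma norm_ell_Rep: "norm x = l2norm (Rep_ell x)"
  by (simp add: norm_ell_def inner_ell.rep_eq l2norm_def dot_square_norm)

lemma norm_ell_sq: "(norm x)\<^sup>2 = (\<Sum>\<^sub>\<infinity>n. (cmod (Rep_ell x n))\<^sup>2)"
  by (simp add: norm_ell_Rep l2norm_def infsum_nonneg)

lemma Rep_ell_summable: "(\<lambda>n. (cmod (Rep_ell x n))\<^sup>2) summable_on UNIV"
  using Rep_ell[of x] by (simp add: l2_iff)

lemma sum_Rep_ell_le: "finite F \<Longrightarrow> (\<Sum>n\<in>F. (cmod (Rep_ell x n))\<^sup>2) \<le> (norm x)\<^sup>2"
  unfolding norm_ell_sq by (intro finite_sum_le_infsum Rep_ell_summable) auto

lemma cmod_Rep_ell_le: "cmod (Rep_ell x n) \<le> norm x"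
  by (rule power2_le_imp_le) (use sum_Rep_ell_le[of "{n}" x] in auto)

text \<open>Membership and norm are both read off from finite partial sums, so limits and pointwise
  estimates can be handled without manipulating infinite sums.\<close>

lemma l2_if_sums_bounded:
  assumes "\<And>F. finite F \<Longrightarrow> (\<Sum>n\<in>F. (cmod (\<psi> n))\<^sup>2) \<le> e\<^sup>2" "0 \<le> e"
  shows "\<psi> \<in> l2" and "norm (Abs_ell \<psi>) \<le> e"
proof -
  have s: "(\<lambda>n. (cmod (\<psi> n))\<^sup>2) summable_on UNIV"
    by (rule nonneg_bdd_above_summable_on) (use assms in \<open>auto intro!: bdd_aboveI2\<close>)
  then show l2: "\<psi> \<in> l2" by (simp add: l2_iff)
  have "(norm (Abs_ell \<psi>))\<^sup>2 \<le> e\<^sup>2"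
    unfolding norm_ell_sq Abs_ell_inverse[OF l2] using assms s by (intro infsum_le_finite_sums) auto
  then show "norm (Abs_ell \<psi>) \<le> e" using assms(2) by (rule power2_le_imp_le)
qed

text \<open>Evaluation at a site is a contraction, so a Cauchy sequence converges pointwise. The
  Cauchy estimate survives the pointwise limit on each finite set of sites, uniformly in that set,
  and hence holds in norm.\<close>

instance ell :: banach
proof
  fix X :: "nat \<Rightarrow> ell" assume X: "Cauchy X"
  have "convergent (\<lambda>i. Rep_ell (X i) n)" for n
  proof -
    have "Cauchy (\<lambda>i. Rep_ell (X i) n)"
      unfolding Cauchy_def
    proof (intro allI impI)
      fix e :: real assume "0 < e"
      then obtain M where "\<forall>i\<ge>M. \<forall>j\<ge>M. dist (X i) (X j) < e" using X unfolding Cauchy_def by blast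
      then show "\<exists>M. \<forall>i\<ge>M. \<forall>j\<ge>M. dist (Rep_ell (X i) n) (Rep_ell (X j) n) < e"
        by (metis cmod_Rep_ell_le dist_norm le_less_trans minus_ell.rep_eq)
    qed
    then show ?thesis by (simp add: Cauchy_convergent_iff)
  qed
  then obtain L where L: "\<And>n. (\<lambda>i. Rep_ell (X i) n) \<longlonglongrightarrow> L n"
    unfolding convergent_def by metis
  have key: "\<exists>M. \<forall>i\<ge>M. (\<lambda>n. Rep_ell (X i) n - L n) \<in> l2 \<and> norm (Abs_ell (\<lambda>n. Rep_ell (X i) n - L n)) \<le> e"
    if e: "0 < e" for e
  proof -
    obtain M where M: "\<forall>i\<ge>M. \<forall>j\<ge>M. dist (X i) (X j) < e"
      using X e unfolding Cauchy_def by blast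
    have bound: "(\<Sum>n\<in>F. (cmod (Rep_ell (X i) n - L n))\<^sup>2) \<le> e\<^sup>2" if "i \<ge> M" "finite F" for i F
    proof (rule LIMSEQ_le_const2)
      show "(\<lambda>j. \<Sum>n\<in>F. (cmod (Rep_ell (X i) n - Rep_ell (X j) n))\<^sup>2)
         \<longlonglongrightarrow> (\<Sum>n\<in>F. (cmod (Rep_ell (X i) n - L n))\<^sup>2)"
        by (intro tendsto_intros L)
      have "(\<Sum>n\<in>F. (cmod (Rep_ell (X i) n - Rep_ell (X j) n))\<^sup>2) \<le> e\<^sup>2" if "j \<ge> M" for j
      proof -
        have "(\<Sum>n\<in>F. (cmod (Rep_ell (X i - X j) n))\<^sup>2) \<le> (norm (X i - X j))\<^sup>2"
          by (rule sum_Rep_ell_le) fact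
        also have "\<dots> \<le> e\<^sup>2"
          using M \<open>i \<ge> M\<close> that by (intro power_mono) (auto simp: dist_norm less_imp_le)
        finally show ?thesis by (simp add: minus_ell.rep_eq)
      qed
      then show "\<exists>N. \<forall>j\<ge>N. (\<Sum>n\<in>F. (cmod (Rep_ell (X i) n - Rep_ell (X j) n))\<^sup>2) \<le> e\<^sup>2" by blast
    qed
    show ?thesis
    proof (intro exI[of _ M] allI impI)
      fix i assume "M \<le> i"
      show "(\<lambda>n. Rep_ell (X i) n - L n) \<in> l2 \<and> norm (Abs_ell (\<lambda>n. Rep_ell (X i) n - L n)) \<le> e"
        using l2_if_sums_bounded[OF bound[OF \<open>M \<le> i\<close>] less_imp_le[OF e]] by blast
    qed
  qed
  obtain i0 where "(\<lambda>n. Rep_ell (X i0) n - L n) \<in> l2" using key[of 1] by auto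
  from l2_add[OF Rep_ell[of "X i0"] l2_scaleR[OF this, of "-1"]] have Ll2: "L \<in> l2" by simp
  have "X \<longlonglongrightarrow> Abs_ell L"
  proof (rule LIMSEQ_I)
    fix e :: real assume "0 < e"
    then obtain M where M: "\<And>i. i \<ge> M \<Longrightarrow> (\<lambda>n. Rep_ell (X i) n - L n) \<in> l2 \<and> norm (Abs_ell (\<lambda>n. Rep_ell (X i) n - L n)) \<le> e / 2"
      using key[of "e/2"] by auto
    have "norm (X i - Abs_ell L) < e" if "i \<ge> M" for i
    proof -
      have "X i - Abs_ell L = Abs_ell (\<lambda>n. Rep_ell (X i) n - L n)"
        using M[OF that] by (intro Rep_ell_inject[THEN iffD1])
          (simp add: minus_ell.rep_eq Abs_ell_inverse Ll2 fun_eq_iff)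
      then show ?thesis using M[OF that] \<open>0 < e\<close> by auto
    qed
    then show "\<exists>M. \<forall>i\<ge>M. norm (X i - Abs_ell L) < e" by blast
  qed
  then show "convergent X" by (auto simp: convergent_def)
qed

section \<open>Spectrum and approximate eigenvectors\<close>

text \<open>With \<open>M\<close> a bound for \<open>K\<close>, the map \<open>x \<mapsto> x - K\<^sup>2 x / M\<^sup>2 + y / M\<^sup>2\<close>
  is a contraction, and its fixed point solves \<open>K\<^sup>2 x = y\<close>.\<close>

lemma symmetric_bounded_below_imp_surj:
  fixes K :: "'a::{real_inner,banach} \<Rightarrow> 'a"
  assumes lin: "linear K" and sym: "\<And>x y. inner (K x) y = inner x (K y)"
    and M: "\<And>x. norm (K x) \<le> M * norm x" "0 < M"
    and m: "\<And>x. m * norm x \<le> norm (K x)" "0 < m"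
  shows "\<exists>x. K x = y"
proof (cases "\<exists>z::'a. z \<noteq> 0")
  case False
  then show ?thesis by metis
next
  case True
  then obtain z :: 'a where "z \<noteq> 0" by blast
  \<comment> \<open>A nonzero vector allows the comparison of \<open>m\<close> with
    \<open>M\<close>, which keeps \<open>1 - t * m\<^sup>2\<close> nonnegative under the
    root.\<close>
  have "m * norm z \<le> M * norm z" using m(1) M(1) order_trans by blast
  then have mM: "m \<le> M" using \<open>z \<noteq> 0\<close> by simp
  define t where "t = 1 / M\<^sup>2"
  define R where "R = (\<lambda>x. x - t *\<^sub>R K (K x))"
  have t: "0 < t" "t * M\<^sup>2 = 1" using M(2) by (auto simp: t_def)
  define q where "q = sqrt (1 - t * m\<^sup>2)"
  have "t * m\<^sup>2 \<le> t * M\<^sup>2" using t m(2) mM by (intro mult_left_mono power_mono) auto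
  then have tm: "0 \<le> 1 - t * m\<^sup>2" "1 - t * m\<^sup>2 < 1" using t m(2) by auto
  then have q: "0 \<le> q" "q < 1" by (auto simp: q_def)
  have R: "norm (R x) \<le> q * norm x" for x
  proof (rule power2_le_imp_le)
    have 1: "inner x (K (K x)) = (norm (K x))\<^sup>2" using sym[of x "K x"] by (simp add: dot_square_norm)
    \<comment> \<open>In the expansion of the square, the quadratic term can give back at most half
      of the cross term \<open>2 t |K x|^2\<close>; the remaining half yields the
      contraction.\<close>
    have "(norm (K (K x)))\<^sup>2 \<le> M\<^sup>2 * (norm (K x))\<^sup>2"
      using power_mono[OF M(1)[of "K x"], of 2] by (simp add: power_mult_distrib)
    then have "t\<^sup>2 * (norm (K (K x)))\<^sup>2 \<le> t\<^sup>2 * (M\<^sup>2 * (norm (K x))\<^sup>2)" by (intro mult_left_mono) auto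
    also have "\<dots> = t * (norm (K x))\<^sup>2" using t(2) by (simp add: power2_eq_square mult_ac)
    finally have 2: "t\<^sup>2 * (norm (K (K x)))\<^sup>2 \<le> t * (norm (K x))\<^sup>2" .
    have "(m * norm x)\<^sup>2 \<le> (norm (K x))\<^sup>2" using m by (intro power_mono) auto
    then have 3: "t * (m\<^sup>2 * (norm x)\<^sup>2) \<le> t * (norm (K x))\<^sup>2"
      using t by (intro mult_left_mono) (auto simp: power_mult_distrib)
    have "(norm (R x))\<^sup>2 = (norm x)\<^sup>2 - 2 * t * inner x (K (K x)) + t\<^sup>2 * (norm (K (K x)))\<^sup>2"
      unfolding R_def power2_norm_eq_inner
      by (simp add: inner_diff_left inner_diff_right inner_commute power2_eq_square algebra_simps)
    also have "\<dots> \<le> (1 - t * m\<^sup>2) * (norm x)\<^sup>2" using 1 2 3 by (simp add: algebra_simps)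
    also have "\<dots> = (q * norm x)\<^sup>2" using tm by (simp add: q_def power_mult_distrib)
    finally show "(norm (R x))\<^sup>2 \<le> (q * norm x)\<^sup>2" .
  qed (use q in simp)
  have "\<exists>!x. R x + t *\<^sub>R y = x"
  proof (rule banach_fix_type[OF q], intro allI)
    fix x1 x2 :: 'a
    have "R x1 + t *\<^sub>R y - (R x2 + t *\<^sub>R y) = R (x1 - x2)"
      by (simp add: R_def linear_diff[OF lin] algebra_simps)
    then show "dist (R x1 + t *\<^sub>R y) (R x2 + t *\<^sub>R y) \<le> q * dist x1 x2"
      using R[of "x1 - x2"] by (simp add: dist_norm)
  qed
  then obtain x where "R x + t *\<^sub>R y = x" by auto
  then have "t *\<^sub>R K (K x) = t *\<^sub>R y" by (auto simp: R_def algebra_simps)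
  then have "K (K x) = y" using t(1) by simp
  then show ?thesis by blast
qed

text \<open>With \<open>m\<close> the best lower bound of \<open>K\<close>, one of \<open>K - m\<close>, \<open>K + m\<close> is not bounded below:
  otherwise \<open>P = K\<^sup>2 - m\<^sup>2\<close> would be, and \<open>\<parallel>P x\<parallel>\<^sup>2 \<le> M\<^sup>2 \<langle>x, P x\<rangle>\<close> would improve \<open>m\<close>.\<close>

lemma symmetric_approx_eigenvalue:
  fixes K :: "'a::real_inner \<Rightarrow> 'a"
  assumes lin: "linear K" and sym: "\<And>x y. inner (K x) y = inner x (K y)"
    and M: "\<And>x. norm (K x) \<le> M * norm x" "0 < M"
    and x0: "x0 \<noteq> 0" "norm (K x0) \<le> \<epsilon> * norm x0"
  shows "\<exists>\<mu>. \<bar>\<mu>\<bar> \<le> \<epsilon> \<and> \<not> (\<exists>c>0. \<forall>x. c * norm x \<le> norm (K x - \<mu> *\<^sub>R x))"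
proof (rule ccontr)
  assume neg: "\<not> ?thesis"
  define S where "S = (\<lambda>x. norm (K x) / norm x) ` {x. x \<noteq> 0}"
  define m where "m = Inf S"
  have S0: "S \<noteq> {}" using x0 by (auto simp: S_def)
  have bdd: "bdd_below S" by (rule bdd_belowI[of _ 0]) (auto simp: S_def)
  have m0: "0 \<le> m" unfolding m_def by (rule cInf_greatest[OF S0]) (auto simp: S_def)
  have "norm (K x0) / norm x0 \<in> S" using x0 by (auto simp: S_def)
  then have "m \<le> norm (K x0) / norm x0" unfolding m_def by (rule cInf_lower[OF _ bdd])
  also have "\<dots> \<le> \<epsilon>" using x0 by (simp add: divide_le_eq)
  finally have m\<epsilon>: "m \<le> \<epsilon>" .
  have mK: "m * norm x \<le> norm (K x)" for x
  proof (cases "x = 0")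
    case False
    then have "norm (K x) / norm x \<in> S" by (auto simp: S_def)
    then have "m \<le> norm (K x) / norm x" unfolding m_def by (rule cInf_lower[OF _ bdd])
    then show ?thesis using False by (simp add: le_divide_eq)
  qed simp
  obtain c1 where c1: "0 < c1" "\<And>x. c1 * norm x \<le> norm (K x - m *\<^sub>R x)"
    using neg m0 m\<epsilon> by (metis abs_of_nonneg)
  obtain c2 where c2: "0 < c2" "\<And>x. c2 * norm x \<le> norm (K x - (- m) *\<^sub>R x)"
    using neg m0 m\<epsilon> by (metis abs_minus_cancel abs_of_nonneg)
  define c where "c = c1 * c2"
  have c: "0 < c" using c1 c2 by (simp add: c_def)
  define P where "P = (\<lambda>x. K (K x) - m\<^sup>2 *\<^sub>R x)"
  have cP: "c * norm x \<le> norm (P x)" for x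
  proof -
    have "c * norm x \<le> c1 * norm (K x - (- m) *\<^sub>R x)"
      using c2(2)[of x] c1(1) by (simp add: c_def mult.assoc)
    also have "\<dots> \<le> norm (K (K x - (- m) *\<^sub>R x) - m *\<^sub>R (K x - (- m) *\<^sub>R x))" by (rule c1)
    also have "K (K x - (- m) *\<^sub>R x) - m *\<^sub>R (K x - (- m) *\<^sub>R x) = P x"
      by (simp add: P_def linear_diff[OF lin] linear_add[OF lin] linear_scale[OF lin] power2_eq_square algebra_simps)
    finally show ?thesis .
  qed
  have ipP: "inner x (P x) = (norm (K x))\<^sup>2 - m\<^sup>2 * (norm x)\<^sup>2" for x
    by (simp add: P_def inner_diff_right sym[of x "K x", symmetric] dot_square_norm)
  have ipP0: "0 \<le> inner x (P x)" for x
    using power_mono[OF mK[of x], of 2] m0 by (simp add: ipP power_mult_distrib)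
  have Psym: "inner (P x) y = inner x (P y)" for x y
    by (simp add: P_def inner_diff_left inner_diff_right sym)
  have Plin: "P (x - a *\<^sub>R y) = P x - a *\<^sub>R P y" for x a y
    by (simp add: P_def linear_diff[OF lin] linear_scale[OF lin] algebra_simps)
  define t where "t = 1 / M\<^sup>2"
  have t: "0 < t" "t * M\<^sup>2 = 1" using M(2) by (auto simp: t_def)
  have improve: "(m\<^sup>2 + t * c\<^sup>2) * (norm x)\<^sup>2 \<le> (norm (K x))\<^sup>2" for x
  proof -
    have "inner (P x) (P (P x)) \<le> (norm (K (P x)))\<^sup>2" by (simp add: ipP)
    also have "\<dots> \<le> (M * norm (P x))\<^sup>2" by (intro power_mono M) auto
    finally have "t\<^sup>2 * inner (P x) (P (P x)) \<le> t\<^sup>2 * (M * norm (P x))\<^sup>2" by (intro mult_left_mono) auto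
    also have "\<dots> = t * (norm (P x))\<^sup>2" using t(2) by (simp add: power2_eq_square mult_ac)
    finally have 1: "t\<^sup>2 * inner (P x) (P (P x)) \<le> t * (norm (P x))\<^sup>2" .
    \<comment> \<open>A Cauchy-Schwarz argument for the nonnegative form of \<open>P\<close>:
      testing it at \<open>x - t P x\<close> with \<open>t = 1 / M^2\<close> gives
      \<open>t |P x|^2 \<le> inner x (P x)\<close>.\<close>
    have "0 \<le> inner (x - t *\<^sub>R P x) (P (x - t *\<^sub>R P x))" by (rule ipP0)
    also have "\<dots> = inner x (P x) - 2 * t * (norm (P x))\<^sup>2 + t\<^sup>2 * inner (P x) (P (P x))"
      using Psym[of x "P x", symmetric] unfolding Plin
      by (simp add: inner_diff_left inner_diff_right dot_square_norm power2_eq_square algebra_simps)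
    finally have "t * (norm (P x))\<^sup>2 \<le> inner x (P x)" using 1 by linarith
    moreover have "t * (c\<^sup>2 * (norm x)\<^sup>2) \<le> t * (norm (P x))\<^sup>2"
      using power_mono[OF cP[of x], of 2] c t by (intro mult_left_mono) (auto simp: power_mult_distrib)
    ultimately show ?thesis by (simp add: ipP algebra_simps)
  qed
  have "sqrt (m\<^sup>2 + t * c\<^sup>2) \<le> m"
    unfolding m_def
  proof (rule cInf_greatest[OF S0])
    fix s assume "s \<in> S"
    then obtain x where x: "x \<noteq> 0" "s = norm (K x) / norm x" by (auto simp: S_def)
    have "m\<^sup>2 + t * c\<^sup>2 \<le> s\<^sup>2" using improve[of x] x by (simp add: power_divide le_divide_eq)
    then show "sqrt ((Inf S)\<^sup>2 + t * c\<^sup>2) \<le> s"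
      unfolding m_def[symmetric] using x by (intro real_le_lsqrt) auto
  qed
  then have "m\<^sup>2 + t * c\<^sup>2 \<le> m\<^sup>2" using m0 real_sqrt_le_iff by (metis abs_of_nonneg real_sqrt_abs)
  moreover have "0 < t * c\<^sup>2" using t c by simp
  ultimately show False by linarith
qed

section \<open>Jacobi operators with bounded real potential\<close>

definition jacobi :: "(int \<Rightarrow> real) \<Rightarrow> (int \<Rightarrow> complex) \<Rightarrow> int \<Rightarrow> complex" where
  "jacobi v \<psi> n = \<psi> (n - 1) + \<psi> (n + 1) + of_real (v n) * \<psi> n"

text \<open>\<open>Abs_ell\<close> is meaningful here only if the image is square summable, which is
  why the facts below carry a bound on the potential.\<close>

definition Jop :: "(int \<Rightarrow> real) \<Rightarrow> ell \<Rightarrow> ell" where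
  "Jop v x = Abs_ell (jacobi v (Rep_ell x))"

text \<open>The energy is absorbed into the potential, so that \<open>H - E\<close> is itself a
  Jacobi operator and a change of energy or of phase is a change of potential.\<close>

definition pot :: "(real \<Rightarrow> real) \<Rightarrow> real \<Rightarrow> real \<Rightarrow> real \<Rightarrow> int \<Rightarrow> real" where
  "pot f \<alpha> \<theta> E n = f (\<alpha> * of_int n + \<theta>) - E"

lemma Hop_eq_jacobi: "(\<lambda>n. Hop f \<alpha> \<theta> \<psi> n - complex_of_real E * \<psi> n) = jacobi (pot f \<alpha> \<theta> E) \<psi>"
  by (simp add: fun_eq_iff Hop_def jacobi_def pot_def algebra_simps)

lemma jacobi_l2:
  assumes "\<forall>n. \<bar>v n\<bar> \<le> M" "\<psi> \<in> l2"
  shows "jacobi v \<psi> \<in> l2"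
proof -
  have "(\<lambda>n. (\<psi> (n + (-1)) + \<psi> (n + 1)) + complex_of_real (v n) * \<psi> n) \<in> l2"
    by (intro l2_add l2_shift l2_mult[where M = M] assms) (use assms in auto)
  then show ?thesis by (simp add: jacobi_def[abs_def])
qed

lemma Rep_Jop: "\<forall>n. \<bar>v n\<bar> \<le> M \<Longrightarrow> Rep_ell (Jop v x) = jacobi v (Rep_ell x)"
  unfolding Jop_def by (rule Abs_ell_inverse) (use jacobi_l2 Rep_ell in blast)

lemma linear_Jop:
  assumes "\<forall>n. \<bar>v n\<bar> \<le> M"
  shows "linear (Jop v)"
proof
  fix x y :: ell and c :: real
  show "Jop v (x + y) = Jop v x + Jop v y"
    by (rule Rep_ell_inject[THEN iffD1])
      (simp add: fun_eq_iff Rep_Jop[OF assms] plus_ell.rep_eq jacobi_def algebra_simps)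
  show "Jop v (c *\<^sub>R x) = c *\<^sub>R Jop v x"
    by (rule Rep_ell_inject[THEN iffD1])
      (simp add: fun_eq_iff Rep_Jop[OF assms] scaleR_ell.rep_eq jacobi_def algebra_simps)
qed

lemma Jop_diff_scale:
  assumes "\<forall>n. \<bar>v n\<bar> \<le> M"
  shows "Jop v x - \<mu> *\<^sub>R x = Jop (\<lambda>n. v n - \<mu>) x"
proof (rule Rep_ell_inject[THEN iffD1])
  have "\<bar>v n - \<mu>\<bar> \<le> M + \<bar>\<mu>\<bar>" for n using assms[rule_format, of n] by linarith
  then have "\<forall>n. \<bar>v n - \<mu>\<bar> \<le> M + \<bar>\<mu>\<bar>" by blast
  then show "Rep_ell (Jop v x - \<mu> *\<^sub>R x) = Rep_ell (Jop (\<lambda>n. v n - \<mu>) x)"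
    by (simp add: fun_eq_iff Rep_Jop[OF assms] Rep_Jop[of "\<lambda>n. v n - \<mu>" "M + \<bar>\<mu>\<bar>"]
        minus_ell.rep_eq scaleR_ell.rep_eq jacobi_def algebra_simps scaleR_conv_of_real)
qed

lemma Jop_symmetric:
  assumes "\<forall>n. \<bar>v n\<bar> \<le> M"
  shows "inner (Jop v x) y = inner x (Jop v y)"
proof -
  let ?x = "Rep_ell x" and ?y = "Rep_ell y"
  have sh: "(\<Sum>\<^sub>\<infinity>n. inner (?x (n - 1)) (?y n)) = (\<Sum>\<^sub>\<infinity>n. inner (?x n) (?y (n + 1)))"
    "(\<Sum>\<^sub>\<infinity>n. inner (?x (n + 1)) (?y n)) = (\<Sum>\<^sub>\<infinity>n. inner (?x n) (?y (n - 1)))"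
    using infsum_reindex_bij_betw[OF bij_shift[of 1], of "\<lambda>n. inner (?x (n - 1)) (?y n)"]
      infsum_reindex_bij_betw[OF bij_shift[of 1], of "\<lambda>n. inner (?x n) (?y (n - 1))"] by simp_all
  have s: "(\<lambda>n. \<psi> (n - 1)) \<in> l2" "(\<lambda>n. \<psi> (n + 1)) \<in> l2" "(\<lambda>n. of_real (v n) * \<psi> n) \<in> l2"
    if "\<psi> \<in> l2" for \<psi>
    using l2_shift[OF that, of "-1"] l2_shift[OF that, of 1] l2_mult[OF that, of "\<lambda>n. of_real (v n)" M] assms
    by simp_all
  note S = summable_inner[OF s(1) Rep_ell] summable_inner[OF s(2) Rep_ell] summable_inner[OF s(3) Rep_ell]
    summable_inner[OF Rep_ell s(1)] summable_inner[OF Rep_ell s(2)] summable_inner[OF Rep_ell s(3)]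
  have v: "inner (of_real (v n) * a) b = inner a (of_real (v n) * b)" for n and a b :: complex
    by (simp add: inner_complex_def algebra_simps)
  have "inner (Jop v x) y = (\<Sum>\<^sub>\<infinity>n. inner (?x (n - 1)) (?y n)) + (\<Sum>\<^sub>\<infinity>n. inner (?x (n + 1)) (?y n))
      + (\<Sum>\<^sub>\<infinity>n. inner (of_real (v n) * ?x n) (?y n))"
    using S(1-3)[OF Rep_ell[of x], of y] unfolding inner_ell.rep_eq Rep_Jop[OF assms] jacobi_def
    by (simp add: inner_add_left infsum_add summable_on_add)
  also have "\<dots> = (\<Sum>\<^sub>\<infinity>n. inner (?x n) (?y (n - 1))) + (\<Sum>\<^sub>\<infinity>n. inner (?x n) (?y (n + 1)))
      + (\<Sum>\<^sub>\<infinity>n. inner (?x n) (of_real (v n) * ?y n))"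
    unfolding sh v by simp
  also have "\<dots> = inner x (Jop v y)"
    using S(4-6)[OF Rep_ell[of y], of x] unfolding inner_ell.rep_eq Rep_Jop[OF assms] jacobi_def
    by (simp add: inner_add_right infsum_add summable_on_add)
  finally show ?thesis .
qed

lemma l2norm_shift: "l2norm (\<lambda>n. \<psi> (n + k)) = l2norm \<psi>" for k :: int
  unfolding l2norm_def using infsum_reindex_bij_betw[OF bij_shift[of k], of "\<lambda>n. (cmod (\<psi> n))\<^sup>2"] by simp

lemma norm_Jop_le:
  assumes "\<forall>n. \<bar>v n\<bar> \<le> M"
  shows "norm (Jop v x) \<le> (M + 2) * norm x"
proof -
  let ?x = "Rep_ell x"
  have M0: "0 \<le> M" using assms[rule_format, of 0] by linarith
  have l: "(\<lambda>n. ?x (n + (-1))) \<in> l2" "(\<lambda>n. ?x (n + 1)) \<in> l2" "(\<lambda>n. of_real (v n) * ?x n) \<in> l2"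
    by (rule l2_shift[OF Rep_ell], rule l2_shift[OF Rep_ell], rule l2_mult[OF Rep_ell, where M = M])
      (use assms in simp)
  have "Jop v x = Abs_ell (\<lambda>n. ?x (n + (-1))) + Abs_ell (\<lambda>n. ?x (n + 1)) + Abs_ell (\<lambda>n. of_real (v n) * ?x n)"
    by (rule Rep_ell_inject[THEN iffD1])
      (simp add: fun_eq_iff Rep_Jop[OF assms] plus_ell.rep_eq Abs_ell_inverse l[simplified] jacobi_def)
  moreover have "norm (Abs_ell (\<lambda>n. ?x (n + (-1)))) = norm x" "norm (Abs_ell (\<lambda>n. ?x (n + 1))) = norm x"
    unfolding norm_ell_Rep Abs_ell_inverse[OF l(1)] Abs_ell_inverse[OF l(2)] l2norm_shift by auto
  moreover have "norm (Abs_ell (\<lambda>n. of_real (v n) * ?x n)) \<le> M * norm x"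
  proof (rule l2_if_sums_bounded)
    fix F :: "int set" assume F: "finite F"
    have "(\<Sum>n\<in>F. (cmod (of_real (v n) * ?x n))\<^sup>2) \<le> (\<Sum>n\<in>F. M\<^sup>2 * (cmod (?x n))\<^sup>2)"
    proof (rule sum_mono)
      fix n
      have "(v n)\<^sup>2 \<le> M\<^sup>2" using assms[rule_format, of n] M0 by (intro abs_le_square_iff[THEN iffD1]) simp
      then show "(cmod (of_real (v n) * ?x n))\<^sup>2 \<le> M\<^sup>2 * (cmod (?x n))\<^sup>2"
        by (simp add: norm_mult power_mult_distrib mult_right_mono)
    qed
    also have "\<dots> \<le> M\<^sup>2 * (norm x)\<^sup>2"
      unfolding sum_distrib_left[symmetric] using sum_Rep_ell_le[OF F] by (intro mult_left_mono) auto
    finally show "(\<Sum>n\<in>F. (cmod (of_real (v n) * ?x n))\<^sup>2) \<le> (M * norm x)\<^sup>2" by (simp add: power_mult_distrib)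
  qed (use M0 in simp)
  ultimately show ?thesis
    using norm_triangle_ineq[of "Abs_ell (\<lambda>n. ?x (n + (-1))) + Abs_ell (\<lambda>n. ?x (n + 1))" "Abs_ell (\<lambda>n. of_real (v n) * ?x n)"]
      norm_triangle_ineq[of "Abs_ell (\<lambda>n. ?x (n + (-1)))" "Abs_ell (\<lambda>n. ?x (n + 1))"]
    by (simp add: algebra_simps)
qed

lemma pot_bounded:
  assumes "\<forall>x. \<bar>f x\<bar> \<le> B"
  shows "\<bar>pot f \<alpha> \<theta> E n\<bar> \<le> B + \<bar>E\<bar>"
  using assms[rule_format, of "\<alpha> * of_int n + \<theta>"] unfolding pot_def by linarith

text \<open>For a symmetric bounded operator a lower bound already forces surjectivity, so the
  inverse exists and is bounded. All later work on spectra consists of producing or refuting lower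
  bounds.\<close>

lemma not_in_spec_iff:
  assumes f: "\<forall>x. \<bar>f x\<bar> \<le> B"
  shows "E \<notin> spec f \<alpha> \<theta> \<longleftrightarrow> (\<exists>c>0. \<forall>x. c * norm x \<le> norm (Jop (pot f \<alpha> \<theta> E) x))"
proof
  let ?v = "pot f \<alpha> \<theta> E"
  have bd: "\<forall>n. \<bar>pot f \<alpha> \<theta> E n\<bar> \<le> B + \<bar>E\<bar>" using pot_bounded[OF f] by blast
  assume "E \<notin> spec f \<alpha> \<theta>"
  then obtain G C where G: "\<And>\<psi>. \<psi> \<in> l2 \<Longrightarrow> G (jacobi ?v \<psi>) = \<psi>"
    and C: "\<And>\<psi>. \<psi> \<in> l2 \<Longrightarrow> l2norm (G \<psi>) \<le> C * l2norm \<psi>"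
    unfolding spec_def Hop_eq_jacobi by blast
  have le: "norm x \<le> (\<bar>C\<bar> + 1) * norm (Jop ?v x)" for x
  proof -
    have "norm x = l2norm (G (jacobi ?v (Rep_ell x)))" by (simp add: norm_ell_Rep G Rep_ell)
    also have "\<dots> \<le> C * norm (Jop ?v x)"
      using C[OF jacobi_l2[OF bd Rep_ell]] by (simp add: norm_ell_Rep Rep_Jop[OF bd])
    also have "\<dots> \<le> (\<bar>C\<bar> + 1) * norm (Jop ?v x)" by (intro mult_right_mono) auto
    finally show ?thesis .
  qed
  then show "\<exists>c>0. \<forall>x. c * norm x \<le> norm (Jop ?v x)"
    by (intro exI[of _ "1 / (\<bar>C\<bar> + 1)"]) (auto simp: field_simps add_pos_nonneg)
next
  let ?v = "pot f \<alpha> \<theta> E"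
  have bd: "\<forall>n. \<bar>pot f \<alpha> \<theta> E n\<bar> \<le> B + \<bar>E\<bar>" using pot_bounded[OF f] by blast
  assume "\<exists>c>0. \<forall>x. c * norm x \<le> norm (Jop ?v x)"
  then obtain c where c: "0 < c" "\<And>x. c * norm x \<le> norm (Jop ?v x)" by blast
  have B: "0 \<le> B + \<bar>E\<bar>" using f[rule_format, of 0] by linarith
  have "\<exists>x. Jop ?v x = y" for y
    by (rule symmetric_bounded_below_imp_surj[OF linear_Jop[OF bd] Jop_symmetric[OF bd] norm_Jop_le[OF bd] _ c(2,1)])
      (use B in auto)
  then obtain G where G: "\<And>y. Jop ?v (G y) = y" by metis
  have inj: "x = y" if "Jop ?v x = Jop ?v y" for x y
    using c(2)[of "x - y"] c(1) that linear_diff[OF linear_Jop[OF bd], of x y]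
    by (simp add: mult_le_0_iff)
  define G' where "G' = (\<lambda>\<psi>. Rep_ell (G (Abs_ell \<psi>)))"
  have "G' \<psi> \<in> l2 \<and> jacobi ?v (G' \<psi>) = \<psi> \<and> G' (jacobi ?v \<psi>) = \<psi>" if \<psi>: "\<psi> \<in> l2" for \<psi>
  proof (intro conjI)
    show "G' \<psi> \<in> l2" by (simp add: G'_def Rep_ell)
    show "jacobi ?v (G' \<psi>) = \<psi>"
      using Rep_Jop[OF bd, of "G (Abs_ell \<psi>)"] G Abs_ell_inverse[OF \<psi>] by (simp add: G'_def)
    have "Abs_ell (jacobi ?v \<psi>) = Jop ?v (Abs_ell \<psi>)" by (simp add: Jop_def Abs_ell_inverse[OF \<psi>])
    then have "G (Abs_ell (jacobi ?v \<psi>)) = Abs_ell \<psi>" using inj G by simp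
    then show "G' (jacobi ?v \<psi>) = \<psi>" by (simp add: G'_def Abs_ell_inverse[OF \<psi>])
  qed
  moreover have "l2norm (G' \<psi>) \<le> (1 / c) * l2norm \<psi>" if "\<psi> \<in> l2" for \<psi>
    using c(2)[of "G (Abs_ell \<psi>)"] c(1) Abs_ell_inverse[OF that]
    by (simp add: G G'_def norm_ell_Rep field_simps)
  ultimately show "E \<notin> spec f \<alpha> \<theta>" unfolding spec_def Hop_eq_jacobi by blast
qed

text \<open>The distance to the spectrum is at most the relative residual. An approximate eigenvalue
  \<mu> of \<open>H - E\<close> obstructs a lower bound for \<open>H - (E + \<mu>)\<close>, so
  \<open>E + \<mu>\<close> is in the spectrum.\<close>

lemma approx_eigenvector_imp_spec:
  assumes f: "\<forall>x. \<bar>f x\<bar> \<le> B" and "x \<noteq> 0"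
    and "norm (Jop (pot f \<alpha> \<theta> E) x) \<le> \<epsilon> * norm x"
  shows "\<exists>E'\<in>spec f \<alpha> \<theta>. \<bar>E' - E\<bar> \<le> \<epsilon>"
proof -
  have bd: "\<forall>n. \<bar>pot f \<alpha> \<theta> E n\<bar> \<le> B + \<bar>E\<bar>" using pot_bounded[OF f] by blast
  have "0 \<le> B + \<bar>E\<bar>" using f[rule_format, of 0] by linarith
  then obtain \<mu> where \<mu>: "\<bar>\<mu>\<bar> \<le> \<epsilon>"
      "\<not> (\<exists>c>0. \<forall>x. c * norm x \<le> norm (Jop (pot f \<alpha> \<theta> E) x - \<mu> *\<^sub>R x))"
    using symmetric_approx_eigenvalue[OF linear_Jop[OF bd] Jop_symmetric[OF bd] norm_Jop_le[OF bd] _ assms(2,3)]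
    by auto
  have "Jop (pot f \<alpha> \<theta> E) x - \<mu> *\<^sub>R x = Jop (pot f \<alpha> \<theta> (E + \<mu>)) x" for x
    unfolding Jop_diff_scale[OF bd] by (simp add: pot_def[abs_def] diff_diff_eq)
  then have "\<not> (\<exists>c>0. \<forall>x. c * norm x \<le> norm (Jop (pot f \<alpha> \<theta> (E + \<mu>)) x))"
    using \<mu>(2) by simp
  then have "E + \<mu> \<in> spec f \<alpha> \<theta>" using not_in_spec_iff[OF f, of "E + \<mu>" \<alpha> \<theta>] by blast
  then show ?thesis using \<mu>(1) by (intro bexI[of _ "E + \<mu>"]) auto
qed

section \<open>Localization\<close>

lemma square_sum3_le: "(a + b + c)\<^sup>2 \<le> 3 * (a\<^sup>2 + b\<^sup>2 + (c::real)\<^sup>2)"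
  using sum_squares_bound[of a b] sum_squares_bound[of a c] sum_squares_bound[of b c]
  by (simp add: power2_eq_square algebra_simps)

lemma square_sum5_le: "(a + b + c + d + e)\<^sup>2 \<le> 5 * (a\<^sup>2 + b\<^sup>2 + c\<^sup>2 + d\<^sup>2 + (e::real)\<^sup>2)"
  using sum_squares_bound[of a b] sum_squares_bound[of a c] sum_squares_bound[of a d] sum_squares_bound[of a e]
    sum_squares_bound[of b c] sum_squares_bound[of b d] sum_squares_bound[of b e]
    sum_squares_bound[of c d] sum_squares_bound[of c e] sum_squares_bound[of d e]
  by (simp add: power2_eq_square algebra_simps)

text \<open>Truncation commutes with the operator except at the two sites next to each cut, where
  one neighbour is lost or a spurious one appears. For a piece of a single site the errors at
  \<open>X\<close> and \<open>Y - 1\<close> coincide, so the square of a sum of five terms is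
  estimated.\<close>

lemma jacobi_restrict_bound:
  assumes "X < Y" and \<psi>: "\<And>n. \<psi> n = (if X \<le> n \<and> n < Y then \<phi> n else 0)"
  shows "(cmod (jacobi v \<psi> n))\<^sup>2 \<le> 5 * ((if X \<le> n \<and> n < Y then (cmod (jacobi v \<phi> n))\<^sup>2 else 0)
    + (if n = X - 1 then (cmod (\<phi> X))\<^sup>2 else 0) + (if n = X then (cmod (\<phi> (X - 1)))\<^sup>2 else 0)
    + (if n = Y - 1 then (cmod (\<phi> Y))\<^sup>2 else 0) + (if n = Y then (cmod (\<phi> (Y - 1)))\<^sup>2 else 0))"
proof -
  define a where "a = (if X \<le> n \<and> n < Y then jacobi v \<phi> n else 0)"
  define b where "b = (if n = X - 1 then \<phi> X else 0)"
  define c where "c = (if n = X then - \<phi> (X - 1) else 0)"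
  define d where "d = (if n = Y - 1 then - \<phi> Y else 0)"
  define e where "e = (if n = Y then \<phi> (Y - 1) else 0)"
  have "jacobi v \<psi> n = a + b + c + d + e"
    using \<open>X < Y\<close>
    by (auto simp: jacobi_def \<psi> a_def b_def c_def d_def e_def, intro arg_cong[where f = \<phi>], linarith)
  then have "cmod (jacobi v \<psi> n) \<le> cmod a + cmod b + cmod c + cmod d + cmod e"
    by (metis (no_types, opaque_lifting) norm_triangle_ineq norm_triangle_mono order_refl)
  then have "(cmod (jacobi v \<psi> n))\<^sup>2 \<le> (cmod a + cmod b + cmod c + cmod d + cmod e)\<^sup>2"
    by (intro power_mono) auto
  also have "\<dots> \<le> 5 * ((cmod a)\<^sup>2 + (cmod b)\<^sup>2 + (cmod c)\<^sup>2 + (cmod d)\<^sup>2 + (cmod e)\<^sup>2)"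
    by (rule square_sum5_le)
  also have "(cmod a)\<^sup>2 = (if X \<le> n \<and> n < Y then (cmod (jacobi v \<phi> n))\<^sup>2 else 0)" by (simp add: a_def)
  also have "(cmod b)\<^sup>2 = (if n = X - 1 then (cmod (\<phi> X))\<^sup>2 else 0)" by (simp add: b_def)
  also have "(cmod c)\<^sup>2 = (if n = X then (cmod (\<phi> (X - 1)))\<^sup>2 else 0)" by (simp add: c_def)
  also have "(cmod d)\<^sup>2 = (if n = Y - 1 then (cmod (\<phi> Y))\<^sup>2 else 0)" by (simp add: d_def)
  also have "(cmod e)\<^sup>2 = (if n = Y then (cmod (\<phi> (Y - 1)))\<^sup>2 else 0)" by (simp add: e_def)
  finally show ?thesis .
qed

lemma sum_delta_le: "finite A \<Longrightarrow> 0 \<le> V \<Longrightarrow> (\<Sum>n\<in>A. if n = c then V else 0) \<le> (V::real)"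
  by (simp add: sum.delta)

text \<open>Cutting a vector at the points \<open>a j + k\<close>, where it is small, produces truncations of
  length at most \<open>2 L\<close>, one of which must be an approximate eigenvector if the whole vector is.\<close>

lemma bounded_below_if_not_localized:
  fixes v :: "int \<Rightarrow> real" and a :: "int \<Rightarrow> int" and L :: int and k m :: nat
  assumes bd: "\<forall>n. \<bar>v n\<bar> \<le> M" and "0 < L" and "0 < \<delta>" and "0 \<le> D"
    and a: "\<And>j. j * L \<le> a j" "\<And>j. a j < (j + 1) * L"
    and small: "\<And>\<phi> j y. y \<in> {a j + int k, a j + int k - 1} \<Longrightarrow> cmod (\<phi> y) \<le>
      \<delta> * (cmod (\<phi> (a j - 1)) + cmod (\<phi> (a j + int m))) + D * (\<Sum>i<m. cmod (jacobi v \<phi> (a j + int i)))"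
    and noloc: "\<And>\<psi> s. (\<And>n. n \<notin> {s..<s + 2 * L} \<Longrightarrow> \<psi> n = 0) \<Longrightarrow>
      (11 * \<delta>)\<^sup>2 * (\<Sum>n\<in>{s..<s + 2 * L}. (cmod (\<psi> n))\<^sup>2)
        \<le> (\<Sum>n\<in>{s - 1..s + 2 * L}. (cmod (jacobi v \<psi> n))\<^sup>2)"
  shows "\<exists>c>0. \<forall>x. c * norm x \<le> norm (Jop v x)"
proof -
  define X where "X = (\<lambda>j. a j + int k)"
  have a_less: "a i < a j" if "i < j" for i j
  proof -
    have "(i + 1) * L \<le> j * L" using that \<open>0 < L\<close> by (intro mult_right_mono) auto
    then show ?thesis using a(2)[of i] a(1)[of j] by linarith
  qed
  have inj: "inj_on (\<lambda>j. a j + c) J" for c J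
    by (rule inj_onI) (metis a_less add_right_cancel less_irrefl linorder_neqE)
  have X_less: "X i < X j" if "i < j" for i j using a_less[OF that] by (simp add: X_def)
  have XL: "X (j + 1) \<le> X j + 2 * L" for j
    using a(1)[of j] a(2)[of "j + 1"] by (simp add: X_def algebra_simps)
  define pc where "pc = (\<lambda>j. {X j..<X (j + 1)})"
  have disj: "pc i \<inter> pc j = {}" if "i \<noteq> j" for i j
  proof -
    have "pc i \<inter> pc j = {}" if "i < j" for i j
    proof -
      have "X (i + 1) \<le> X j" using X_less[of "i + 1" j] that by (cases "i + 1 = j") auto
      then show ?thesis by (auto simp: pc_def)
    qed
    then show ?thesis using that by (metis Int_commute linorder_neqE)
  qed
  have cover: "\<exists>j. n \<in> pc j" for n
  proof -
    define j where "j = (n - int k) div L"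
    have j: "j * L \<le> n - int k" "n - int k < (j + 1) * L"
    proof -
      have "n - int k = j * L + (n - int k) mod L" by (simp add: j_def)
      then show "j * L \<le> n - int k" "n - int k < (j + 1) * L"
        using pos_mod_bound[OF \<open>0 < L\<close>, of "n - int k"] pos_mod_sign[OF \<open>0 < L\<close>, of "n - int k"]
        unfolding distrib_right by linarith+
    qed
    have "n < X (j + 1)" using j(2) a(1)[of "j + 1"] by (simp add: X_def)
    moreover have "X (j - 1) \<le> n" using j(1) a(2)[of "j - 1"] by (simp add: X_def)
    ultimately have "n \<in> pc j \<or> n \<in> pc (j - 1)" by (auto simp: pc_def)
    then show ?thesis by blast
  qed
  \<comment> \<open>Summing over the pieces gives \<open>(11 \<delta>)^2 |x|^2\<close> on the left
    and boundary terms \<open>5 * 4 * 6 \<delta>^2 |x|^2\<close> on the right. Since 121 exceeds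
    120, the boundary terms are absorbed and \<open>\<delta>^2 |x|^2\<close> remains.\<close>
  have main: "\<delta>\<^sup>2 * (norm x)\<^sup>2 \<le> (5 + 60 * D\<^sup>2 * (real m)\<^sup>2) * (norm (Jop v x))\<^sup>2" for x
  proof -
    define \<phi> where "\<phi> = Rep_ell x"
    define \<Phi> where "\<Phi> = (\<lambda>n. (cmod (\<phi> n))\<^sup>2)"
    define G where "G = (\<lambda>n. (cmod (jacobi v \<phi> n))\<^sup>2)"
    have \<Phi>0: "0 \<le> \<Phi> n" and G0: "0 \<le> G n" for n by (auto simp: \<Phi>_def G_def)
    have sum\<Phi>: "sum \<Phi> F \<le> (norm x)\<^sup>2" if "finite F" for F
      using sum_Rep_ell_le[OF that, of x] by (simp add: \<Phi>_def \<phi>_def)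
    have sumG: "sum G F \<le> (norm (Jop v x))\<^sup>2" if "finite F" for F
      using sum_Rep_ell_le[OF that, of "Jop v x"] by (simp add: G_def \<phi>_def Rep_Jop[OF bd])
    \<comment> \<open>The starting points of the boxes are distinct, so a fixed offset from each
      visits every site at most once. Summing over all boxes therefore loses no factor depending on
      their number or on \<open>L\<close>.\<close>
    have sh\<Phi>: "(\<Sum>j\<in>J. \<Phi> (a j + c)) \<le> (norm x)\<^sup>2" if "finite J" for J c
      using sum.reindex[OF inj, of \<Phi> c J] sum\<Phi>[of "(\<lambda>j. a j + c) ` J"] that by simp
    have shG: "(\<Sum>j\<in>J. G (a j + c)) \<le> (norm (Jop v x))\<^sup>2" if "finite J" for J c
      using sum.reindex[OF inj, of G c J] sumG[of "(\<lambda>j. a j + c) ` J"] that by simp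
    have pt: "\<Phi> y \<le> 3 * \<delta>\<^sup>2 * (\<Phi> (a j + (-1)) + \<Phi> (a j + int m)) + 3 * D\<^sup>2 * real m * (\<Sum>i<m. G (a j + int i))"
      if "y \<in> {X j, X j - 1}" for y j
    proof -
      let ?s = "\<Sum>i<m. cmod (jacobi v \<phi> (a j + int i))"
      have "cmod (\<phi> y) \<le> \<delta> * cmod (\<phi> (a j - 1)) + \<delta> * cmod (\<phi> (a j + int m)) + D * ?s"
        using small[of y j \<phi>] that by (simp add: X_def algebra_simps)
      then have "\<Phi> y \<le> (\<delta> * cmod (\<phi> (a j - 1)) + \<delta> * cmod (\<phi> (a j + int m)) + D * ?s)\<^sup>2"
        unfolding \<Phi>_def by (intro power_mono) auto
      also have "\<dots> \<le> 3 * ((\<delta> * cmod (\<phi> (a j - 1)))\<^sup>2 + (\<delta> * cmod (\<phi> (a j + int m)))\<^sup>2 + (D * ?s)\<^sup>2)"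
        by (rule square_sum3_le)
      also have "\<dots> = 3 * \<delta>\<^sup>2 * (\<Phi> (a j + (-1)) + \<Phi> (a j + int m)) + 3 * D\<^sup>2 * ?s\<^sup>2"
        by (simp add: \<Phi>_def power_mult_distrib algebra_simps)
      also have "\<dots> \<le> 3 * \<delta>\<^sup>2 * (\<Phi> (a j + (-1)) + \<Phi> (a j + int m))
          + 3 * D\<^sup>2 * ((\<Sum>i<m. G (a j + int i)) * real m)"
        using sum_squared_le_sum_of_squares[of "\<lambda>i. cmod (jacobi v \<phi> (a j + int i))" "{..<m}"]
        by (intro add_left_mono mult_left_mono) (simp_all add: G_def)
      finally show ?thesis by (simp add: algebra_simps)
    qed
    define \<beta> where "\<beta> = 6 * \<delta>\<^sup>2 * (norm x)\<^sup>2 + 3 * D\<^sup>2 * (real m)\<^sup>2 * (norm (Jop v x))\<^sup>2"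
    have sumX: "(\<Sum>j\<in>J. \<Phi> (Y j)) \<le> \<beta>" if J: "finite J" and Y: "\<And>j. Y j \<in> {X j, X j - 1}" for J Y
    proof -
      have "(\<Sum>j\<in>J. \<Phi> (Y j)) \<le> (\<Sum>j\<in>J. 3 * \<delta>\<^sup>2 * (\<Phi> (a j + (-1)) + \<Phi> (a j + int m))
          + 3 * D\<^sup>2 * real m * (\<Sum>i<m. G (a j + int i)))"
        by (intro sum_mono pt Y)
      also have "\<dots> = 3 * \<delta>\<^sup>2 * ((\<Sum>j\<in>J. \<Phi> (a j + (-1))) + (\<Sum>j\<in>J. \<Phi> (a j + int m)))
          + 3 * D\<^sup>2 * real m * (\<Sum>i<m. \<Sum>j\<in>J. G (a j + int i))"
        unfolding sum.distrib sum_distrib_left[symmetric] by (subst (2) sum.swap) simp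
      also have "\<dots> \<le> 3 * \<delta>\<^sup>2 * ((norm x)\<^sup>2 + (norm x)\<^sup>2)
          + 3 * D\<^sup>2 * real m * (\<Sum>i<m. (norm (Jop v x))\<^sup>2)"
        by (intro add_mono mult_left_mono sum_mono sh\<Phi> shG J) auto
      also have "\<dots> = \<beta>" by (simp add: \<beta>_def power2_eq_square)
      finally show ?thesis .
    qed
    have piece: "(11 * \<delta>)\<^sup>2 * sum \<Phi> (pc j) \<le>
        5 * (sum G (pc j) + \<Phi> (X j) + \<Phi> (X j - 1) + \<Phi> (X (j + 1)) + \<Phi> (X (j + 1) - 1))" for j
    proof -
      define \<psi> where "\<psi> = (\<lambda>n. if X j \<le> n \<and> n < X (j + 1) then \<phi> n else 0)"
      let ?A = "{X j - 1..X j + 2 * L}"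
      have lt: "X j < X (j + 1)" by (rule X_less) simp
      have "(\<Sum>n\<in>{X j..<X j + 2 * L}. (cmod (\<psi> n))\<^sup>2) = (\<Sum>n\<in>pc j. (cmod (\<psi> n))\<^sup>2)"
        using XL[of j] by (intro sum.mono_neutral_right) (auto simp: \<psi>_def pc_def)
      also have "\<dots> = sum \<Phi> (pc j)" by (intro sum.cong) (auto simp: \<psi>_def pc_def \<Phi>_def)
      finally have "(11 * \<delta>)\<^sup>2 * sum \<Phi> (pc j) = (11 * \<delta>)\<^sup>2 * (\<Sum>n\<in>{X j..<X j + 2 * L}. (cmod (\<psi> n))\<^sup>2)"
        by simp
      also have "\<dots> \<le> (\<Sum>n\<in>?A. (cmod (jacobi v \<psi> n))\<^sup>2)"
        by (rule noloc) (use XL[of j] in \<open>auto simp: \<psi>_def\<close>)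
      also have "\<dots> \<le> (\<Sum>n\<in>?A. 5 * ((if X j \<le> n \<and> n < X (j + 1) then G n else 0)
        + (if n = X j - 1 then \<Phi> (X j) else 0) + (if n = X j then \<Phi> (X j - 1) else 0)
        + (if n = X (j + 1) - 1 then \<Phi> (X (j + 1)) else 0) + (if n = X (j + 1) then \<Phi> (X (j + 1) - 1) else 0)))"
        unfolding G_def \<Phi>_def by (intro sum_mono jacobi_restrict_bound[OF lt]) (simp add: \<psi>_def)
      also have "\<dots> = 5 * ((\<Sum>n\<in>?A. if X j \<le> n \<and> n < X (j + 1) then G n else 0)
        + (\<Sum>n\<in>?A. if n = X j - 1 then \<Phi> (X j) else 0) + (\<Sum>n\<in>?A. if n = X j then \<Phi> (X j - 1) else 0)
        + (\<Sum>n\<in>?A. if n = X (j + 1) - 1 then \<Phi> (X (j + 1)) else 0)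
        + (\<Sum>n\<in>?A. if n = X (j + 1) then \<Phi> (X (j + 1) - 1) else 0))"
        by (simp only: sum.distrib sum_distrib_left[symmetric])
      also have "(\<Sum>n\<in>?A. if X j \<le> n \<and> n < X (j + 1) then G n else 0) = sum G (pc j)"
      proof -
        have "(\<Sum>n\<in>?A. if X j \<le> n \<and> n < X (j + 1) then G n else 0)
            = (\<Sum>n\<in>pc j. if X j \<le> n \<and> n < X (j + 1) then G n else 0)"
          using XL[of j] by (intro sum.mono_neutral_right) (auto simp: pc_def)
        also have "\<dots> = sum G (pc j)" by (intro sum.cong) (auto simp: pc_def)
        finally show ?thesis .
      qed
      also have "5 * (sum G (pc j)
        + (\<Sum>n\<in>?A. if n = X j - 1 then \<Phi> (X j) else 0) + (\<Sum>n\<in>?A. if n = X j then \<Phi> (X j - 1) else 0)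
        + (\<Sum>n\<in>?A. if n = X (j + 1) - 1 then \<Phi> (X (j + 1)) else 0)
        + (\<Sum>n\<in>?A. if n = X (j + 1) then \<Phi> (X (j + 1) - 1) else 0))
        \<le> 5 * (sum G (pc j) + \<Phi> (X j) + \<Phi> (X j - 1) + \<Phi> (X (j + 1)) + \<Phi> (X (j + 1) - 1))"
        by (intro mult_left_mono add_mono sum_delta_le \<Phi>0 order_refl) auto
      finally show ?thesis .
    qed
    have "(11 * \<delta>)\<^sup>2 * (norm x)\<^sup>2 \<le> 5 * ((norm (Jop v x))\<^sup>2 + 4 * \<beta>)"
    proof -
      \<comment> \<open>Each cut bounds two pieces and involves two sites. The four resulting
        boundary families, two of them after shifting the index by one, are each at most
        \<beta>.\<close>
      have fin: "(11 * \<delta>)\<^sup>2 * sum \<Phi> F \<le> 5 * ((norm (Jop v x))\<^sup>2 + 4 * \<beta>)" if F: "finite F" for F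
      proof -
        obtain p where p: "\<And>n. n \<in> pc (p n)" using cover by metis
        define J where "J = p ` F"
        have J: "finite J" using F by (simp add: J_def)
        have U: "sum h (\<Union>j\<in>J. pc j) = (\<Sum>j\<in>J. sum h (pc j))" for h :: "int \<Rightarrow> real"
          using J disj by (intro sum.UNION_disjoint) (auto simp: pc_def)
        have finU: "finite (\<Union>j\<in>J. pc j)" using J by (auto simp: pc_def)
        have "sum \<Phi> F \<le> sum \<Phi> (\<Union>j\<in>J. pc j)"
          using p \<Phi>0 by (intro sum_mono2 finU) (auto simp: J_def)
        then have "(11 * \<delta>)\<^sup>2 * sum \<Phi> F \<le> (11 * \<delta>)\<^sup>2 * (\<Sum>j\<in>J. sum \<Phi> (pc j))"
          unfolding U by (intro mult_left_mono) auto
        also have "\<dots> \<le> (\<Sum>j\<in>J. 5 * (sum G (pc j) + \<Phi> (X j) + \<Phi> (X j - 1) + \<Phi> (X (j + 1)) + \<Phi> (X (j + 1) - 1)))"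
          by (subst sum_distrib_left) (intro sum_mono piece)
        also have "\<dots> = 5 * (sum G (\<Union>j\<in>J. pc j) + (\<Sum>j\<in>J. \<Phi> (X j)) + (\<Sum>j\<in>J. \<Phi> (X j - 1))
            + (\<Sum>j\<in>J. \<Phi> (X (j + 1))) + (\<Sum>j\<in>J. \<Phi> (X (j + 1) - 1)))"
          unfolding U by (simp only: sum.distrib sum_distrib_left[symmetric])
        also have "(\<Sum>j\<in>J. \<Phi> (X (j + 1))) = (\<Sum>j\<in>(\<lambda>j. j + 1) ` J. \<Phi> (X j))"
          by (simp add: sum.reindex)
        also have "(\<Sum>j\<in>J. \<Phi> (X (j + 1) - 1)) = (\<Sum>j\<in>(\<lambda>j. j + 1) ` J. \<Phi> (X j - 1))"
          by (simp add: sum.reindex)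
        also have "5 * (sum G (\<Union>j\<in>J. pc j) + (\<Sum>j\<in>J. \<Phi> (X j)) + (\<Sum>j\<in>J. \<Phi> (X j - 1))
            + (\<Sum>j\<in>(\<lambda>j. j + 1) ` J. \<Phi> (X j)) + (\<Sum>j\<in>(\<lambda>j. j + 1) ` J. \<Phi> (X j - 1)))
            \<le> 5 * ((norm (Jop v x))\<^sup>2 + \<beta> + \<beta> + \<beta> + \<beta>)"
          using J by (intro mult_left_mono add_mono sumX sumG finU) auto
        finally show ?thesis by simp
      qed
      have "(norm x)\<^sup>2 \<le> 5 * ((norm (Jop v x))\<^sup>2 + 4 * \<beta>) / (11 * \<delta>)\<^sup>2"
        unfolding norm_ell_sq[of x]
      proof (rule infsum_le_finite_sums[OF Rep_ell_summable])
        fix F :: "int set" assume "finite F"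
        from fin[OF this] show "(\<Sum>n\<in>F. (cmod (Rep_ell x n))\<^sup>2) \<le> 5 * ((norm (Jop v x))\<^sup>2 + 4 * \<beta>) / (11 * \<delta>)\<^sup>2"
          using \<open>0 < \<delta>\<close> by (simp add: \<Phi>_def \<phi>_def field_simps)
      qed
      then show ?thesis using \<open>0 < \<delta>\<close> by (simp add: field_simps)
    qed
    then show ?thesis by (simp add: \<beta>_def power_mult_distrib algebra_simps)
  qed
  define K where "K = 5 + 60 * D\<^sup>2 * (real m)\<^sup>2"
  have K: "0 < K" unfolding K_def by (rule add_pos_nonneg) auto
  have "\<delta> / sqrt K * norm x \<le> norm (Jop v x)" for x
  proof (rule power2_le_imp_le)
    show "(\<delta> / sqrt K * norm x)\<^sup>2 \<le> (norm (Jop v x))\<^sup>2"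
      using main[of x, folded K_def] K by (simp add: power_mult_distrib power_divide divide_le_eq mult.commute)
  qed simp
  then show ?thesis using K \<open>0 < \<delta>\<close> by (intro exI[of _ "\<delta> / sqrt K"]) auto
qed

text \<open>The determinant of \<open>E - H\<close> restricted to the sites \<open>0, \<dots>, m - 1\<close>.\<close>

definition chi :: "(real \<Rightarrow> real) \<Rightarrow> real \<Rightarrow> real \<Rightarrow> nat \<Rightarrow> real \<Rightarrow> real" where
  "chi f \<alpha> E m \<theta> = continuant (\<lambda>i. E - f (\<alpha> * real i + \<theta>)) m"

lemma chi_add_int:
  assumes per: "\<And>x. f (x + 1) = f x"
  shows "chi f \<alpha> E m (\<theta> + of_int n) = chi f \<alpha> E m \<theta>"
  using periodic_add_int[of f, OF per] by (simp add: chi_def flip: add.assoc)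

lemma continuous_on_chi:
  fixes f :: "real \<Rightarrow> real"
  assumes "continuous_on UNIV f"
  shows "continuous_on A (\<lambda>p. chi f \<alpha> (snd p) m (fst p))"
  unfolding chi_def
proof (induction m rule: induct_nat_012)
  case (ge2 m)
  then show ?case unfolding continuant.simps
    by (intro continuous_intros continuous_on_compose2[OF assms]) auto
qed (auto intro!: continuous_intros continuous_on_compose2[OF assms])

lemma chi_bound:
  assumes "\<And>x. \<bar>f x\<bar> \<le> B" "\<bar>E\<bar> \<le> R"
  shows "\<bar>chi f \<alpha> E m \<theta>\<bar> \<le> (R + B + 1) ^ m"
proof -
  have "\<bar>E - f (\<alpha> * real i + \<theta>)\<bar> + 1 \<le> R + B + 1" for i
    using assms(1)[of "\<alpha> * real i + \<theta>"] assms(2) by linarith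
  moreover have "1 \<le> R + B + 1" using assms(1)[of 0] assms(2) by linarith
  ultimately show ?thesis
    using norm_continuant_le[of "\<lambda>i. E - f (\<alpha> * real i + \<theta>)" "R + B + 1" m] by (simp add: chi_def)
qed

text \<open>Periodicity confines the phase to a compact interval. Length and phase are returned as
  one pair, so that a single choice function of \<open>n\<close> selects both.\<close>

lemma chi_max_attained:
  assumes cont: "continuous_on UNIV f" and per: "\<And>x. f (x + 1) = f x"
  shows "\<exists>m\<theta>. fst m\<theta> \<le> n \<and> (\<forall>i\<le>n. \<forall>\<theta>. \<bar>chi f \<alpha> E i \<theta>\<bar> \<le> \<bar>chi f \<alpha> E (fst m\<theta>) (snd m\<theta>)\<bar>)"
proof -
  have "\<exists>t. \<forall>\<theta>. \<bar>chi f \<alpha> E i \<theta>\<bar> \<le> \<bar>chi f \<alpha> E i t\<bar>" for i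
  proof -
    have "continuous_on {0..1} ((\<lambda>p. chi f \<alpha> (snd p) i (fst p)) \<circ> (\<lambda>t. (t, E)))"
      by (intro continuous_on_compose continuous_on_chi[OF cont] continuous_intros)
    then have "continuous_on {0..1} (\<lambda>t. \<bar>chi f \<alpha> E i t\<bar>)"
      by (auto simp: o_def intro!: continuous_intros)
    from continuous_attains_sup[OF _ _ this]
    obtain t where t: "\<forall>\<theta>\<in>{0..1}. \<bar>chi f \<alpha> E i \<theta>\<bar> \<le> \<bar>chi f \<alpha> E i t\<bar>" by auto
    have "\<bar>chi f \<alpha> E i \<theta>\<bar> \<le> \<bar>chi f \<alpha> E i t\<bar>" for \<theta>
    proof -
      have "chi f \<alpha> E i \<theta> = chi f \<alpha> E i (frac \<theta>)"
        using chi_add_int[of f \<alpha> E i "frac \<theta>" "\<lfloor>\<theta>\<rfloor>"] per by (simp add: frac_def)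
      then show ?thesis using t[rule_format, of "frac \<theta>"] frac_lt_1[of \<theta>] by (simp add: less_imp_le)
    qed
    then show ?thesis by blast
  qed
  then obtain t where t: "\<And>i \<theta>. \<bar>chi f \<alpha> E i \<theta>\<bar> \<le> \<bar>chi f \<alpha> E i (t i)\<bar>" by metis
  let ?g = "\<lambda>i. \<bar>chi f \<alpha> E i (t i)\<bar>"
  have "Max (?g ` {..n}) \<in> ?g ` {..n}" by (intro Max_in) auto
  then obtain m where m: "m \<le> n" "Max (?g ` {..n}) = ?g m" by (elim imageE) simp
  have "\<bar>chi f \<alpha> E i \<theta>\<bar> \<le> ?g m" if "i \<le> n" for i \<theta>
  proof -
    have "?g i \<le> Max (?g ` {..n})" using that by (intro Max_ge) auto
    then show ?thesis using t[of i \<theta>] m by linarith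
  qed
  then show ?thesis using m by (intro exI[of _ "(m, t m)"]) auto
qed

text \<open>The maxima grow exponentially at rate \<open>\<gamma>\<close> at all scales and are at most \<open>\<Lambda>\<^sup>N\<close> at scale \<open>N\<close>,
  so they must gain a factor \<open>exp N\<close> at one of the \<open>J\<close> doublings of \<open>N\<close>.\<close>

lemma exists_growth_scale:
  assumes cont: "continuous_on UNIV f" and per: "\<And>x. f (x + 1) = f x"
    and bound: "\<And>m \<theta>. \<bar>chi f \<alpha> E m \<theta>\<bar> \<le> \<Lambda> ^ m" "1 \<le> \<Lambda>"
    and grow: "\<And>n. 1 \<le> n \<Longrightarrow> \<exists>\<theta>. \<exists>i\<le>n. exp (\<gamma> * real n) / 4 \<le> \<bar>chi f \<alpha> E i \<theta>\<bar>"
    and J: "real J + ln \<Lambda> + ln 4 < \<gamma> * 2 ^ J" and N: "1 \<le> N"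
  obtains k m \<theta>0 where "N \<le> k" "k \<le> 2 ^ J * N" "k < m" "m \<le> 2 * k" "1 \<le> \<bar>chi f \<alpha> E m \<theta>0\<bar>"
    "\<And>i \<theta>. i \<le> 2 * k \<Longrightarrow> \<bar>chi f \<alpha> E i \<theta>\<bar> \<le> \<bar>chi f \<alpha> E m \<theta>0\<bar>"
    "\<And>i \<theta>. i \<le> k \<Longrightarrow> \<bar>chi f \<alpha> E i \<theta>\<bar> \<le> exp (- real N) * \<bar>chi f \<alpha> E m \<theta>0\<bar>"
proof -
  have "\<exists>p. \<forall>n. fst (p n) \<le> n \<and> (\<forall>i\<le>n. \<forall>\<theta>. \<bar>chi f \<alpha> E i \<theta>\<bar> \<le> \<bar>chi f \<alpha> E (fst (p n)) (snd (p n))\<bar>)"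
    by (intro choice allI chi_max_attained[OF cont per])
  then obtain p where p1: "\<And>n. fst (p n) \<le> n"
    and p2: "\<And>n i \<theta>. i \<le> n \<Longrightarrow> \<bar>chi f \<alpha> E i \<theta>\<bar> \<le> \<bar>chi f \<alpha> E (fst (p n)) (snd (p n))\<bar>" by blast
  define \<tau> where "\<tau> = (\<lambda>n. \<bar>chi f \<alpha> E (fst (p n)) (snd (p n))\<bar>)"
  have \<tau>1: "1 \<le> \<tau> n" for n using p2[of 0 n 0] by (simp add: \<tau>_def chi_def)
  have "\<exists>j<J. exp (real N) * \<tau> (2 ^ j * N) \<le> \<tau> (2 ^ Suc j * N)"
  proof (rule ccontr)
    assume "\<not> ?thesis"
    then have step: "\<tau> (2 ^ Suc j * N) \<le> exp (real N) * \<tau> (2 ^ j * N)" if "j < J" for j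
      using that by (meson linear)
    have "\<tau> (2 ^ j * N) \<le> exp (real N * real j) * \<tau> N" if "j \<le> J" for j
      using that
    proof (induction j)
      case (Suc j)
      have "\<tau> (2 ^ Suc j * N) \<le> exp (real N) * (exp (real N * real j) * \<tau> N)"
        using step[of j] Suc by (intro order_trans[OF step] mult_left_mono) auto
      also have "\<dots> = exp (real N * real (Suc j)) * \<tau> N"
        by (simp add: exp_add[symmetric] algebra_simps)
      finally show ?case .
    qed simp
    then have "\<tau> (2 ^ J * N) \<le> exp (real N * real J) * \<tau> N" by simp
    also have "\<tau> N \<le> \<Lambda> ^ fst (p N)" unfolding \<tau>_def by (rule bound)
    also have "\<dots> \<le> \<Lambda> ^ N" by (rule power_increasing[OF p1 bound(2)])
    also have "\<Lambda> ^ N = exp (real N * ln \<Lambda>)" using bound(2) by (simp add: exp_of_nat_mult)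
    finally have 1: "\<tau> (2 ^ J * N) \<le> exp (real N * real J) * exp (real N * ln \<Lambda>)" by simp
    have "1 \<le> 2 ^ J * N" using N by simp
    then obtain \<theta> i where "i \<le> 2 ^ J * N" "exp (\<gamma> * real (2 ^ J * N)) / 4 \<le> \<bar>chi f \<alpha> E i \<theta>\<bar>"
      using grow by blast
    then have "exp (\<gamma> * real (2 ^ J * N)) / 4 \<le> \<tau> (2 ^ J * N)"
      using p2[of i "2 ^ J * N" \<theta>] unfolding \<tau>_def by linarith
    then have "exp (\<gamma> * real (2 ^ J * N)) \<le> exp (ln 4) * (exp (real N * real J) * exp (real N * ln \<Lambda>))"
      using 1 by simp
    then have "exp (\<gamma> * real (2 ^ J * N)) \<le> exp (ln 4 + (real N * real J + real N * ln \<Lambda>))"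
      by (simp only: exp_add)
    then have "\<gamma> * real (2 ^ J * N) \<le> ln 4 + (real N * real J + real N * ln \<Lambda>)" by simp
    \<comment> \<open>This makes the inequality homogeneous in \<open>N\<close>, so that the
      condition on \<open>J\<close> does not involve the scale.\<close>
    also have "ln (4::real) \<le> real N * ln 4" using N by simp
    finally have "real N * (\<gamma> * 2 ^ J) \<le> real N * (real J + ln \<Lambda> + ln 4)"
      by (simp add: algebra_simps)
    then show False using J N by simp
  qed
  then obtain j where j: "j < J" "exp (real N) * \<tau> (2 ^ j * N) \<le> \<tau> (2 ^ Suc j * N)" by blast
  define k where "k = 2 ^ j * N"
  have k2: "2 ^ Suc j * N = 2 * k" by (simp add: k_def)
  have \<tau>k: "\<tau> k \<le> exp (- real N) * \<tau> (2 * k)"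
    using j(2) unfolding k2 k_def[symmetric] by (simp add: exp_minus field_simps)
  define m where "m = fst (p (2 * k))"
  define \<theta>0 where "\<theta>0 = snd (p (2 * k))"
  have \<tau>2k: "\<tau> (2 * k) = \<bar>chi f \<alpha> E m \<theta>0\<bar>" by (simp add: \<tau>_def m_def \<theta>0_def)
  show ?thesis
  proof
    show "N \<le> k" by (simp add: k_def)
    have "(2::nat) ^ j \<le> 2 ^ J" using j(1) by (intro power_increasing) auto
    then show "k \<le> 2 ^ J * N" by (simp add: k_def)
    show "m \<le> 2 * k" unfolding m_def by (rule p1)
    show "1 \<le> \<bar>chi f \<alpha> E m \<theta>0\<bar>" using \<tau>1[of "2 * k"] by (simp add: \<tau>2k)
    show "\<bar>chi f \<alpha> E i \<theta>\<bar> \<le> \<bar>chi f \<alpha> E m \<theta>0\<bar>" if "i \<le> 2 * k" for i \<theta>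
      using p2[OF that] by (simp add: m_def \<theta>0_def)
    show small: "\<bar>chi f \<alpha> E i \<theta>\<bar> \<le> exp (- real N) * \<bar>chi f \<alpha> E m \<theta>0\<bar>" if "i \<le> k" for i \<theta>
      using p2[OF that, of \<theta>] \<tau>k unfolding \<tau>2k by (simp add: \<tau>_def)
    \<comment> \<open>A length of at most \<open>k\<close> would put the positive maximum below
      itself times \<open>exp (- N)\<close>.\<close>
    show "k < m"
    proof (rule ccontr)
      assume "\<not> k < m"
      then have le: "\<bar>chi f \<alpha> E m \<theta>0\<bar> \<le> exp (- real N) * \<bar>chi f \<alpha> E m \<theta>0\<bar>" by (intro small) auto
      have "exp (- real N) * \<bar>chi f \<alpha> E m \<theta>0\<bar> < 1 * \<bar>chi f \<alpha> E m \<theta>0\<bar>"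
        using \<tau>1[of "2 * k"] N by (intro mult_strict_right_mono) (auto simp: \<tau>2k)
      then show False using le by simp
    qed
  qed
qed

lemma hol_ext_mono: "hol_ext \<rho> B g \<Longrightarrow> B \<le> B' \<Longrightarrow> hol_ext \<rho> B' g"
  unfolding hol_ext_def by (meson order_trans)

lemma hol_ext_imp_bounded:
  assumes "hol_ext \<rho> B f" "0 < \<rho>"
  shows "\<bar>f x\<bar> \<le> B"
proof -
  obtain F where "\<forall>z\<in>ball (0::complex) \<rho>. cmod (F z) \<le> B" "\<forall>t. \<bar>t\<bar> < \<rho> \<longrightarrow> F (of_real t) = of_real (f (x + t))"
    using assms unfolding hol_ext_def by blast
  then have "cmod (F 0) \<le> B" "F 0 = of_real (f x)" using assms(2) by (auto dest: spec[of _ 0])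
  then show ?thesis by simp
qed

text \<open>The point is uniformity: one \<open>C\<close> serves all energies in the range, all
  lengths and all phases. A supremum of at least 1 lets the complex bound
  \<open>(R + B + 1) ^ m\<close> be written as that supremum times a power of 2 with exponent linear
  in \<open>m\<close>.\<close>

lemma orbit_meets_large_values:
  assumes ext: "hol_ext \<rho> B f" "0 < \<rho>" "0 \<le> B" and per: "\<And>x. f (x + 1) = f x"
    and dioph: "0 < c" "\<And>q p. 0 < q \<Longrightarrow> c / (real q)\<^sup>2 \<le> \<bar>real q * \<alpha> - of_int p\<bar>"
  shows "\<exists>C::nat. 0 < C \<and> (\<forall>E m \<theta>0 \<theta>. \<bar>E\<bar> \<le> R \<and> 1 \<le> m \<and> 1 \<le> \<bar>chi f \<alpha> E m \<theta>0\<bar> \<and>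
      (\<forall>\<theta>'. \<bar>chi f \<alpha> E m \<theta>'\<bar> \<le> \<bar>chi f \<alpha> E m \<theta>0\<bar>) \<longrightarrow>
      (\<exists>i<C * m ^ 3. \<bar>chi f \<alpha> E m \<theta>0\<bar> / 2 \<le> \<bar>chi f \<alpha> E m (\<theta> + \<alpha> * real i)\<bar>))"
proof -
  obtain \<kappa> where "R + B + 1 < 2 ^ \<kappa>" using real_arch_pow[of 2 "R + B + 1"] by auto
  also have "(2::real) ^ \<kappa> \<le> 2 ^ Suc \<kappa>" by simp
  finally have \<kappa>: "R + B + 1 \<le> 2 ^ Suc \<kappa>" by simp
  \<comment> \<open>A displacement of \<open>1 / (q m)\<close> changes the determinant by at most
    \<open>8 (Suc \<kappa>) \<tau> / (\<rho> q)\<close>; this \<open>q\<close> brings the loss down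
    to \<open>\<tau> / 2\<close>.\<close>
  define q where "q = Suc (nat \<lceil>16 * real (Suc \<kappa>) / \<rho>\<rceil>)"
  have q: "16 * real (Suc \<kappa>) / \<rho> \<le> real q" "0 < q" unfolding q_def by linarith+
  define C where "C = Suc (nat \<lfloor>(real q)^3 / c\<rfloor>)"
  have C: "(real q)^3 / c < real C" unfolding C_def using dioph(1) by linarith
  have "\<exists>i<C * m ^ 3. \<bar>chi f \<alpha> E m \<theta>0\<bar> / 2 \<le> \<bar>chi f \<alpha> E m (\<theta> + \<alpha> * real i)\<bar>"
    if E: "\<bar>E\<bar> \<le> R" and m: "1 \<le> m" and \<tau>1: "1 \<le> \<bar>chi f \<alpha> E m \<theta>0\<bar>"
      and max: "\<And>\<theta>'. \<bar>chi f \<alpha> E m \<theta>'\<bar> \<le> \<bar>chi f \<alpha> E m \<theta>0\<bar>" for E m \<theta>0 \<theta>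
  proof -
    define \<tau> where "\<tau> = \<bar>chi f \<alpha> E m \<theta>0\<bar>"
    have "(R + B + 1) ^ m \<le> (2 ^ Suc \<kappa>) ^ m" using \<kappa> E ext(3) by (intro power_mono) auto
    also have "\<dots> = 1 * 2 ^ (Suc \<kappa> * m)" by (simp only: power_mult mult_1)
    also have "\<dots> \<le> \<tau> * 2 ^ (Suc \<kappa> * m)" using \<tau>1 by (intro mult_right_mono) (auto simp: \<tau>_def)
    finally have "hol_ext \<rho> (\<tau> * 2 ^ (Suc \<kappa> * m)) (chi f \<alpha> E m)"
      using hol_ext_mono[OF hol_ext_continuant[OF ext(1,3) E]] by (simp add: chi_def[abs_def])
    then have lip: "\<bar>chi f \<alpha> E m x - chi f \<alpha> E m y\<bar> \<le> 8 * real (Suc \<kappa> * m) * \<tau> / \<rho> * \<bar>x - y\<bar>" for x y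
      by (rule hol_ext_imp_Lipschitz) (use ext m max in \<open>auto simp: \<tau>_def\<close>)
    obtain i :: nat and z :: int where iz: "real i \<le> (real (q * m))^3 / c"
        "\<bar>\<theta> + \<alpha> * real i - \<theta>0 - of_int z\<bar> \<le> 1 / real (q * m)"
      using orbit_quantitatively_dense[OF dioph, of "q * m" \<theta> \<theta>0] q(2) m by auto
    have "real i \<le> (real q)^3 / c * real (m ^ 3)" using iz(1) by (simp add: power_mult_distrib)
    also have "\<dots> < real C * real (m ^ 3)" using C m by (intro mult_strict_right_mono) auto
    finally have "i < C * m ^ 3" by (metis of_nat_less_iff of_nat_mult)
    moreover have "\<tau> / 2 \<le> \<bar>chi f \<alpha> E m (\<theta> + \<alpha> * real i)\<bar>"
    proof -
      have "\<bar>chi f \<alpha> E m (\<theta> + \<alpha> * real i) - chi f \<alpha> E m (\<theta>0 + of_int z)\<bar>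
          \<le> 8 * real (Suc \<kappa> * m) * \<tau> / \<rho> * \<bar>\<theta> + \<alpha> * real i - (\<theta>0 + of_int z)\<bar>" by (rule lip)
      also have "\<dots> \<le> 8 * real (Suc \<kappa> * m) * \<tau> / \<rho> * (1 / real (q * m))"
        using iz(2) ext(2) by (intro mult_left_mono) (auto simp: \<tau>_def diff_diff_eq)
      also have "\<dots> = (16 * real (Suc \<kappa>) / \<rho>) * (\<tau> / (2 * real q))" using m q(2) ext(2) by (simp add: field_simps)
      also have "\<dots> \<le> real q * (\<tau> / (2 * real q))"
        using q by (intro mult_right_mono) (auto simp: \<tau>_def)
      also have "\<dots> = \<tau> / 2" using q(2) by simp
      finally show ?thesis unfolding chi_add_int[of f, OF per] \<tau>_def by linarith
    qed
    ultimately show ?thesis unfolding \<tau>_def by blast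
  qed
  then show ?thesis by (intro exI[of _ C]) (auto simp: C_def)
qed

text \<open>If no localized vector existed, the truncation argument would bound \<open>H - E\<close>
  below and expel \<open>E\<close> from the spectrum. The length \<open>m\<close> depends on
  \<open>E\<close>, but \<open>L\<close> does not: it bounds \<open>C m^3\<close> for every
  admissible \<open>m\<close>, so each block of \<open>L\<close> sites contains the start of a good
  box. Dividing the Green bound by \<open>\<tau> / 2\<close> gives the decay factor
  \<open>2 exp (- N)\<close>, whence 22 = 11 * 2.\<close>

lemma localized_approx_eigenvector:
  assumes f: "\<forall>x. \<bar>f x\<bar> \<le> B" and cont: "continuous_on UNIV f" and per: "\<And>x. f (x + 1) = f x"
    and ER: "\<bar>E\<bar> \<le> R"
    and C: "0 < C" "\<And>m \<theta>0 \<theta>. 1 \<le> m \<Longrightarrow> 1 \<le> \<bar>chi f \<alpha> E m \<theta>0\<bar> \<Longrightarrow>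
      (\<And>\<theta>'. \<bar>chi f \<alpha> E m \<theta>'\<bar> \<le> \<bar>chi f \<alpha> E m \<theta>0\<bar>) \<Longrightarrow>
      \<exists>i<C * m ^ 3. \<bar>chi f \<alpha> E m \<theta>0\<bar> / 2 \<le> \<bar>chi f \<alpha> E m (\<theta> + \<alpha> * real i)\<bar>"
    and grow: "\<And>n. 1 \<le> n \<Longrightarrow> \<exists>\<theta>. \<exists>i\<le>n. exp (\<gamma> * real n) / 4 \<le> \<bar>chi f \<alpha> E i \<theta>\<bar>"
    and J: "real J + ln (R + B + 1) + ln 4 < \<gamma> * 2 ^ J" and N: "1 \<le> N"
    and E: "E \<in> spec f \<alpha> \<theta>"
    and L: "L = int (C * (2 * 2 ^ J * N) ^ 3)"
  shows "\<exists>\<psi> s. (\<forall>n. n \<notin> {s..<s + 2 * L} \<longrightarrow> \<psi> n = 0) \<and>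
      (\<Sum>n\<in>{s - 1..s + 2 * L}. (cmod (jacobi (pot f \<alpha> \<theta> E) \<psi> n))\<^sup>2)
        < (22 * exp (- real N))\<^sup>2 * (\<Sum>n\<in>{s..<s + 2 * L}. (cmod (\<psi> n))\<^sup>2)"
proof (rule ccontr)
  assume neg: "\<not> ?thesis"
  have f': "\<And>x. \<bar>f x\<bar> \<le> B" using f by blast
  obtain k m \<theta>0 where k: "N \<le> k" "k \<le> 2 ^ J * N" "k < m" "m \<le> 2 * k" and \<tau>1: "1 \<le> \<bar>chi f \<alpha> E m \<theta>0\<bar>"
    and max: "\<And>i \<theta>. i \<le> 2 * k \<Longrightarrow> \<bar>chi f \<alpha> E i \<theta>\<bar> \<le> \<bar>chi f \<alpha> E m \<theta>0\<bar>"
    and gain: "\<And>i \<theta>. i \<le> k \<Longrightarrow> \<bar>chi f \<alpha> E i \<theta>\<bar> \<le> exp (- real N) * \<bar>chi f \<alpha> E m \<theta>0\<bar>"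
    by (rule exists_growth_scale[OF cont per chi_bound[OF f' ER] _ grow J N])
      (use f' [of 0] ER in \<open>auto intro: order_trans\<close>)
  define \<tau> where "\<tau> = \<bar>chi f \<alpha> E m \<theta>0\<bar>"
  have \<tau>: "1 \<le> \<tau>" using \<tau>1 by (simp add: \<tau>_def)
  have L0: "0 < L" using C(1) N by (simp add: L)
  have "m ^ 3 \<le> (2 * 2 ^ J * N) ^ 3" using k by (intro power_mono) auto
  then have CmL: "int (C * m ^ 3) \<le> L" unfolding L of_nat_le_iff by (intro mult_left_mono) auto
  have "\<exists>i<C * m ^ 3. \<tau> / 2 \<le> \<bar>chi f \<alpha> E m (\<theta> + \<alpha> * of_int (j * L) + \<alpha> * real i)\<bar>" for j
    unfolding \<tau>_def using k max by (intro C(2) \<tau>1) auto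
  then obtain i where i: "\<And>j. i j < C * m ^ 3"
    "\<And>j. \<tau> / 2 \<le> \<bar>chi f \<alpha> E m (\<theta> + \<alpha> * of_int (j * L) + \<alpha> * real (i j))\<bar>" by metis
  define a where "a = (\<lambda>j. j * L + int (i j))"
  define T where "T = (\<lambda>j. \<theta> + \<alpha> * of_int (a j))"
  have big: "\<tau> / 2 \<le> \<bar>chi f \<alpha> E m (T j)\<bar>" for j
    using i(2)[of j] by (simp add: T_def a_def algebra_simps)
  have "\<exists>c>0. \<forall>x. c * norm x \<le> norm (Jop (pot f \<alpha> \<theta> E) x)"
  proof (rule bounded_below_if_not_localized[where a = a and L = L and k = k and m = m
        and \<delta> = "2 * exp (- real N)" and D = "4 * exp (- real N) * \<tau>" and M = "B + \<bar>E\<bar>"])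
    show "\<forall>n. \<bar>pot f \<alpha> \<theta> E n\<bar> \<le> B + \<bar>E\<bar>" using pot_bounded[OF f] by blast
    show "0 < L" by fact
    show "j * L \<le> a j" for j by (simp add: a_def)
    show "a j < (j + 1) * L" for j
      using less_le_trans[OF of_nat_less_iff[THEN iffD2, OF i(1)[of j]] CmL]
      by (simp add: a_def distrib_right)
    show "(11 * (2 * exp (- real N)))\<^sup>2 * (\<Sum>n\<in>{s..<s + 2 * L}. (cmod (\<psi> n))\<^sup>2)
        \<le> (\<Sum>n\<in>{s - 1..s + 2 * L}. (cmod (jacobi (pot f \<alpha> \<theta> E) \<psi> n))\<^sup>2)"
      if "\<And>n. n \<notin> {s..<s + 2 * L} \<Longrightarrow> \<psi> n = 0" for \<psi> s
    proof -
      have "\<forall>n. n \<notin> {s..<s + 2 * L} \<longrightarrow> \<psi> n = 0" using that by blast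
      then have "\<not> (\<Sum>n\<in>{s - 1..s + 2 * L}. (cmod (jacobi (pot f \<alpha> \<theta> E) \<psi> n))\<^sup>2)
        < (22 * exp (- real N))\<^sup>2 * (\<Sum>n\<in>{s..<s + 2 * L}. (cmod (\<psi> n))\<^sup>2)" using neg by blast
      moreover have "11 * (2 * exp (- real N)) = 22 * exp (- real N)" by simp
      ultimately show ?thesis by (simp only: not_less)
    qed
    show "cmod (\<phi> y) \<le> 2 * exp (- real N) * (cmod (\<phi> (a j - 1)) + cmod (\<phi> (a j + int m)))
        + 4 * exp (- real N) * \<tau> * (\<Sum>i<m. cmod (jacobi (pot f \<alpha> \<theta> E) \<phi> (a j + int i)))"
      if y: "y \<in> {a j + int k, a j + int k - 1}" for \<phi> j y
    proof -
      \<comment> \<open>Both sites at a cut must be small, so \<open>l\<close> is \<open>k\<close>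
        or \<open>k + 1\<close>. In either case the determinants to the left and to the right, of
        lengths \<open>l - 1\<close> and \<open>m - l\<close>, have length at most \<open>k\<close>
        because \<open>k < m \<le> 2 k\<close>, and the gain applies to both.\<close>
      define l where "l = nat (y - a j + 1)"
      have l: "l = k \<or> l = Suc k" "y = a j - 1 + int l" using y k(1) N by (auto simp: l_def)
      define u where "u = (\<lambda>i. E - f (\<alpha> * real i + T j))"
      have cu: "continuant (\<lambda>i. u (i + n)) m' = chi f \<alpha> E m' (T j + \<alpha> * real n)" for n m'
        by (simp add: u_def chi_def algebra_simps)
      define z where "z = (\<lambda>i. \<phi> (a j - 1 + int i))"
      have "\<bar>continuant u m\<bar> * cmod (z l) \<le> (exp (- real N) * \<tau>) * (cmod (z 0) + cmod (z (Suc m)))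
        + 2 * (exp (- real N) * \<tau>) * \<tau> * (\<Sum>i<m. cmod (z i + z (Suc (Suc i)) - of_real (u i) * z (Suc i)))"
      proof (rule Green_function_bound)
        show "1 \<le> l" "l \<le> m" using l k N by auto
        show "\<bar>continuant u (l - 1)\<bar> \<le> exp (- real N) * \<tau>"
          using cu[of 0 "l - 1"] gain[of "l - 1"] l(1) by (auto simp: \<tau>_def)
        show "\<bar>continuant (\<lambda>i. u (i + l)) (m - l)\<bar> \<le> exp (- real N) * \<tau>"
          unfolding cu \<tau>_def using l(1) k(4) by (intro gain) auto
        show "\<bar>continuant (\<lambda>i. u (i + l')) i\<bar> \<le> \<tau>" if "l' + i \<le> m" for l' i
          unfolding cu \<tau>_def using that k(4) by (intro max) auto
      qed
      also have "(\<Sum>i<m. cmod (z i + z (Suc (Suc i)) - of_real (u i) * z (Suc i)))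
          = (\<Sum>i<m. cmod (jacobi (pot f \<alpha> \<theta> E) \<phi> (a j + int i)))"
      proof (intro sum.cong refl arg_cong[where f = cmod])
        fix i
        have "pot f \<alpha> \<theta> E (a j + int i) = - u i"
          by (simp add: pot_def u_def T_def algebra_simps)
        then show "z i + z (Suc (Suc i)) - of_real (u i) * z (Suc i) = jacobi (pot f \<alpha> \<theta> E) \<phi> (a j + int i)"
          by (simp add: jacobi_def z_def algebra_simps)
      qed
      finally have G: "\<bar>continuant u m\<bar> * cmod (\<phi> y) \<le> (exp (- real N) * \<tau>) * (cmod (\<phi> (a j - 1)) + cmod (\<phi> (a j + int m)))
        + 2 * (exp (- real N) * \<tau>) * \<tau> * (\<Sum>i<m. cmod (jacobi (pot f \<alpha> \<theta> E) \<phi> (a j + int i)))"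
        by (simp add: z_def l(2))
      have "\<tau> / 2 \<le> \<bar>continuant u m\<bar>" using cu[of 0 m] big[of j] by simp
      then have "\<tau> / 2 * cmod (\<phi> y) \<le> \<bar>continuant u m\<bar> * cmod (\<phi> y)" by (intro mult_right_mono) auto
      also note G
      also have "(exp (- real N) * \<tau>) * (cmod (\<phi> (a j - 1)) + cmod (\<phi> (a j + int m)))
        + 2 * (exp (- real N) * \<tau>) * \<tau> * (\<Sum>i<m. cmod (jacobi (pot f \<alpha> \<theta> E) \<phi> (a j + int i)))
        = \<tau> / 2 * (2 * exp (- real N) * (cmod (\<phi> (a j - 1)) + cmod (\<phi> (a j + int m)))
        + 4 * exp (- real N) * \<tau> * (\<Sum>i<m. cmod (jacobi (pot f \<alpha> \<theta> E) \<phi> (a j + int i))))"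
        by (simp add: algebra_simps)
      finally show ?thesis using \<tau> by (simp only: mult_le_cancel_left_pos)
    qed
  qed (use \<tau> in auto)
  then show False using E not_in_spec_iff[OF f] by blast
qed

section \<open>Lyapunov exponent\<close>

lemma integral_periodic_shift:
  fixes g :: "real \<Rightarrow> real"
  assumes cont: "continuous_on UNIV g" and per: "\<And>x. g (x + 1) = g x"
  shows "integral {0..1} (\<lambda>x. g (x + s)) = integral {0..1} g"
proof -
  define r where "r = frac s"
  have r: "0 \<le> r" "r \<le> 1" using frac_lt_1[of s] by (auto simp: r_def less_imp_le)
  have int: "g integrable_on {a..b}" for a b
    by (intro integrable_continuous_real continuous_on_subset[OF cont]) auto
  have "g (x + s) = g (r + x)" for x
    using periodic_add_int[of g, OF per, of "r + x" "\<lfloor>s\<rfloor>"] by (simp add: r_def frac_def algebra_simps)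
  then have "integral {0..1} (\<lambda>x. g (x + s)) = integral {0 + r..1 + r} g"
    using integral_shift_Icc_real[of 0 1 g r] by (simp add: o_def)
  also have "\<dots> = integral {r..1} g + integral {1..1 + r} g"
    using Henstock_Kurzweil_Integration.integral_combine[of r 1 "1 + r" g] r int by simp
  also have "integral {1..1 + r} g = integral {0..r} g"
    using integral_shift_Icc_real[of 0 r g 1] per by (simp add: o_def add.commute)
  also have "integral {r..1} g + integral {0..r} g = integral {0..1} g"
    using Henstock_Kurzweil_Integration.integral_combine[of 0 r 1 g] r int by simp
  finally show ?thesis .
qed

text \<open>Fekete's lemma, with the lower bound on \<open>u\<close> keeping the infimum finite. The
  second conclusion, that the limit lies below every term, is what turns an asymptotic rate into one
  at every scale.\<close>

lemma subadditive_convergent: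
  fixes u :: "nat \<Rightarrow> real"
  assumes sub: "\<And>m n. u (m + n) \<le> u m + u n" and low: "\<And>n. - K \<le> u n"
  shows "\<exists>L. (\<lambda>n. u n / real n) \<longlonglongrightarrow> L \<and> (\<forall>n\<ge>1. L \<le> u n / real n)"
proof -
  define S where "S = (\<lambda>n. u n / real n) ` {1..}"
  define L where "L = Inf S"
  have bdd: "bdd_below S"
  proof (rule bdd_belowI[of _ "- \<bar>K\<bar>"])
    fix s assume "s \<in> S"
    then obtain n where n: "1 \<le> n" "s = u n / real n" by (auto simp: S_def)
    have "\<bar>K\<bar> * 1 \<le> \<bar>K\<bar> * real n" using n by (intro mult_left_mono) auto
    then have "- \<bar>K\<bar> * real n \<le> u n" using low[of n] by simp
    then show "- \<bar>K\<bar> \<le> s" using n by (simp add: le_divide_eq)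
  qed
  have Lle: "L \<le> u n / real n" if "1 \<le> n" for n
    unfolding L_def using that by (intro cInf_lower bdd) (auto simp: S_def)
  have "(\<lambda>n. u n / real n) \<longlonglongrightarrow> L"
  proof (rule LIMSEQ_I)
    fix e :: real assume e: "0 < e"
    have "\<exists>s\<in>S. s < L + e / 2"
      unfolding L_def using cInf_lessD[of S "Inf S + e / 2"] e by (auto simp: S_def)
    then obtain n0 where n0: "1 \<le> n0" "u n0 / real n0 < L + e / 2" by (auto simp: S_def)
    define C where "C = (\<Sum>r<n0. \<bar>u r\<bar>) + \<bar>u n0\<bar>"
    have upper: "u n / real n \<le> u n0 / real n0 + C / real n" if "1 \<le> n" for n
    proof -
      define q where "q = n div n0"
      define r where "r = n mod n0"
      have nqr: "n = q * n0 + r" by (simp add: q_def r_def)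
      have r: "r < n0" using n0 by (simp add: r_def)
      have mult: "u (q * n0 + r) \<le> real q * u n0 + u r" for q
      proof (induction q)
        case (Suc q)
        then show ?case using sub[of n0 "q * n0 + r"] by (simp add: algebra_simps)
      qed simp
      have ur: "u r \<le> (\<Sum>r<n0. \<bar>u r\<bar>)"
        using member_le_sum[of r "{..<n0}" "\<lambda>r. \<bar>u r\<bar>"] r by auto
      have "real q * u n0 = real n * (u n0 / real n0) - real r * (u n0 / real n0)"
        using n0 nqr by (simp add: field_simps)
      moreover have "- (real r * (u n0 / real n0)) \<le> \<bar>u n0\<bar>"
      proof -
        have "\<bar>real r * (u n0 / real n0)\<bar> = real r / real n0 * \<bar>u n0\<bar>" by (simp add: abs_mult)
        also have "\<dots> \<le> 1 * \<bar>u n0\<bar>" using r by (intro mult_right_mono) auto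
        finally show ?thesis by linarith
      qed
      ultimately have "u n \<le> real n * (u n0 / real n0) + C"
        using mult[of q] ur nqr by (simp add: C_def)
      then show ?thesis using that by (simp add: divide_le_eq algebra_simps)
    qed
    have "(\<lambda>n. C / real n) \<longlonglongrightarrow> 0" by (rule lim_const_over_n)
    then have "eventually (\<lambda>n. C / real n < e / 2) sequentially"
      using e by (intro order_tendstoD) auto
    then obtain M where M: "\<And>n. n \<ge> M \<Longrightarrow> C / real n < e / 2" by (auto simp: eventually_sequentially)
    have "norm (u n / real n - L) < e" if "n \<ge> max 1 M" for n
    proof -
      have "1 \<le> n" "M \<le> n" using that by auto
      from upper[OF this(1)] M[OF this(2)] Lle[OF this(1)] n0(2) show ?thesis
        unfolding real_norm_def by linarith
    qed
    then show "\<exists>no. \<forall>n\<ge>no. norm (u n / real n - L) < e" by blast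
  qed
  then show ?thesis using Lle by blast
qed

text \<open>This links the Lyapunov exponent to box determinants. The index starts at two because
  the lower right entry is a determinant of length two less than the product.\<close>

lemma Tmat_entries:
  "Tmat f \<alpha> (Suc (Suc n)) \<theta> E $ 1 $ 1 = chi f \<alpha> E (Suc (Suc n)) \<theta>"
  "Tmat f \<alpha> (Suc (Suc n)) \<theta> E $ 1 $ 2 = - chi f \<alpha> E (Suc n) (\<theta> + \<alpha>)"
  "Tmat f \<alpha> (Suc (Suc n)) \<theta> E $ 2 $ 1 = chi f \<alpha> E (Suc n) \<theta>"
  "Tmat f \<alpha> (Suc (Suc n)) \<theta> E $ 2 $ 2 = - chi f \<alpha> E n (\<theta> + \<alpha>)"
proof (induction n)
  case 0
  show "Tmat f \<alpha> (Suc (Suc 0)) \<theta> E $ 1 $ 1 = chi f \<alpha> E (Suc (Suc 0)) \<theta>"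
    "Tmat f \<alpha> (Suc (Suc 0)) \<theta> E $ 1 $ 2 = - chi f \<alpha> E (Suc 0) (\<theta> + \<alpha>)"
    "Tmat f \<alpha> (Suc (Suc 0)) \<theta> E $ 2 $ 1 = chi f \<alpha> E (Suc 0) \<theta>"
    "Tmat f \<alpha> (Suc (Suc 0)) \<theta> E $ 2 $ 2 = - chi f \<alpha> E 0 (\<theta> + \<alpha>)"
    by (simp_all add: Mmat_def matrix_matrix_mult_def sum_2 chi_def mat_def add.commute)
next
  case (Suc n)
  have step: "Tmat f \<alpha> (Suc (Suc (Suc n))) \<theta> E $ 1 $ b = (E - f (\<alpha> * real (Suc (Suc n)) + \<theta>)) *
      Tmat f \<alpha> (Suc (Suc n)) \<theta> E $ 1 $ b - Tmat f \<alpha> (Suc (Suc n)) \<theta> E $ 2 $ b"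
    "Tmat f \<alpha> (Suc (Suc (Suc n))) \<theta> E $ 2 $ b = Tmat f \<alpha> (Suc (Suc n)) \<theta> E $ 1 $ b" for b
    by (simp_all only: Tmat.simps(2)[of f \<alpha> "Suc (Suc n)"] Mmat_def matrix_matrix_mult_def sum_2 vec_lambda_beta vector_2)
  have e: "\<alpha> * real (Suc (Suc n)) + \<theta> = \<alpha> * real (Suc n) + (\<theta> + \<alpha>)" by (simp add: algebra_simps)
  show "Tmat f \<alpha> (Suc (Suc (Suc n))) \<theta> E $ 1 $ 1 = chi f \<alpha> E (Suc (Suc (Suc n))) \<theta>"
    unfolding step Suc by (simp add: chi_def)
  show "Tmat f \<alpha> (Suc (Suc (Suc n))) \<theta> E $ 1 $ 2 = - chi f \<alpha> E (Suc (Suc n)) (\<theta> + \<alpha>)"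
    unfolding step Suc e by (simp add: chi_def)
  show "Tmat f \<alpha> (Suc (Suc (Suc n))) \<theta> E $ 2 $ 1 = chi f \<alpha> E (Suc (Suc n)) \<theta>"
    "Tmat f \<alpha> (Suc (Suc (Suc n))) \<theta> E $ 2 $ 2 = - chi f \<alpha> E (Suc n) (\<theta> + \<alpha>)"
    unfolding step Suc by simp_all
qed

lemma Tmat_entry_le_chi:
  assumes "1 \<le> n"
  shows "\<exists>i\<le>n. \<exists>\<theta>'. \<bar>Tmat f \<alpha> n \<theta> E $ a $ b\<bar> \<le> \<bar>chi f \<alpha> E i \<theta>'\<bar>"
proof (cases "n = 1")
  case True
  have "\<bar>Tmat f \<alpha> 1 \<theta> E $ a $ b\<bar> \<le> \<bar>chi f \<alpha> E 1 \<theta>\<bar> \<or> \<bar>Tmat f \<alpha> 1 \<theta> E $ a $ b\<bar> \<le> \<bar>chi f \<alpha> E 0 \<theta>\<bar>"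
    using exhaust_2[of a] exhaust_2[of b]
    by (auto simp: Mmat_def matrix_matrix_mult_def sum_2 chi_def mat_def)
  then show ?thesis using True by (metis le_refl zero_le)
next
  case False
  define k where "k = n - 2"
  have k: "n = Suc (Suc k)" using assms False by (simp add: k_def)
  note T = Tmat_entries[of f \<alpha> k \<theta> E]
  have w: "\<exists>i\<le>n. \<exists>\<theta>'. x \<le> \<bar>chi f \<alpha> E i \<theta>'\<bar>" if "x = \<bar>chi f \<alpha> E i \<theta>'\<bar>" "i \<le> n" for x i \<theta>'
    using that by blast
  have "\<exists>i\<le>n. \<exists>\<theta>'. \<bar>Tmat f \<alpha> n \<theta> E $ 1 $ 1\<bar> \<le> \<bar>chi f \<alpha> E i \<theta>'\<bar>"
    by (rule w[of _ "Suc (Suc k)" \<theta>]) (simp_all add: k T del: Tmat.simps)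
  moreover have "\<exists>i\<le>n. \<exists>\<theta>'. \<bar>Tmat f \<alpha> n \<theta> E $ 1 $ 2\<bar> \<le> \<bar>chi f \<alpha> E i \<theta>'\<bar>"
    by (rule w[of _ "Suc k" "\<theta> + \<alpha>"]) (simp_all add: k T del: Tmat.simps)
  moreover have "\<exists>i\<le>n. \<exists>\<theta>'. \<bar>Tmat f \<alpha> n \<theta> E $ 2 $ 1\<bar> \<le> \<bar>chi f \<alpha> E i \<theta>'\<bar>"
    by (rule w[of _ "Suc k" \<theta>]) (simp_all add: k T del: Tmat.simps)
  moreover have "\<exists>i\<le>n. \<exists>\<theta>'. \<bar>Tmat f \<alpha> n \<theta> E $ 2 $ 2\<bar> \<le> \<bar>chi f \<alpha> E i \<theta>'\<bar>"
    by (rule w[of _ k "\<theta> + \<alpha>"]) (simp_all add: k T del: Tmat.simps)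
  ultimately show ?thesis using exhaust_2[of a] exhaust_2[of b] by (elim disjE) simp_all
qed

text \<open>The norm is at most the sum of the four entries, each dominated by a determinant; this
  is the origin of the factor 1/4 in the growth condition.\<close>

lemma onorm_Tmat_le:
  assumes "1 \<le> n" and "\<And>i \<theta>'. i \<le> n \<Longrightarrow> \<bar>chi f \<alpha> E i \<theta>'\<bar> < S"
  shows "onorm ((*v) (Tmat f \<alpha> n \<theta> E)) < 4 * S"
proof -
  have e: "\<bar>Tmat f \<alpha> n \<theta> E $ a $ b\<bar> < S" for a b
    using Tmat_entry_le_chi[OF assms(1), of f \<alpha> \<theta> E a b] assms(2) by (meson le_less_trans)
  have "onorm ((*v) (Tmat f \<alpha> n \<theta> E)) \<le> (\<Sum>a\<in>UNIV. \<Sum>b\<in>UNIV. \<bar>Tmat f \<alpha> n \<theta> E $ a $ b\<bar>)"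
    by (rule onorm_le_matrix_component_sum)
  also have "\<dots> < 4 * S" using e[of 1 1] e[of 1 2] e[of 2 1] e[of 2 2] by (simp add: sum_2)
  finally show ?thesis .
qed

lemma det_Tmat: "det (Tmat f \<alpha> n \<theta> E) = 1"
proof (induction n)
  case (Suc n)
  have "det (Mmat f \<alpha> n \<theta> E) = 1" by (simp add: Mmat_def det_2)
  then show ?case using Suc by (simp add: det_mul)
qed simp

text \<open>If all entries were at most 1/2 in modulus, the determinant would be at most 1/2 instead
  of 1. The bound makes the logarithm continuous in the phase and bounds its integrals below, as
  Fekete's lemma requires.\<close>

lemma onorm_Tmat_ge: "1 / 2 \<le> onorm ((*v) (Tmat f \<alpha> n \<theta> E))"
proof (rule ccontr)
  assume neg: "\<not> ?thesis"
  let ?T = "Tmat f \<alpha> n \<theta> E"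
  have e: "\<bar>?T $ a $ b\<bar> \<le> 1 / 2" for a b
    using matrix_component_le_onorm[of ?T a b] neg by simp
  have "\<bar>?T $ a $ b * ?T $ c $ d\<bar> \<le> 1 / 4" for a b c d
    using mult_mono[OF e[of a b] e[of c d]] by (simp add: abs_mult)
  from this[of 1 1 2 2] this[of 1 2 2 1] det_Tmat[of f \<alpha> n \<theta> E] show False
    by (simp add: det_2)
qed

lemma Tmat_add: "Tmat f \<alpha> (m + n) \<theta> E = Tmat f \<alpha> n (\<theta> + \<alpha> * real m) E ** Tmat f \<alpha> m \<theta> E"
proof (induction n)
  case 0
  then show ?case by simp
next
  case (Suc n)
  have "Mmat f \<alpha> (m + n) \<theta> E = Mmat f \<alpha> n (\<theta> + \<alpha> * real m) E"
    by (simp add: Mmat_def algebra_simps)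
  then show ?case using Suc by (simp add: matrix_mul_assoc)
qed

lemma onorm_Tmat_add:
  "onorm ((*v) (Tmat f \<alpha> (m + n) \<theta> E))
    \<le> onorm ((*v) (Tmat f \<alpha> n (\<theta> + \<alpha> * real m) E)) * onorm ((*v) (Tmat f \<alpha> m \<theta> E))"
proof -
  have "(*v) (Tmat f \<alpha> (m + n) \<theta> E) = (*v) (Tmat f \<alpha> n (\<theta> + \<alpha> * real m) E) \<circ> (*v) (Tmat f \<alpha> m \<theta> E)"
    by (simp add: Tmat_add fun_eq_iff matrix_vector_mul_assoc)
  then show ?thesis by (simp add: onorm_compose)
qed

lemma Tmat_periodic:
  assumes per: "\<And>x. f (x + 1) = f x"
  shows "Tmat f \<alpha> n (\<theta> + 1) E = Tmat f \<alpha> n \<theta> E"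
  by (induction n) (simp_all add: Mmat_def per flip: add.assoc)

lemma onorm_matrix_diff_le:
  fixes A B :: "real^2^2"
  shows "\<bar>onorm ((*v) A) - onorm ((*v) B)\<bar> \<le> (\<Sum>a\<in>UNIV. \<Sum>b\<in>UNIV. \<bar>A $ a $ b - B $ a $ b\<bar>)"
proof -
  have "onorm ((*v) A) - onorm ((*v) B) \<le> (\<Sum>a\<in>UNIV. \<Sum>b\<in>UNIV. \<bar>A $ a $ b - B $ a $ b\<bar>)" for A B :: "real^2^2"
  proof -
    have "(*v) A = (\<lambda>x. (A - B) *v x + B *v x)"
      by (simp add: fun_eq_iff matrix_vector_mult_diff_rdistrib)
    then have "onorm ((*v) A) \<le> onorm ((*v) (A - B)) + onorm ((*v) B)"
      using onorm_triangle[of "(*v) (A - B)" "(*v) B"] by simp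
    then show ?thesis using onorm_le_matrix_component_sum[of "A - B"] by simp
  qed
  from this[of A B] this[of B A] show ?thesis by (simp add: abs_le_iff abs_minus_commute)
qed

lemma continuous_on_Tmat_entry:
  assumes cont: "continuous_on UNIV f"
  shows "continuous_on UNIV (\<lambda>\<theta>. Tmat f \<alpha> n \<theta> E $ a $ b)"
proof (induction n arbitrary: a)
  case 0
  then show ?case by simp
next
  case (Suc n)
  have M: "continuous_on UNIV (\<lambda>\<theta>. Mmat f \<alpha> n \<theta> E $ a $ c)" for c
  proof -
    have "continuous_on UNIV (\<lambda>\<theta>. E - f (\<alpha> * real n + \<theta>))"
      by (intro continuous_intros continuous_on_compose2[OF cont]) auto
    then show ?thesis using exhaust_2[of a] exhaust_2[of c] by (elim disjE) (simp_all add: Mmat_def)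
  qed
  show ?case
    by (simp add: matrix_matrix_mult_def) (intro continuous_intros M Suc)
qed

lemma continuous_on_ln_onorm_Tmat:
  assumes cont: "continuous_on UNIV f"
  shows "continuous_on UNIV (\<lambda>\<theta>. ln (onorm ((*v) (Tmat f \<alpha> n \<theta> E))))"
proof -
  let ?N = "\<lambda>\<theta>. onorm ((*v) (Tmat f \<alpha> n \<theta> E))"
  have "isCont ?N t" for t
    unfolding isCont_def
  proof (rule LIM_zero_cancel, rule Lim_null_comparison)
    let ?D = "\<lambda>\<theta>. \<Sum>a\<in>UNIV. \<Sum>b\<in>UNIV. \<bar>Tmat f \<alpha> n \<theta> E $ a $ b - Tmat f \<alpha> n t E $ a $ b\<bar>"
    show "\<forall>\<^sub>F \<theta> in at t. norm (?N \<theta> - ?N t) \<le> ?D \<theta>"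
      by (intro always_eventually allI) (simp add: onorm_matrix_diff_le)
    have T: "(\<lambda>\<theta>. Tmat f \<alpha> n \<theta> E $ a $ b) \<midarrow>t\<rightarrow> Tmat f \<alpha> n t E $ a $ b" for a b
      using continuous_on_Tmat_entry[OF cont] by (simp add: continuous_on_eq_continuous_at isCont_def)
    then have "?D \<midarrow>t\<rightarrow> (\<Sum>a\<in>UNIV. \<Sum>b\<in>UNIV. \<bar>Tmat f \<alpha> n t E $ a $ b - Tmat f \<alpha> n t E $ a $ b\<bar>)"
      by (intro tendsto_sum tendsto_rabs tendsto_diff tendsto_const T)
    then show "?D \<midarrow>t\<rightarrow> 0" by simp
  qed
  then have "continuous_on UNIV ?N" by (simp add: continuous_on_eq_continuous_at)
  moreover have "?N \<theta> \<noteq> 0" for \<theta> using onorm_Tmat_ge[of f \<alpha> n \<theta> E] by linarith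
  ultimately show ?thesis by (intro continuous_on_ln) auto
qed

text \<open>The mean of \<open>ln |T_n|\<close> is at least \<open>L n\<close> for every
  \<open>n \<ge> 1\<close>. If all determinants up to length \<open>n\<close> stayed below
  \<open>exp (L n / 2) / 4\<close>, the norm would stay below \<open>exp (L n / 2)\<close> at every
  phase, and so would its logarithmic mean.\<close>

lemma lyap_pos_imp_growth:
  assumes cont: "continuous_on UNIV f" and per: "\<And>x. f (x + 1) = f x" and pos: "0 < lyap f E \<alpha>"
  shows "\<exists>\<gamma>>0. \<forall>n\<ge>1. \<exists>\<theta>. \<exists>i\<le>n. exp (\<gamma> * real n) / 4 \<le> \<bar>chi f \<alpha> E i \<theta>\<bar>"
proof -
  define g where "g = (\<lambda>n \<theta>. ln (onorm ((*v) (Tmat f \<alpha> n \<theta> E))))"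
  define u where "u = (\<lambda>n. integral {0..1} (g n))"
  have gcont: "continuous_on S (g n)" for S n
    unfolding g_def using continuous_on_ln_onorm_Tmat[OF cont] continuous_on_subset by blast
  have gint: "g n integrable_on {0..1}" for n by (intro integrable_continuous_real gcont)
  have gint': "(\<lambda>\<theta>. g n (\<theta> + s)) integrable_on {0..1}" for n s
    by (intro integrable_continuous_real continuous_on_compose2[OF gcont[of UNIV n]] continuous_intros) auto
  have gper: "g n (\<theta> + 1) = g n \<theta>" for n \<theta> by (simp add: g_def Tmat_periodic[of f, OF per])
  have Npos: "0 < onorm ((*v) (Tmat f \<alpha> n \<theta> E))" for n \<theta>
    using onorm_Tmat_ge[of f \<alpha> n \<theta> E] by linarith
  have gadd: "g (m + n) \<theta> \<le> g m \<theta> + g n (\<theta> + \<alpha> * real m)" for m n \<theta>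
  proof -
    have "g (m + n) \<theta> \<le> ln (onorm ((*v) (Tmat f \<alpha> n (\<theta> + \<alpha> * real m) E)) * onorm ((*v) (Tmat f \<alpha> m \<theta> E)))"
      unfolding g_def using onorm_Tmat_add Npos by (subst ln_le_cancel_iff) auto
    also have "\<dots> = g n (\<theta> + \<alpha> * real m) + g m \<theta>" unfolding g_def by (intro ln_mult_pos Npos)
    finally show ?thesis by simp
  qed
  have sub: "u (m + n) \<le> u m + u n" for m n
  proof -
    have "u (m + n) \<le> integral {0..1} (\<lambda>\<theta>. g m \<theta> + g n (\<theta> + \<alpha> * real m))"
      unfolding u_def by (intro integral_le gint integrable_add gint' gadd)
    also have "\<dots> = u m + integral {0..1} (\<lambda>\<theta>. g n (\<theta> + \<alpha> * real m))"
      unfolding u_def by (intro integral_add gint gint')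
    also have "integral {0..1} (\<lambda>\<theta>. g n (\<theta> + \<alpha> * real m)) = u n"
      unfolding u_def by (rule integral_periodic_shift[OF gcont gper])
    finally show ?thesis .
  qed
  have low: "- ln 2 \<le> u n" for n
  proof -
    have "- ln 2 \<le> g n \<theta>" for \<theta>
    proof -
      have "ln (1 / 2) \<le> g n \<theta>" unfolding g_def using onorm_Tmat_ge Npos by (subst ln_le_cancel_iff) auto
      then show ?thesis by (simp add: ln_div)
    qed
    then have "integral {0..1} (\<lambda>_::real. - ln 2) \<le> u n"
      unfolding u_def by (intro integral_le gint) auto
    then show ?thesis by simp
  qed
  obtain L where L: "(\<lambda>n. u n / real n) \<longlonglongrightarrow> L" "\<And>n. n \<ge> 1 \<Longrightarrow> L \<le> u n / real n"
    using subadditive_convergent[of u, OF sub low] by auto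
  \<comment> \<open>\<open>lim\<close> denotes the actual limit only because convergence has just
    been established.\<close>
  have "lyap f E \<alpha> = lim (\<lambda>n. u n / real n)"
    by (simp add: lyap_def u_def g_def[abs_def])
  then have L0: "0 < L" using pos limI[OF L(1)] by simp
  have "\<exists>\<theta>. \<exists>i\<le>n. exp (L / 2 * real n) / 4 \<le> \<bar>chi f \<alpha> E i \<theta>\<bar>" if n: "1 \<le> n" for n
  proof (rule ccontr)
    assume "\<not> ?thesis"
    then have small: "\<bar>chi f \<alpha> E i \<theta>\<bar> < exp (L / 2 * real n) / 4" if "i \<le> n" for i \<theta>
      using that by (meson not_le)
    have "g n \<theta> \<le> L / 2 * real n" for \<theta>
    proof -
      have "onorm ((*v) (Tmat f \<alpha> n \<theta> E)) < 4 * (exp (L / 2 * real n) / 4)"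
        by (rule onorm_Tmat_le[OF n small])
      then have "g n \<theta> \<le> ln (exp (L / 2 * real n))"
        unfolding g_def using Npos by (subst ln_le_cancel_iff) auto
      then show ?thesis by simp
    qed
    then have "u n \<le> integral {0..1} (\<lambda>_::real. L / 2 * real n)"
      unfolding u_def by (intro integral_le gint) auto
    moreover have "L * real n \<le> u n" using L(2)[OF n] n by (simp add: le_divide_eq)
    moreover have "0 < L * real n" using L0 n by simp
    ultimately show False by simp
  qed
  then show ?thesis using L0 by (intro exI[of _ "L / 2"]) auto
qed

section \<open>Measure and perturbation of the spectrum\<close>

text \<open>Closeness is demanded only on the support of \<open>x\<close>. Potentials with different
  frequencies are not uniformly close on the whole lattice, but they are on a short
  interval.\<close>

lemma norm_Jop_perturb:
  assumes v: "\<forall>n. \<bar>v n\<bar> \<le> M" and w: "\<forall>n. \<bar>w n\<bar> \<le> M'" and "0 \<le> \<epsilon>"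
    and close: "\<And>n. Rep_ell x n \<noteq> 0 \<Longrightarrow> \<bar>v n - w n\<bar> \<le> \<epsilon>"
  shows "norm (Jop v x) \<le> norm (Jop w x) + \<epsilon> * norm x"
proof -
  define d where "d = (\<lambda>n. complex_of_real (v n - w n) * Rep_ell x n)"
  have F: "(\<Sum>n\<in>F. (cmod (d n))\<^sup>2) \<le> (\<epsilon> * norm x)\<^sup>2" if F: "finite F" for F
  proof -
    have "(cmod (d n))\<^sup>2 \<le> \<epsilon>\<^sup>2 * (cmod (Rep_ell x n))\<^sup>2" for n
    proof (cases "Rep_ell x n = 0")
      case False
      then have "cmod (d n) \<le> \<epsilon> * cmod (Rep_ell x n)"
        unfolding d_def norm_mult norm_of_real using close by (intro mult_right_mono) auto
      then have "(cmod (d n))\<^sup>2 \<le> (\<epsilon> * cmod (Rep_ell x n))\<^sup>2" by (intro power_mono) auto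
      then show ?thesis by (simp add: power_mult_distrib)
    qed (simp add: d_def)
    then have "(\<Sum>n\<in>F. (cmod (d n))\<^sup>2) \<le> \<epsilon>\<^sup>2 * (\<Sum>n\<in>F. (cmod (Rep_ell x n))\<^sup>2)"
      unfolding sum_distrib_left by (intro sum_mono)
    also have "\<dots> \<le> \<epsilon>\<^sup>2 * (norm x)\<^sup>2" using sum_Rep_ell_le[OF F] by (intro mult_left_mono) auto
    finally show ?thesis by (simp add: power_mult_distrib)
  qed
  have e: "0 \<le> \<epsilon> * norm x" using \<open>0 \<le> \<epsilon>\<close> by simp
  have d: "d \<in> l2" "norm (Abs_ell d) \<le> \<epsilon> * norm x"
    using l2_if_sums_bounded[of d, OF F e] by blast+
  have "Rep_ell (Jop v x - Jop w x) n = Rep_ell (Abs_ell d) n" for n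
    unfolding Abs_ell_inverse[OF d(1)] minus_ell.rep_eq Rep_Jop[OF v] Rep_Jop[OF w]
    by (simp add: d_def jacobi_def algebra_simps)
  then have "Jop v x - Jop w x = Abs_ell d" by (intro Rep_ell_inject[THEN iffD1] ext)
  then have "norm (Jop v x - Jop w x) \<le> \<epsilon> * norm x" using d(2) by simp
  then show ?thesis using norm_triangle_sub[of "Jop v x" "Jop w x"] by linarith
qed

lemma norm_ell_finite_support:
  assumes "finite A" "\<And>n. n \<notin> A \<Longrightarrow> Rep_ell x n = 0"
  shows "(norm x)\<^sup>2 = (\<Sum>n\<in>A. (cmod (Rep_ell x n))\<^sup>2)"
proof -
  have "(\<Sum>\<^sub>\<infinity>n. (cmod (Rep_ell x n))\<^sup>2) = (\<Sum>\<^sub>\<infinity>n\<in>A. (cmod (Rep_ell x n))\<^sup>2)"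
    by (rule infsum_cong_neutral) (use assms in auto)
  then show ?thesis using assms(1) by (simp add: norm_ell_sq)
qed

section \<open>Boundedness and compactness of the union of spectra\<close>

lemma spec_bounded:
  assumes f: "\<forall>x. \<bar>f x\<bar> \<le> B" and E: "E \<in> spec f \<alpha> \<theta>"
  shows "\<bar>E\<bar> \<le> B + 2"
proof (rule ccontr)
  assume "\<not> ?thesis"
  then have E2: "0 < \<bar>E\<bar> - (B + 2)" by simp
  have bd: "\<forall>n. \<bar>pot f \<alpha> \<theta> 0 n\<bar> \<le> B" using f by (simp add: pot_def)
  have "(\<bar>E\<bar> - (B + 2)) * norm x \<le> norm (Jop (pot f \<alpha> \<theta> E) x)" for x
  proof -
    have "Jop (pot f \<alpha> \<theta> E) x = Jop (pot f \<alpha> \<theta> 0) x - E *\<^sub>R x"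
      unfolding Jop_diff_scale[OF bd] by (simp add: pot_def[abs_def])
    then have "norm (E *\<^sub>R x) \<le> norm (Jop (pot f \<alpha> \<theta> 0) x) + norm (Jop (pot f \<alpha> \<theta> E) x)"
      using norm_triangle_sub[of "E *\<^sub>R x" "Jop (pot f \<alpha> \<theta> 0) x"] by (simp only: norm_minus_commute)
    moreover have "norm (Jop (pot f \<alpha> \<theta> 0) x) \<le> (B + 2) * norm x" by (rule norm_Jop_le[OF bd])
    moreover have "norm (E *\<^sub>R x) = \<bar>E\<bar> * norm x" by simp
    ultimately show ?thesis by (simp add: algebra_simps)
  qed
  then show False using E not_in_spec_iff[OF f] E2 by blast
qed

lemma spec_add_int:
  assumes "\<And>x. f (x + 1) = f x"
  shows "spec f \<alpha> (\<theta> + of_int n) = spec f \<alpha> \<theta>"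
  using periodic_add_int[of f, OF assms] by (simp add: spec_def Hop_def flip: add.assoc)

lemma specU_eq: "(\<And>x. f (x + 1) = f x) \<Longrightarrow> specU f \<alpha> = (\<Union>\<theta>\<in>{0..1}. spec f \<alpha> \<theta>)"
proof -
  assume per: "\<And>x. f (x + 1) = f x"
  have "spec f \<alpha> \<theta> = spec f \<alpha> (frac \<theta>)" for \<theta>
    using spec_add_int[of f \<alpha> "frac \<theta>" "\<lfloor>\<theta>\<rfloor>", OF per] by (simp add: frac_def)
  moreover have "frac \<theta> \<in> {0..1}" for \<theta> :: real using frac_lt_1[of \<theta>] by (simp add: less_imp_le)
  ultimately show ?thesis unfolding specU_def by blast
qed

text \<open>Phases may be taken in the unit interval, so a subsequence of them converges. A lower
  bound at the limit phase and energy would persist under the uniformly small change of potential,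
  contradicting that the approximating energies are spectral. Compactness later yields measurability
  and finite measure.\<close>

lemma compact_specU:
  assumes f: "\<forall>x. \<bar>f x\<bar> \<le> B" and per: "\<And>x. f (x + 1) = f x"
    and lip: "\<And>x y. \<bar>f x - f y\<bar> \<le> D * \<bar>x - y\<bar>" and "0 \<le> D"
  shows "compact (specU f \<alpha>)"
proof -
  have "bounded (specU f \<alpha>)"
    unfolding bounded_iff specU_def using spec_bounded[OF f] by (auto intro!: exI[of _ "B + 2"])
  moreover have "closed (specU f \<alpha>)"
    unfolding closed_sequential_limits
  proof (intro allI impI, elim conjE)
    fix e l assume e: "\<forall>n. e n \<in> specU f \<alpha>" and lim: "e \<longlonglongrightarrow> l"
    have "\<forall>n. \<exists>t\<in>{0..1}. e n \<in> spec f \<alpha> t" using e specU_eq[of f \<alpha>, OF per] by auto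
    then obtain t where t: "\<And>n. t n \<in> {0..1}" "\<And>n. e n \<in> spec f \<alpha> (t n)" by metis
    have "compact {0..1::real}" by simp
    then obtain \<theta> r where r: "strict_mono r" "(t \<circ> r) \<longlonglongrightarrow> \<theta>"
      using t(1) unfolding compact_def by metis
    have "(\<lambda>n. D * \<bar>t (r n) - \<theta>\<bar> + \<bar>e (r n) - l\<bar>) \<longlonglongrightarrow> D * \<bar>\<theta> - \<theta>\<bar> + \<bar>l - l\<bar>"
      using r(2) LIMSEQ_subseq_LIMSEQ[OF lim r(1)] by (intro tendsto_intros) (auto simp: o_def)
    then have small: "(\<lambda>n. D * \<bar>t (r n) - \<theta>\<bar> + \<bar>e (r n) - l\<bar>) \<longlonglongrightarrow> 0" by simp
    have "l \<in> spec f \<alpha> \<theta>"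
    proof (rule ccontr)
      assume "l \<notin> spec f \<alpha> \<theta>"
      then obtain c where c: "0 < c" "\<And>x. c * norm x \<le> norm (Jop (pot f \<alpha> \<theta> l) x)"
        using not_in_spec_iff[OF f] by blast
      have "eventually (\<lambda>n. D * \<bar>t (r n) - \<theta>\<bar> + \<bar>e (r n) - l\<bar> < c / 2) sequentially"
        using order_tendstoD(2)[OF small, of "c / 2"] c(1) by simp
      then obtain n where n: "D * \<bar>t (r n) - \<theta>\<bar> + \<bar>e (r n) - l\<bar> < c / 2"
        by (auto simp: eventually_sequentially)
      have "c / 2 * norm x \<le> norm (Jop (pot f \<alpha> (t (r n)) (e (r n))) x)" for x
      proof -
        have "norm (Jop (pot f \<alpha> \<theta> l) x) \<le> norm (Jop (pot f \<alpha> (t (r n)) (e (r n))) x) + c / 2 * norm x"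
        proof (rule norm_Jop_perturb)
          show "\<forall>n. \<bar>pot f \<alpha> \<theta> l n\<bar> \<le> B + \<bar>l\<bar>" using pot_bounded[OF f] by blast
          show "\<forall>i. \<bar>pot f \<alpha> (t (r n)) (e (r n)) i\<bar> \<le> B + \<bar>e (r n)\<bar>" using pot_bounded[OF f] by blast
          show "\<bar>pot f \<alpha> \<theta> l i - pot f \<alpha> (t (r n)) (e (r n)) i\<bar> \<le> c / 2" for i
          proof -
            let ?y = "f (\<alpha> * of_int i + \<theta>)" and ?z = "f (\<alpha> * of_int i + t (r n))"
            have "\<bar>?y - ?z\<bar> \<le> D * \<bar>t (r n) - \<theta>\<bar>"
              using lip[of "\<alpha> * of_int i + \<theta>" "\<alpha> * of_int i + t (r n)"] by (simp add: abs_minus_commute)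
            then have "\<bar>?y - ?z\<bar> + \<bar>e (r n) - l\<bar> \<le> c / 2" using n by simp
            then show ?thesis unfolding pot_def by linarith
          qed
        qed (use c in simp)
        then show ?thesis using c(2)[of x] by simp
      qed
      then have "e (r n) \<notin> spec f \<alpha> (t (r n))"
        unfolding not_in_spec_iff[OF f] using c(1) by (intro exI[of _ "c / 2"]) auto
      then show False using t(2) by blast
    qed
    then show "l \<in> specU f \<alpha>" by (auto simp: specU_def)
  qed
  ultimately show ?thesis by (simp add: compact_eq_bounded_closed)
qed

text \<open>The finite-scale form of a positive exponent. Prescribing a bound at every length, with
  a free phase, makes the condition closed in the energy and monotone in the rate.\<close>

definition growth_set :: "(real \<Rightarrow> real) \<Rightarrow> real \<Rightarrow> real \<Rightarrow> real set" where
  "growth_set f \<alpha> \<gamma> = {E. \<forall>n\<ge>1. \<exists>\<theta>. \<exists>i\<le>n. exp (\<gamma> * real n) / 4 \<le> \<bar>chi f \<alpha> E i \<theta>\<bar>}"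

lemma growth_set_antimono:
  assumes "\<gamma> \<le> \<gamma>'"
  shows "growth_set f \<alpha> \<gamma>' \<subseteq> growth_set f \<alpha> \<gamma>"
proof
  fix E assume E: "E \<in> growth_set f \<alpha> \<gamma>'"
  show "E \<in> growth_set f \<alpha> \<gamma>"
    unfolding growth_set_def
  proof (intro CollectI allI impI)
    fix n :: nat assume "1 \<le> n"
    then obtain \<theta> i where i: "i \<le> n" "exp (\<gamma>' * real n) / 4 \<le> \<bar>chi f \<alpha> E i \<theta>\<bar>"
      using E unfolding growth_set_def by blast
    have "exp (\<gamma> * real n) / 4 \<le> exp (\<gamma>' * real n) / 4" using assms by (simp add: mult_right_mono)
    then show "\<exists>\<theta>. \<exists>i\<le>n. exp (\<gamma> * real n) / 4 \<le> \<bar>chi f \<alpha> E i \<theta>\<bar>" using i by (meson order_trans)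
  qed
qed

text \<open>Periodicity restricts the phase to the unit interval, and the projection of a closed set
  along a compact factor is closed. Finite unions over the length and intersections over the scale
  preserve this.\<close>

lemma closed_growth_set:
  assumes cont: "continuous_on UNIV f" and per: "\<And>x. f (x + 1) = f x"
  shows "closed (growth_set f \<alpha> \<gamma>)"
proof -
  let ?T = "\<lambda>n i. {p. exp (\<gamma> * real n) / 4 \<le> \<bar>chi f \<alpha> (snd p) i (fst p)\<bar>}"
  have eq: "growth_set f \<alpha> \<gamma> = (\<Inter>n\<in>{1..}. \<Union>i\<in>{..n}. {E. \<exists>\<theta>. \<theta> \<in> {0..1} \<and> (\<theta>, E) \<in> ?T n i})"
  proof -
    have "(\<exists>\<theta>. c \<le> \<bar>chi f \<alpha> E i \<theta>\<bar>) \<longleftrightarrow> (\<exists>\<theta>. \<theta> \<in> {0..1} \<and> c \<le> \<bar>chi f \<alpha> E i \<theta>\<bar>)" for c E i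
    proof
      assume "\<exists>\<theta>. c \<le> \<bar>chi f \<alpha> E i \<theta>\<bar>"
      then obtain \<theta> where "c \<le> \<bar>chi f \<alpha> E i \<theta>\<bar>" by blast
      moreover have "chi f \<alpha> E i \<theta> = chi f \<alpha> E i (frac \<theta>)"
        using chi_add_int[of f \<alpha> E i "frac \<theta>" "\<lfloor>\<theta>\<rfloor>", OF per] by (simp add: frac_def)
      ultimately show "\<exists>\<theta>. \<theta> \<in> {0..1} \<and> c \<le> \<bar>chi f \<alpha> E i \<theta>\<bar>"
        using frac_lt_1[of \<theta>] by (intro exI[of _ "frac \<theta>"]) (simp add: less_imp_le)
    qed blast
    then have "(\<exists>\<theta>. \<exists>i\<le>n. c \<le> \<bar>chi f \<alpha> E i \<theta>\<bar>) \<longleftrightarrow>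
        (\<exists>i\<in>{..n}. E \<in> {E. \<exists>\<theta>. \<theta> \<in> {0..1} \<and> (\<theta>, E) \<in> {p. c \<le> \<bar>chi f \<alpha> (snd p) i (fst p)\<bar>}})" for n c E
      unfolding mem_Collect_eq fst_conv snd_conv atMost_iff Bex_def by meson
    then show ?thesis unfolding growth_set_def set_eq_iff by (simp only: INT_iff UN_iff mem_Collect_eq atLeast_iff) blast
  qed
  have "closed (?T n i)" for n i
    using continuous_on_chi[OF cont, of UNIV \<alpha> i]
    by (intro closed_Collect_le continuous_intros) auto
  then have "closed {E. \<exists>\<theta>. \<theta> \<in> {0..1} \<and> (\<theta>, E) \<in> ?T n i}" for n i
    by (intro closed_compact_projection) auto
  then show ?thesis unfolding eq by (intro closed_INT ballI closed_UN) auto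
qed

theorem theorem3:
  fixes f :: "real \<Rightarrow> real" and \<alpha> :: real
  assumes "real_analytic f"
    and "\<forall>x. f (x + 1) = f x"
    and "\<alpha> \<in> Omega"
    and "AE E in lborel. lyap f E \<alpha> > 0"
  shows "\<forall>\<delta>>0. \<exists>A h c. A \<subseteq> specU f \<alpha> \<and> A \<in> sets lebesgue \<and> emeasure lebesgue A < ennreal \<delta>
           \<and> h > 0 \<and> c > 0
           \<and> (\<forall>E \<in> specU f \<alpha> - A. \<forall>\<alpha>'. 0 < \<bar>\<alpha> - \<alpha>'\<bar> \<and> \<bar>\<alpha> - \<alpha>'\<bar> < h \<longrightarrow>
                 (\<exists>E' \<in> specU f \<alpha>'. \<bar>E' - E\<bar> < c * \<bar>(\<alpha> - \<alpha>') * (ln \<bar>\<alpha> - \<alpha>'\<bar>) ^ 3\<bar>))"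
proof (intro allI impI)
  fix \<delta> :: real assume "0 < \<delta>"
  have per: "\<And>x. f (x + 1) = f x" using assms(2) by blast
  obtain \<rho> B where ext: "0 < \<rho>" "0 \<le> B" "hol_ext \<rho> B f"
    using real_analytic_periodic_hol_ext[OF assms(1) per] by blast
  have f: "\<forall>x. \<bar>f x\<bar> \<le> B" using hol_ext_imp_bounded[OF ext(3,1)] by blast
  define D where "D = 8 * real 1 * B / \<rho>"
  have D0: "0 \<le> D" using ext by (simp add: D_def)
  have "hol_ext \<rho> (B * 2 ^ 1) f" by (rule hol_ext_mono[OF ext(3)]) (use ext(2) in simp)
  then have lip: "\<bar>f x - f y\<bar> \<le> D * \<bar>x - y\<bar>" for x y
    unfolding D_def by (rule hol_ext_imp_Lipschitz) (use ext f in auto)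
  have "D-lipschitz_on UNIV f" by (rule lipschitz_onI) (use lip D0 in \<open>auto simp: dist_real_def\<close>)
  then have cont: "continuous_on UNIV f" by (rule lipschitz_on_continuous_on)
  obtain \<eta> where \<eta>: "0 < \<eta>" "\<And>n. \<eta> \<le> frac (cf_rem \<alpha> n)" using Omega_frac_lower_bound[OF assms(3)] by blast
  have dioph: "0 < \<eta>\<^sup>2 / 4" "\<And>q p. 0 < q \<Longrightarrow> \<eta>\<^sup>2 / 4 / (real q)\<^sup>2 \<le> \<bar>real q * \<alpha> - of_int p\<bar>"
    using \<eta>(1) diophantine_of_frac_bound[OF \<eta>] by auto
  define R where "R = B + 2"
  obtain C where C: "0 < C" "\<And>E m \<theta>0 \<theta>. \<bar>E\<bar> \<le> R \<Longrightarrow> 1 \<le> m \<Longrightarrow> 1 \<le> \<bar>chi f \<alpha> E m \<theta>0\<bar> \<Longrightarrow>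
      (\<And>\<theta>'. \<bar>chi f \<alpha> E m \<theta>'\<bar> \<le> \<bar>chi f \<alpha> E m \<theta>0\<bar>) \<Longrightarrow>
      \<exists>i<C * m ^ 3. \<bar>chi f \<alpha> E m \<theta>0\<bar> / 2 \<le> \<bar>chi f \<alpha> E m (\<theta> + \<alpha> * real i)\<bar>"
    using orbit_meets_large_values[OF ext(3,1,2) per dioph, of R] by blast
  have cpt: "compact (specU f \<alpha>)" by (rule compact_specU[OF f per lip D0])

  \<comment> \<open>Spectral energies without growth at rate \<open>1 / (j + 1)\<close>. These sets
    decrease, have finite measure, and intersect only in energies where the exponent is not
    positive, so continuity from above makes one of them small.\<close>
  define A where "A = (\<lambda>j. specU f \<alpha> - growth_set f \<alpha> (1 / real (Suc j)))"
  have Aborel: "A j \<in> sets lborel" for j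
    unfolding A_def using closed_growth_set[OF cont per] cpt by (auto simp: compact_imp_closed)
  have "decseq A"
  proof (rule decseq_SucI)
    fix j
    have "1 / real (Suc (Suc j)) \<le> 1 / real (Suc j)" by (simp add: frac_le)
    then show "A (Suc j) \<subseteq> A j" unfolding A_def using growth_set_antimono by blast
  qed
  have fin: "emeasure lborel (A j) \<noteq> \<infinity>" for j
  proof -
    have "emeasure lborel (A j) \<le> emeasure lborel (specU f \<alpha>)"
      using cpt by (intro emeasure_mono) (auto simp: A_def compact_imp_closed)
    also have "\<dots> < \<infinity>" using emeasure_bounded_finite[OF compact_imp_bounded[OF cpt]] .
    finally show ?thesis by simp
  qed
  obtain N where N: "{E \<in> space lborel. \<not> 0 < lyap f E \<alpha>} \<subseteq> N" "emeasure lborel N = 0" "N \<in> sets lborel"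
    using AE_E[OF assms(4)] by blast
  have "(\<Inter>j. A j) \<subseteq> N"
  proof
    fix E assume E: "E \<in> (\<Inter>j. A j)"
    have "\<not> 0 < lyap f E \<alpha>"
    proof
      assume "0 < lyap f E \<alpha>"
      then obtain \<gamma> where \<gamma>: "0 < \<gamma>" "E \<in> growth_set f \<alpha> \<gamma>"
        using lyap_pos_imp_growth[OF cont per] unfolding growth_set_def by blast
      obtain j where "1 / real (Suc j) < \<gamma>" using \<gamma>(1) nat_approx_posE by metis
      then have "E \<in> growth_set f \<alpha> (1 / real (Suc j))" using \<gamma>(2) growth_set_antimono less_imp_le by blast
      then show False using E by (auto simp: A_def)
    qed
    then show "E \<in> N" using N(1) by auto
  qed
  then have "emeasure lborel (\<Inter>j. A j) = 0" using N(2,3) emeasure_mono[of "\<Inter>j. A j" N lborel] by simp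
  then have "(\<lambda>j. emeasure lborel (A j)) \<longlonglongrightarrow> 0"
    using Lim_emeasure_decseq[of A lborel] Aborel \<open>decseq A\<close> fin by auto
  then have "eventually (\<lambda>j. emeasure lborel (A j) < ennreal \<delta>) sequentially"
    using \<open>0 < \<delta>\<close> by (intro order_tendstoD) auto
  then obtain j where j: "emeasure lborel (A j) < ennreal \<delta>" by (auto simp: eventually_sequentially)

  define \<gamma> where "\<gamma> = 1 / real (Suc j)"
  have \<gamma>0: "0 < \<gamma>" by (simp add: \<gamma>_def)
  \<comment> \<open>Doubling the scale \<open>J\<close> times multiplies the exponent by
    \<open>2 ^ J\<close> while the requirement grows linearly, so some \<open>J\<close> works. It is
    fixed before \<open>E\<close> and \<alpha>' are chosen.\<close>
  have "(\<lambda>J. real J / 2 ^ J + (ln (R + B + 1) + ln 4) / 2 ^ J) \<longlonglongrightarrow> 0 + 0"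
    by (intro tendsto_add lim_n_over_pown LIMSEQ_divide_realpow_zero) auto
  then have "eventually (\<lambda>J. real J / 2 ^ J + (ln (R + B + 1) + ln 4) / 2 ^ J < \<gamma>) sequentially"
    using \<gamma>0 by (intro order_tendstoD(2)) auto
  then obtain J where "real J / 2 ^ J + (ln (R + B + 1) + ln 4) / 2 ^ J < \<gamma>"
    by (auto simp: eventually_sequentially)
  then have J: "real J + ln (R + B + 1) + ln 4 < \<gamma> * 2 ^ J" by (simp add: field_simps)

  \<comment> \<open>The 22 is the relative residual in units of \<open>d\<close>. The other term is
    the drift \<open>D * d * 2 L\<close> of the potential, with \<open>N \<le> 2 l\<close> inserted
    into the formula for \<open>L\<close>. Later \<open>K + 1\<close> makes the inequality
    strict.\<close>
  define K where "K = 22 + 2 * D * real C * (4 * 2 ^ J) ^ 3"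
  have K0: "22 \<le> K" using D0 by (simp add: K_def)
  have main: "\<exists>E'\<in>specU f \<alpha>'. \<bar>E' - E\<bar> < (K + 1) * \<bar>(\<alpha> - \<alpha>') * (ln \<bar>\<alpha> - \<alpha>'\<bar>) ^ 3\<bar>"
    if E: "E \<in> specU f \<alpha> - A j" and \<alpha>': "0 < \<bar>\<alpha> - \<alpha>'\<bar>" "\<bar>\<alpha> - \<alpha>'\<bar> < exp (- 1)" for E \<alpha>'
  proof -
    define d where "d = \<bar>\<alpha> - \<alpha>'\<bar>"
    define l where "l = - ln d"
    have d0: "0 < d" using \<alpha>' by (simp add: d_def)
    have "ln d < ln (exp (- 1))" using \<alpha>' by (subst ln_less_cancel_iff) (auto simp: d_def)
    then have l1: "1 < l" by (simp add: l_def)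
    \<comment> \<open>The least scale at which \<open>exp (- N)\<close> drops to \<open>d\<close>.
      Since \<open>d < exp (- 1)\<close> gives \<open>l > 1\<close>, both \<open>N < 2 l\<close> and
      \<open>d \<le> d * l ^ 3\<close> hold.\<close>
    define N where "N = nat \<lceil>l\<rceil>"
    have N: "l \<le> real N" "real N < l + 1" unfolding N_def using l1 by linarith+
    have N1: "1 \<le> N" using N(1) l1 by simp
    have "exp (- real N) \<le> exp (- l)" using N by simp
    also have "\<dots> = d" using d0 by (simp add: l_def)
    finally have expN: "exp (- real N) \<le> d" .
    obtain \<theta> where \<theta>: "E \<in> spec f \<alpha> \<theta>" using E by (auto simp: specU_def)
    have ER: "\<bar>E\<bar> \<le> R" using spec_bounded[OF f \<theta>] by (simp add: R_def)
    have grow: "\<And>n. 1 \<le> n \<Longrightarrow> \<exists>\<theta>. \<exists>i\<le>n. exp (\<gamma> * real n) / 4 \<le> \<bar>chi f \<alpha> E i \<theta>\<bar>"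
      using E unfolding A_def growth_set_def \<gamma>_def by blast
    define L where "L = int (C * (2 * 2 ^ J * N) ^ 3)"
    obtain \<psi> s where supp: "\<And>n. n \<notin> {s..<s + 2 * L} \<Longrightarrow> \<psi> n = 0"
      and approx: "(\<Sum>n\<in>{s - 1..s + 2 * L}. (cmod (jacobi (pot f \<alpha> \<theta> E) \<psi> n))\<^sup>2)
        < (22 * exp (- real N))\<^sup>2 * (\<Sum>n\<in>{s..<s + 2 * L}. (cmod (\<psi> n))\<^sup>2)"
      using localized_approx_eigenvector[OF f cont per ER C(1) C(2)[OF ER] grow J N1 \<theta> L_def] by blast
    have \<psi>: "\<psi> \<in> l2"
    proof -
      have "(\<lambda>n. (cmod (\<psi> n))\<^sup>2) summable_on UNIV \<longleftrightarrow> (\<lambda>n. (cmod (\<psi> n))\<^sup>2) summable_on {s..<s + 2 * L}"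
        by (rule summable_on_cong_neutral) (use supp in auto)
      then show ?thesis by (simp add: l2_iff)
    qed
    define x where "x = Abs_ell \<psi>"
    have rep: "Rep_ell x = \<psi>" using Abs_ell_inverse[OF \<psi>] by (simp add: x_def)
    have bd: "\<forall>n. \<bar>pot f \<alpha> \<theta> E n\<bar> \<le> B + \<bar>E\<bar>" for \<alpha> \<theta> using pot_bounded[OF f] by blast
    have "jacobi (pot f \<alpha> \<theta> E) \<psi> n = 0" if "n \<notin> {s - 1..s + 2 * L}" for n
      using that supp[of "n - 1"] supp[of n] supp[of "n + 1"] by (auto simp: jacobi_def)
    then have "(norm (Jop (pot f \<alpha> \<theta> E) x))\<^sup>2 = (\<Sum>n\<in>{s - 1..s + 2 * L}. (cmod (jacobi (pot f \<alpha> \<theta> E) \<psi> n))\<^sup>2)"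
      using norm_ell_finite_support[of "{s - 1..s + 2 * L}" "Jop (pot f \<alpha> \<theta> E) x"]
      unfolding Rep_Jop[OF bd] rep by blast
    moreover have "(norm x)\<^sup>2 = (\<Sum>n\<in>{s..<s + 2 * L}. (cmod (\<psi> n))\<^sup>2)"
      using norm_ell_finite_support[of "{s..<s + 2 * L}" x] supp by (simp add: rep)
    ultimately have sq: "(norm (Jop (pot f \<alpha> \<theta> E) x))\<^sup>2 < (22 * exp (- real N) * norm x)\<^sup>2"
      using approx by (simp add: power_mult_distrib)
    then have "x \<noteq> 0" by auto
    have "norm (Jop (pot f \<alpha> \<theta> E) x) \<le> 22 * exp (- real N) * norm x"
      by (rule power2_le_imp_le[OF less_imp_le[OF sq]]) simp
    also have "\<dots> \<le> 22 * d * norm x" using expN by (intro mult_right_mono) auto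
    finally have Ja: "norm (Jop (pot f \<alpha> \<theta> E) x) \<le> 22 * d * norm x" .
    \<comment> \<open>With this phase the arguments of \<open>f\<close> agree at the left end
      \<open>s\<close> of the support and differ by \<open>(\<alpha>' - \<alpha>) * (n - s)\<close>
      at site \<open>n\<close>, so the position of the support does not enter the error.\<close>
    define \<theta>' where "\<theta>' = \<theta> + (\<alpha> - \<alpha>') * of_int s"
    have L0: "0 \<le> L" by (simp add: L_def)
    have "norm (Jop (pot f \<alpha>' \<theta>' E) x) \<le> norm (Jop (pot f \<alpha> \<theta> E) x) + D * (d * of_int (2 * L)) * norm x"
    proof (rule norm_Jop_perturb[OF bd bd])
      show "0 \<le> D * (d * of_int (2 * L))" using D0 d0 L0 by simp
      fix n assume "Rep_ell x n \<noteq> 0"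
      then have n: "s \<le> n" "n < s + 2 * L" using supp[of n] by (auto simp: rep)
      have "\<bar>pot f \<alpha>' \<theta>' E n - pot f \<alpha> \<theta> E n\<bar>
          \<le> D * \<bar>(\<alpha>' * of_int n + \<theta>') - (\<alpha> * of_int n + \<theta>)\<bar>"
        using lip[of "\<alpha>' * of_int n + \<theta>'" "\<alpha> * of_int n + \<theta>"] by (simp add: pot_def)
      also have "(\<alpha>' * of_int n + \<theta>') - (\<alpha> * of_int n + \<theta>) = (\<alpha>' - \<alpha>) * of_int (n - s)"
        by (simp add: \<theta>'_def algebra_simps)
      also have "\<bar>(\<alpha>' - \<alpha>) * of_int (n - s)\<bar> = d * of_int (n - s)"
        using n by (simp add: abs_mult d_def abs_minus_commute)
      also have "D * (d * of_int (n - s)) \<le> D * (d * of_int (2 * L))"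
        using n D0 d0 by (intro mult_left_mono) (auto simp del: of_int_mult of_int_diff)
      finally show "\<bar>pot f \<alpha>' \<theta>' E n - pot f \<alpha> \<theta> E n\<bar> \<le> D * (d * of_int (2 * L))" .
    qed
    with Ja have "norm (Jop (pot f \<alpha>' \<theta>' E) x) \<le> (22 * d + D * (d * of_int (2 * L))) * norm x"
      by (simp add: algebra_simps)
    then obtain E' where E': "E' \<in> spec f \<alpha>' \<theta>'" "\<bar>E' - E\<bar> \<le> 22 * d + D * (d * of_int (2 * L))"
      using approx_eigenvector_imp_spec[OF f \<open>x \<noteq> 0\<close>] by blast
    have "22 * d + D * (d * of_int (2 * L)) \<le> K * (d * l ^ 3)"
    proof -
      have "d * 1 \<le> d * l ^ 3" using l1 d0 by (intro mult_left_mono one_le_power) auto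
      moreover have "D * (d * of_int (2 * L)) \<le> 2 * D * real C * (4 * 2 ^ J) ^ 3 * (d * l ^ 3)"
      proof -
        have "real (2 * 2 ^ J * N) \<le> 4 * 2 ^ J * l" using N(2) l1 by simp
        then have "real (2 * 2 ^ J * N) ^ 3 \<le> (4 * 2 ^ J * l) ^ 3" by (intro power_mono) auto
        then have "(2 * D * real C * d) * real (2 * 2 ^ J * N) ^ 3 \<le> (2 * D * real C * d) * (4 * 2 ^ J * l) ^ 3"
          using D0 d0 by (intro mult_left_mono) auto
        moreover have "D * (d * of_int (2 * L)) = (2 * D * real C * d) * real (2 * 2 ^ J * N) ^ 3"
          by (simp add: L_def)
        ultimately have "D * (d * of_int (2 * L)) \<le> (2 * D * real C * d) * (4 * 2 ^ J * l) ^ 3"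
          by (simp only:)
        also have "\<dots> = 2 * D * real C * (4 * 2 ^ J) ^ 3 * (d * l ^ 3)"
          unfolding power_mult_distrib[of "4 * 2 ^ J" l] by simp
        finally show ?thesis .
      qed
      ultimately show ?thesis by (simp add: K_def algebra_simps)
    qed
    also have "\<dots> < (K + 1) * (d * l ^ 3)" using d0 l1 by (intro mult_strict_right_mono) auto
    also have "d * l ^ 3 = \<bar>(\<alpha> - \<alpha>') * (ln \<bar>\<alpha> - \<alpha>'\<bar>) ^ 3\<bar>"
      using l1 by (simp add: abs_mult power_abs d_def l_def)
    finally show ?thesis using E' by (intro bexI[of _ E']) (auto simp: specU_def)
  qed
  show "\<exists>A h c. A \<subseteq> specU f \<alpha> \<and> A \<in> sets lebesgue \<and> emeasure lebesgue A < ennreal \<delta> \<and> h > 0 \<and> c > 0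
           \<and> (\<forall>E \<in> specU f \<alpha> - A. \<forall>\<alpha>'. 0 < \<bar>\<alpha> - \<alpha>'\<bar> \<and> \<bar>\<alpha> - \<alpha>'\<bar> < h \<longrightarrow>
                 (\<exists>E' \<in> specU f \<alpha>'. \<bar>E' - E\<bar> < c * \<bar>(\<alpha> - \<alpha>') * (ln \<bar>\<alpha> - \<alpha>'\<bar>) ^ 3\<bar>))"
  proof (intro exI conjI ballI allI impI)
    show "A j \<subseteq> specU f \<alpha>" by (auto simp: A_def)
    show "A j \<in> sets lebesgue" using Aborel by (rule sets_completionI_sets)
    show "emeasure lebesgue (A j) < ennreal \<delta>" using j Aborel[of j] by simp
    show "(0::real) < exp (- 1)" by simp
    show "0 < K + 1" using K0 by simp
  qed (use main in blast)
qed

end
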